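(* Let $A \in \mathbb{R}^{n\times m}$. The following are equivalent: (a) $\Gamma_A$ is a caterpillar forest; (b) $\mathcal{Q}^6(A)\subseteq\mathbf{P_0}$; (c) $\mathcal{Q}^4(A)\subseteq\mathbf{PS}$; (d) $\mathcal{Q}^{2k}(A)\subseteq\mathbf{P_0}$ for all $k\in\mathbb{N}$; (e) $\mathcal{Q}^{2k}(A)\subseteq\mathbf{PS}$ for all $k\in\mathbb{N}$.
   Context: For $A\in\mathbb{R}^{n\times m}$, $\mathcal{Q}(A)$ is the set of real $n\times m$ matrices $B$ with $\mathrm{sign}\,B_{ij}=\mathrm{sign}\,A_{ij}$ for all $i,j$. $\mathcal{Q}^{2k}(A)=\{A_1A_2^{\mathrm t}A_3A_4^{\mathrm t}\cdots A_{2k-1}A_{2k}^{\mathrm t}\colon A_i\in\mathcal{Q}(A)\}$. $\mathbf{P_0}$ is the set of real square matrices all of whose principal minors are nonnegative; $\mathbf{PS}$ is the set of real square matrices all of whose eigenvalues are real and nonnegative. $\Gamma_A$ is the bipartite graph with vertices $X_1,\dots,X_n,Y_1,\dots,Y_m$ and an edge $X_iY_j$ iff $A_{ij}\ne0$. A caterpillar is a tree which becomes a path on removal of its leaves; a caterpillar forest is a forest each of whose connected components is a caterpillar. *)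

theory Defs
  imports
    "Jordan_Normal_Form.Char_Poly"
    "Jordan_Normal_Form.DL_Submatrix"
    "Graph_Theory.Graph_Theory"
    Complex_Main
begin

section \<open>Qualitative classes and alternating products\<close>

definition qual_class :: "real mat \<Rightarrow> real mat set" where
  "qual_class A = {B \<in> carrier_mat (dim_row A) (dim_col A).
     \<forall>i < dim_row A. \<forall>j < dim_col A. sgn (B $$ (i, j)) = sgn (A $$ (i, j))}"

text \<open>For \<open>k \<ge> 1\<close>, \<open>alt_prod n F k\<close> is
  \<open>F 1 * (F 2)\<^sup>T * F 3 * (F 4)\<^sup>T * \<dots> * F (2k-1) * (F (2k))\<^sup>T\<close>,
  the leading factor \<open>1\<^sub>m n\<close> being neutral.\<close>

primrec alt_prod :: "nat \<Rightarrow> (nat \<Rightarrow> real mat) \<Rightarrow> nat \<Rightarrow> real mat" where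
  "alt_prod n F 0 = 1\<^sub>m n"
| "alt_prod n F (Suc k) = alt_prod n F k * F (2 * k + 1) * transpose_mat (F (2 * k + 2))"

text \<open>\<open>qual_power k A\<close> is \<open>\<Q>\<^sup>2\<^sup>k(A)\<close>: the index \<open>k\<close> is half the number of factors.\<close>

definition qual_power :: "nat \<Rightarrow> real mat \<Rightarrow> real mat set" where
  "qual_power k A = {alt_prod (dim_row A) F k | F. \<forall>i \<in> {1..2 * k}. F i \<in> qual_class A}"

definition P0_matrices :: "real mat set" where
  "P0_matrices = {M. square_mat M \<and> (\<forall>I \<subseteq> {..<dim_row M}. 0 \<le> det (submatrix M I I))}"

definition PS_matrices :: "real mat set" where
  "PS_matrices = {M. square_mat M \<and>
     (\<forall>z. eigenvalue (map_mat complex_of_real M) z \<longrightarrow> z \<in> \<real> \<and> 0 \<le> Re z)}"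

section \<open>Caterpillar forests\<close>

text \<open>Undirected graphs are symmetric digraphs (locale \<open>graph\<close>). In these, each edge traversed
  back and forth is a \<open>cycle\<close> of length 2, so \<open>Digraph_Component.forest\<close> and
  \<open>Digraph_Component.tree\<close> do not describe undirected forests and trees; the cycles of the
  undirected graph are those of length at least 3.\<close>

definition graph_forest :: "('a, 'b) pre_digraph \<Rightarrow> bool" where
  "graph_forest G \<longleftrightarrow> graph G \<and> \<not> (\<exists>p. pre_digraph.cycle G p \<and> 3 \<le> length p)"

definition graph_tree :: "('a, 'b) pre_digraph \<Rightarrow> bool" where
  "graph_tree G \<longleftrightarrow> graph_forest G \<and> Digraph_Component.connected G"

definition leaves :: "('a, 'b) pre_digraph \<Rightarrow> 'a set" where
  "leaves G = {v \<in> verts G. out_degree G v = 1}"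

text \<open>The graph without vertices counts as a path, so that a single edge is a caterpillar.\<close>

definition path_graph :: "('a, 'b) pre_digraph \<Rightarrow> bool" where
  "path_graph G \<longleftrightarrow> graph G \<and>
     (\<exists>vs. distinct vs \<and> set vs = verts G \<and>
        arcs_ends G = set (vwalk_arcs vs) \<union> (set (vwalk_arcs vs))\<inverse>)"

definition caterpillar :: "('a, 'b) pre_digraph \<Rightarrow> bool" where
  "caterpillar G \<longleftrightarrow> graph_tree G \<and> path_graph (G \<restriction> (verts G - leaves G))"

text \<open>In a symmetric digraph the strongly connected components are the connected components.\<close>

definition caterpillar_forest :: "('a, 'b) pre_digraph \<Rightarrow> bool" where
  "caterpillar_forest G \<longleftrightarrow> graph_forest G \<and> (\<forall>H \<in> pre_digraph.sccs G. caterpillar H)"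

text \<open>\<open>Inl i\<close> is the row vertex \<open>X\<^sub>i\<close> and \<open>Inr j\<close> the column vertex \<open>Y\<^sub>j\<close>, both indexed from 0.\<close>

definition bipartite_graph :: "real mat \<Rightarrow> (nat + nat) pair_pre_digraph" where
  "bipartite_graph A =
     (let E = {(Inl i, Inr j) | i j. i < dim_row A \<and> j < dim_col A \<and> A $$ (i, j) \<noteq> 0}
      in \<lparr>pverts = Inl ` {..<dim_row A} \<union> Inr ` {..<dim_col A}, parcs = E \<union> E\<inverse>\<rparr>)"

end

theory Submission
  imports Defs "Jordan_Normal_Form.Schur_Decomposition"
begin

text \<open>
  Listing the vertices of a caterpillar forest along its spines permutes the rows and columns of
  \<open>A\<close> into a staircase pattern, whose minors have at most one nonzero term in their Leibniz
  expansion. After a change of signs all matrices of the qualitative class are therefore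
  totally nonnegative, and by Cauchy--Binet so are their alternating products. Principal
  minors are then nonnegative. For the spectrum, the traces of powers of the compound
  matrices (perturbed by a totally positive kernel close to the identity, and shifted by a small
  multiple of the identity) are nonnegative, which forces the product of the \<open>k\<close> largest
  eigenvalues to be positive for each \<open>k\<close>.

  Conversely, the sets \<open>\<bold>P\<^sub>0\<close> and \<open>\<bold>P\<bold>S\<close> are closed, so entries may be set to zero. Reading a
  product of sparse matrices as tokens that move along the edges of the graph, a cycle produces
  the eigenvalue \<open>-1\<close> with four factors. If there are no cycles but some vertex has three
  neighbours that are not leaves, two tokens can be interchanged at this junction, which gives
  the eigenvalue \<open>-1\<close> with six factors, and four factors suffice for a non-real eigenvalue.
\<close>

section \<open>Cauchy--Binet formula\<close>

text \<open>Nonnegative traces only show that, among the eigenvalues of largest modulus of a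
  compound matrix, one is itself nonnegative; others may lie on the same circle. The shift by
  \<open>\<epsilon>\<close> excludes them: the circle of radius \<open>R\<close> about
  \<open>\<epsilon>\<close> meets the circle of radius \<open>R + \<epsilon>\<close> about
  \<open>0\<close> only in \<open>R + \<epsilon>\<close>. The shift needs a positive diagonal of the
  compound. This is what the kernel supplies: multiplied onto both sides, it spreads one nonzero
  minor to all minors of that size. Traces of compounds are sums of principal minors, so compound
  matrices never have to be built as matrices.

  In the converse, the value \<open>-1\<close> is chosen because the sum of all principal minors is
  \<open>det (1 + M)\<close> and the empty minor contributes \<open>1\<close>, so no matrix in
  \<open>P0_matrices\<close> can have it; neither can a matrix in \<open>PS_matrices\<close>. A
  cycle thus serves both classes. At a junction, an interchange takes three moves, each one pair of
  factors. With two pairs, tokens are split between staying and moving instead, and a non-real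
  eigenvalue is enough to leave \<open>PS_matrices\<close>.\<close>

definition ksubsets :: "nat \<Rightarrow> nat \<Rightarrow> nat set set" where
  "ksubsets n k = {K. K \<subseteq> {..<n} \<and> card K = k}"

lemma finite_ksubsets [simp]: "finite (ksubsets n k)"
  unfolding ksubsets_def by (rule finite_subset[of _ "Pow {..<n}"]) auto

lemma finite_ksubset: "K \<in> ksubsets n k \<Longrightarrow> finite K"
  unfolding ksubsets_def using finite_subset by auto

lemma pick_bij_betw:
  assumes "finite K"
  shows "bij_betw (pick K) {0..<card K} K"
proof -
  have inj: "inj_on (pick K) {0..<card K}"
    by (rule inj_onI) (metis atLeastLessThan_iff nat_neq_iff pick_mono_le)
  have "pick K ` {0..<card K} \<subseteq> K"
    using pick_in_set_le by auto
  then have "pick K ` {0..<card K} = K"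
    using inj assms by (metis card_image card_subset_eq card_atLeastLessThan minus_nat.diff_0)
  with inj show ?thesis by (simp add: bij_betw_def)
qed

lemma pick_ksubset: "K \<in> ksubsets n k \<Longrightarrow> i < k \<Longrightarrow> pick K i \<in> K \<and> pick K i < n"
  unfolding ksubsets_def using pick_in_set_le by auto

lemma submatrix_ksubsets:
  assumes "A \<in> carrier_mat n m" "I \<in> ksubsets n k" "J \<in> ksubsets m l"
  shows "submatrix A I J = mat k l (\<lambda>(i, j). A $$ (pick I i, pick J j))"
proof -
  have "{i. i < n \<and> i \<in> I} = I" "{j. j < m \<and> j \<in> J} = J"
    using assms unfolding ksubsets_def by auto
  then show ?thesis using assms unfolding submatrix_def ksubsets_def by auto
qed

lemma submatrix_carrier [simp]:
  assumes "A \<in> carrier_mat n m" "I \<in> ksubsets n k" "J \<in> ksubsets m l"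
  shows "submatrix A I J \<in> carrier_mat k l"
  using submatrix_ksubsets[OF assms] by simp

lemma permutes_below_iff: "p permutes {0..<k::nat} \<Longrightarrow> p i < k \<longleftrightarrow> i < k"
  using permutes_in_image[of p "{0..<k}" i] by simp

text \<open>Multilinearity in the rows of the product gives a sum over all functions
  \<open>f\<close> that choose a row of \<open>B\<close> for each row index. A repeated row kills
  the term. The injective \<open>f\<close> are grouped by their image \<open>K\<close>; within a
  group they differ by a permutation, whose sign rebuilds the minor of \<open>A\<close>.\<close>

lemma det_mult_rectangular:
  fixes A B :: "'a :: comm_ring_1 mat"
  assumes A: "A \<in> carrier_mat k n" and B: "B \<in> carrier_mat n k"
  shows "det (A * B) = (\<Sum>K\<in>ksubsets n k.
    det (mat k k (\<lambda>(i, j). A $$ (i, pick K j))) * det (mat k k (\<lambda>(i, j). B $$ (pick K i, j))))"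
proof -
  define F where "F = {f. (\<forall>i\<in>{0..<k}. f i \<in> {0..<n}) \<and> (\<forall>i. i \<notin> {0..<k} \<longrightarrow> f i = i)}"
  define G where "G f = (\<Prod>i=0..<k. A $$ (i, f i)) * det (mat\<^sub>r k k (\<lambda>i. row B (f i)))" for f
  have finF: "finite F" unfolding F_def by (rule finite_bounded_functions) auto
  have "det (A * B) = (\<Sum>f\<in>F. det (mat\<^sub>r k k (\<lambda>i. A $$ (i, f i) \<cdot>\<^sub>v row B (f i))))"
    unfolding mat_mul_finsum_alt[OF A B] F_def
    by (rule det_linear_rows_sum) (use A B in auto)
  also have "\<dots> = (\<Sum>f\<in>F. G f)"
    unfolding G_def F_def by (rule sum.cong[OF refl], rule det_rows_mul) (use B in auto)
  also have "\<dots> = (\<Sum>f\<in>{f \<in> F. inj_on f {0..<k}}. G f)"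
  proof (rule sum.mono_neutral_right[OF finF])
    show "\<forall>f\<in>F - {f \<in> F. inj_on f {0..<k}}. G f = 0"
    proof
      fix f assume "f \<in> F - {f \<in> F. inj_on f {0..<k}}"
      then obtain i j where ij: "f i = f j" "i \<noteq> j" "i < k" "j < k"
        unfolding inj_on_def by auto
      have "det (mat\<^sub>r k k (\<lambda>i. row B (f i))) = 0"
        by (rule det_identical_rows[OF _ ij(2-4)]) (use ij B in \<open>auto intro: mat_row_carrierI\<close>)
      then show "G f = 0" unfolding G_def by simp
    qed
  qed auto
  also have "\<dots> = (\<Sum>K\<in>ksubsets n k. \<Sum>f\<in>{f \<in> {f \<in> F. inj_on f {0..<k}}. f ` {0..<k} = K}. G f)"
    by (rule sum.group[symmetric])
      (simp add: finF, simp, auto simp: ksubsets_def F_def card_image)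
  also have "\<dots> = (\<Sum>K\<in>ksubsets n k.
    det (mat k k (\<lambda>(i, j). A $$ (i, pick K j))) * det (mat k k (\<lambda>(i, j). B $$ (pick K i, j))))"
  proof (rule sum.cong[OF refl])
    fix K assume K: "K \<in> ksubsets n k"
    let ?P = "{p. p permutes {0..<k}}"
    \<comment> \<open>\<open>pick K\<close> lists \<open>K\<close> in increasing order, so the
      injections with image \<open>K\<close> are its compositions with permutations of the
      indices.\<close>
    define h where "h p = (\<lambda>i. if i < k then pick K (p i) else i)" for p :: "nat \<Rightarrow> nat"
    have bK: "bij_betw (pick K) {0..<k} K"
      using pick_bij_betw[OF finite_ksubset[OF K]] K unfolding ksubsets_def by auto
    have bij: "bij_betw h ?P {f \<in> {f \<in> F. inj_on f {0..<k}}. f ` {0..<k} = K}"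
    proof (rule bij_betwI')
      fix p q assume "p \<in> ?P" "q \<in> ?P"
      then have p: "p permutes {0..<k}" and q: "q permutes {0..<k}" by auto
      show "(h p = h q) = (p = q)"
      proof
        assume eq: "h p = h q"
        show "p = q"
        proof
          fix i
          show "p i = q i"
          proof (cases "i < k")
            case True
            then have "pick K (p i) = pick K (q i)" using fun_cong[OF eq, of i] unfolding h_def by simp
            moreover have "p i \<in> {0..<k}" "q i \<in> {0..<k}"
              using True p q by (auto simp: permutes_below_iff)
            ultimately show ?thesis using bK unfolding bij_betw_def inj_on_def by blast
          next
            case False
            then show ?thesis using p q unfolding permutes_def by simp
          qed
        qed
      qed simp
    next
      fix p assume "p \<in> ?P"
      then have p: "p permutes {0..<k}" by simp
      have img: "h p ` {0..<k} = K"
      proof -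
        have "h p ` {0..<k} = pick K ` (p ` {0..<k})"
          unfolding h_def image_image by (rule image_cong) auto
        then show ?thesis using bK permutes_image[OF p] unfolding bij_betw_def by simp
      qed
      have "inj_on (h p) {0..<k}"
        using img K unfolding ksubsets_def by (intro eq_card_imp_inj_on) auto
      moreover have "h p \<in> F"
        unfolding F_def h_def using pick_ksubset[OF K] p by (auto simp: permutes_below_iff)
      ultimately show "h p \<in> {f \<in> {f \<in> F. inj_on f {0..<k}}. f ` {0..<k} = K}"
        using img by simp
    next
      fix f assume "f \<in> {f \<in> {f \<in> F. inj_on f {0..<k}}. f ` {0..<k} = K}"
      then have f: "f \<in> F" "inj_on f {0..<k}" "K = f ` {0..<k}" by auto
      define p where "p i = (if i < k then inv_into {0..<k} (pick K) (f i) else i)" for i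
      have pf: "pick K (p i) = f i \<and> p i < k" if "i < k" for i
      proof -
        have "f i \<in> pick K ` {0..<k}" using that f bK unfolding bij_betw_def by auto
        then show ?thesis using that inv_into_into[of "f i" "pick K" "{0..<k}"]
          unfolding p_def by (auto simp: f_inv_into_f)
      qed
      have "p permutes {0..<k}"
      proof (rule inj_on_nat_permutes)
        show "inj_on p {0..<k}"
          using pf f(2) unfolding inj_on_def by (metis atLeastLessThan_iff)
        show "p \<in> {0..<k} \<rightarrow> {0..<k}" using pf by auto
        show "finite {0..<k}" by simp
        show "p i = i" if "i \<notin> {0..<k}" for i using that unfolding p_def by simp
      qed
      moreover have "f = h p" using f pf unfolding h_def F_def by (auto simp: fun_eq_iff)
      ultimately show "\<exists>p\<in>?P. f = h p" by auto
    qed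
    have Gh: "G (h p) = signof p * (\<Prod>i=0..<k. A $$ (i, pick K (p i))) *
        det (mat k k (\<lambda>(i, j). B $$ (pick K i, j)))" if p: "p permutes {0..<k}" for p
    proof -
      have "mat\<^sub>r k k (\<lambda>i. row B (h p i)) =
          mat k k (\<lambda>(i, j). mat k k (\<lambda>(i, j). B $$ (pick K i, j)) $$ (p i, j))"
        by (rule eq_matI) (use p B pick_ksubset[OF K] in \<open>auto simp: h_def permutes_below_iff\<close>)
      then have "det (mat\<^sub>r k k (\<lambda>i. row B (h p i))) =
          signof p * det (mat k k (\<lambda>(i, j). B $$ (pick K i, j)))"
        by (simp add: det_permute_rows[OF mat_carrier p])
      moreover have "(\<Prod>i=0..<k. A $$ (i, h p i)) = (\<Prod>i=0..<k. A $$ (i, pick K (p i)))"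
        by (rule prod.cong) (auto simp: h_def)
      ultimately show ?thesis unfolding G_def by (simp add: ac_simps)
    qed
    have "(\<Sum>f\<in>{f \<in> {f \<in> F. inj_on f {0..<k}}. f ` {0..<k} = K}. G f) = (\<Sum>p\<in>?P. G (h p))"
      by (rule sum.reindex_bij_betw[OF bij, symmetric])
    also have "\<dots> = (\<Sum>p\<in>?P. signof p * (\<Prod>i=0..<k. A $$ (i, pick K (p i)))) *
        det (mat k k (\<lambda>(i, j). B $$ (pick K i, j)))"
      unfolding sum_distrib_right by (rule sum.cong) (auto simp: Gh)
    also have "(\<Sum>p\<in>?P. signof p * (\<Prod>i=0..<k. A $$ (i, pick K (p i)))) =
        det (mat k k (\<lambda>(i, j). A $$ (i, pick K j)))"
      unfolding det_def'[OF mat_carrier]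
      by (intro sum.cong refl arg_cong[where f = "\<lambda>x. _ * x"] prod.cong) (auto simp: permutes_below_iff)
    finally show "(\<Sum>f\<in>{f \<in> {f \<in> F. inj_on f {0..<k}}. f ` {0..<k} = K}. G f) =
      det (mat k k (\<lambda>(i, j). A $$ (i, pick K j))) * det (mat k k (\<lambda>(i, j). B $$ (pick K i, j)))" .
  qed
  finally show ?thesis .
qed

theorem Cauchy_Binet:
  fixes A B :: "'a :: comm_ring_1 mat"
  assumes A: "A \<in> carrier_mat a n" and B: "B \<in> carrier_mat n b"
    and I: "I \<in> ksubsets a k" and J: "J \<in> ksubsets b k"
  shows "det (submatrix (A * B) I J) =
    (\<Sum>K\<in>ksubsets n k. det (submatrix A I K) * det (submatrix B K J))"
proof -
  have "submatrix (A * B) I J =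
      mat k n (\<lambda>(i, j). A $$ (pick I i, j)) * mat n k (\<lambda>(i, j). B $$ (i, pick J j))"
    unfolding submatrix_ksubsets[OF mult_carrier_mat[OF A B] I J]
    by (rule eq_matI) (use A B pick_ksubset[OF I] pick_ksubset[OF J] in
      \<open>auto simp: scalar_prod_def intro!: sum.cong\<close>)
  then show ?thesis
    apply (simp add: det_mult_rectangular[OF mat_carrier mat_carrier])
    apply (rule sum.cong[OF refl])
    apply (subst submatrix_ksubsets[OF A I], assumption)
    apply (subst submatrix_ksubsets[OF B _ J], assumption)
    apply (intro arg_cong2[where f = "(*)"] arg_cong[where f = det] eq_matI)
    using pick_ksubset by auto
qed

section \<open>Sums of principal minors and the spectrum\<close>

text \<open>The trace of the \<open>k\<close>-th compound matrix; over the complex numbers, the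
  \<open>k\<close>-th elementary symmetric function of the eigenvalues.\<close>

definition minor_sum :: "nat \<Rightarrow> 'a :: comm_ring_1 mat \<Rightarrow> 'a" where
  "minor_sum k M = (\<Sum>I\<in>ksubsets (dim_row M) k. det (submatrix M I I))"

text \<open>By Cauchy--Binet both sides are the same double sum over pairs of index sets, as for the
  trace of a product.\<close>

lemma minor_sum_mult_commute:
  fixes A B :: "'a :: comm_ring_1 mat"
  assumes A: "A \<in> carrier_mat n m" and B: "B \<in> carrier_mat m n"
  shows "minor_sum k (A * B) = minor_sum k (B * A)"
proof -
  have "minor_sum k (A * B) = (\<Sum>I\<in>ksubsets n k. \<Sum>K\<in>ksubsets m k.
      det (submatrix A I K) * det (submatrix B K I))"
    unfolding minor_sum_def using A by (intro sum.cong) (auto simp: Cauchy_Binet[OF A B])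
  also have "\<dots> = (\<Sum>K\<in>ksubsets m k. \<Sum>I\<in>ksubsets n k.
      det (submatrix B K I) * det (submatrix A I K))"
    by (subst sum.swap) (simp add: mult.commute)
  also have "\<dots> = minor_sum k (B * A)"
    unfolding minor_sum_def using B by (intro sum.cong) (auto simp: Cauchy_Binet[OF B A])
  finally show ?thesis .
qed

lemma minor_sum_similar:
  assumes A: "A \<in> carrier_mat n n" and sim: "similar_mat_wit A B P Q"
  shows "minor_sum k A = minor_sum k B"
proof -
  note D = similar_mat_witD2[OF A sim]
  have "minor_sum k A = minor_sum k (Q * (P * B))"
    unfolding D(3) using D by (intro minor_sum_mult_commute) auto
  also have "Q * (P * B) = B"
    using assoc_mult_mat[OF D(7) D(6) D(5)] D(2,5) by simp
  finally show ?thesis .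
qed

lemma upper_triangular_mult:
  fixes A B :: "'a :: comm_ring_1 mat"
  assumes A: "A \<in> carrier_mat n n" "upper_triangular A"
    and B: "B \<in> carrier_mat n n" "upper_triangular B"
  shows "upper_triangular (A * B)"
    and "i < n \<Longrightarrow> (A * B) $$ (i, i) = A $$ (i, i) * B $$ (i, i)"
proof -
  show "upper_triangular (A * B)"
  proof
    fix i j assume ji: "j < i" and i: "i < dim_row (A * B)"
    have "(A * B) $$ (i, j) = (\<Sum>l = 0..<n. A $$ (i, l) * B $$ (l, j))"
      using A B ji i by (simp add: scalar_prod_def)
    also have "\<dots> = 0"
    proof (rule sum.neutral, rule ballI)
      fix l assume l: "l \<in> {0..<n}"
      show "A $$ (i, l) * B $$ (l, j) = 0"
        using upper_triangularD[OF A(2), of l i] upper_triangularD[OF B(2), of j l] l i A B ji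
        by (cases "l < i") auto
    qed
    finally show "(A * B) $$ (i, j) = 0" .
  qed
  assume i: "i < n"
  have "(A * B) $$ (i, i) = (\<Sum>l = 0..<n. A $$ (i, l) * B $$ (l, i))"
    using A B i by (simp add: scalar_prod_def)
  also have "\<dots> = (\<Sum>l\<in>{i}. A $$ (i, l) * B $$ (l, i))"
  proof (rule sum.mono_neutral_right)
    show "\<forall>l\<in>{0..<n} - {i}. A $$ (i, l) * B $$ (l, i) = 0"
    proof
      fix l assume l: "l \<in> {0..<n} - {i}"
      show "A $$ (i, l) * B $$ (l, i) = 0"
        using upper_triangularD[OF A(2), of l i] upper_triangularD[OF B(2), of i l] l i A B
        by (cases "l < i") auto
    qed
  qed (use i in auto)
  finally show "(A * B) $$ (i, i) = A $$ (i, i) * B $$ (i, i)" by simp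
qed

lemma upper_triangular_power:
  fixes A :: "'a :: comm_ring_1 mat"
  assumes A: "A \<in> carrier_mat n n" "upper_triangular A"
  shows "upper_triangular (A ^\<^sub>m q) \<and> (\<forall>i<n. (A ^\<^sub>m q) $$ (i, i) = (A $$ (i, i)) ^ q)"
proof (induction q)
  case (Suc q)
  then show ?case using A upper_triangular_mult[OF pow_carrier_mat[OF A(1)] _ A, of q]
    by (simp add: mult.commute)
qed (use A in auto)

lemma det_principal_upper_triangular:
  fixes B :: "'a :: comm_ring_1 mat"
  assumes B: "B \<in> carrier_mat n n" "upper_triangular B" and I: "I \<in> ksubsets n k"
  shows "det (submatrix B I I) = (\<Prod>i\<in>I. B $$ (i, i))"
proof -
  have cI: "card I = k" using I unfolding ksubsets_def by simp
  have "upper_triangular (submatrix B I I)"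
  proof
    fix i j assume "j < i" "i < dim_row (submatrix B I I)"
    then show "submatrix B I I $$ (i, j) = 0"
      using upper_triangularD[OF B(2), of "pick I j" "pick I i"] pick_mono_le[of i I j]
        pick_ksubset[OF I, of i] cI B
      by (simp add: submatrix_ksubsets[OF B(1) I I])
  qed
  then have "det (submatrix B I I) = prod_list (diag_mat (submatrix B I I))"
    by (rule det_upper_triangular) (rule submatrix_carrier[OF B(1) I I])
  also have "\<dots> = (\<Prod>i = 0..<k. B $$ (pick I i, pick I i))"
    unfolding prod_list_diag_prod by (simp add: submatrix_ksubsets[OF B(1) I I])
  also have "\<dots> = (\<Prod>i\<in>I. B $$ (i, i))"
    using prod.reindex_bij_betw[OF pick_bij_betw[OF finite_ksubset[OF I]]] cI by simp
  finally show ?thesis .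
qed

text \<open>A Schur triangularisation can list the eigenvalues in any prescribed order, here by
  decreasing modulus. The principal minors of a triangular matrix are products of diagonal entries,
  and the same holds for its powers. The last conclusion serves the sizes at which the matrix has no
  nonzero minor.\<close>

lemma complex_spectrum_minor_sums:
  fixes M :: "complex mat"
  assumes M: "M \<in> carrier_mat n n"
  obtains es where "length es = n" "sorted_wrt (\<lambda>a b. cmod b \<le> cmod a) es"
    "\<And>z. eigenvalue M z \<longleftrightarrow> z \<in> set es"
    "\<And>z. poly (char_poly M) z = (\<Prod>a\<leftarrow>es. z - a)"
    "\<And>k q. minor_sum k (M ^\<^sub>m q) = (\<Sum>I\<in>ksubsets n k. (\<Prod>i\<in>I. es ! i) ^ q)"
    "\<And>k I. \<forall>I\<in>ksubsets n k. \<forall>J\<in>ksubsets n k. det (submatrix M I J) = 0 \<Longrightarrow>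
      I \<in> ksubsets n k \<Longrightarrow> (\<Prod>i\<in>I. es ! i) = 0"
proof -
  from char_poly_factorized[OF M] obtain as
    where as: "char_poly M = (\<Prod>a\<leftarrow>as. [:- a, 1:])" "length as = n" by blast
  define es where "es = rev (sort_key cmod as)"
  have ms: "mset es = mset as" unfolding es_def by simp
  have len: "length es = n" unfolding es_def using as by simp
  have cp: "char_poly M = (\<Prod>a\<leftarrow>es. [:- a, 1:])"
    unfolding as(1) prod_mset_prod_list[symmetric] mset_map ms ..
  have srt: "sorted_wrt (\<lambda>a b. cmod b \<le> cmod a) es"
    unfolding es_def sorted_wrt_rev using sorted_sort_key[of cmod as] by (simp add: sorted_wrt_map)
  obtain B P Q where "schur_decomposition M es = (B, P, Q)" by (metis prod_cases3)
  from schur_decomposition[OF M cp this]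
  have sim: "similar_mat_wit M B P Q" and ut: "upper_triangular B" and dg: "diag_mat B = es" by auto
  note D = similar_mat_witD2[OF M sim]
  have Bi: "B $$ (i, i) = es ! i" if "i < n" for i
    using that D(5) unfolding dg[symmetric] diag_mat_def by simp
  have evalp: "poly (char_poly M) z = (\<Prod>a\<leftarrow>es. z - a)" for z
    unfolding cp by (induction es) (auto simp: algebra_simps)
  have ev: "eigenvalue M z \<longleftrightarrow> z \<in> set es" for z
    unfolding eigenvalue_root_char_poly[OF M] evalp by (induction es) auto
  have ms: "minor_sum k (M ^\<^sub>m q) = (\<Sum>I\<in>ksubsets n k. (\<Prod>i\<in>I. es ! i) ^ q)" for k q
  proof -
    have Bq: "B ^\<^sub>m q \<in> carrier_mat n n" using D(5) by simp
    note u = upper_triangular_power[OF D(5) ut, of q]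
    have "minor_sum k (M ^\<^sub>m q) = minor_sum k (B ^\<^sub>m q)"
      by (rule minor_sum_similar[OF pow_carrier_mat[OF M] similar_mat_wit_pow[OF sim]])
    also have "\<dots> = (\<Sum>I\<in>ksubsets n k. (\<Prod>i\<in>I. es ! i) ^ q)"
      unfolding minor_sum_def
    proof (rule sum.cong)
      fix I assume I: "I \<in> ksubsets n k"
      have "det (submatrix (B ^\<^sub>m q) I I) = (\<Prod>i\<in>I. (B ^\<^sub>m q) $$ (i, i))"
        by (rule det_principal_upper_triangular[OF Bq _ I]) (use u in simp)
      also have "\<dots> = (\<Prod>i\<in>I. es ! i ^ q)"
        using I u Bi unfolding ksubsets_def by (intro prod.cong) auto
      finally show "det (submatrix (B ^\<^sub>m q) I I) = (\<Prod>i\<in>I. es ! i) ^ q"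
        by (simp add: prod_power_distrib)
    qed (use D in simp)
    finally show ?thesis .
  qed
  have z: "(\<Prod>i\<in>I. es ! i) = 0"
    if zero: "\<forall>I\<in>ksubsets n k. \<forall>J\<in>ksubsets n k. det (submatrix M I J) = 0"
      and I: "I \<in> ksubsets n k" for k I
  proof -
    have BQ: "B = Q * M * P" using similar_mat_witD2(3)[OF D(5) similar_mat_wit_sym[OF sim]] .
    have "det (submatrix B I I) = 0"
      unfolding BQ using D(6,7) M I zero by (simp add: Cauchy_Binet[of _ n n _ n _ k])
    then show ?thesis using det_principal_upper_triangular[OF D(5) ut I] Bi I
      by (simp add: ksubsets_def subset_eq)
  qed
  from that[OF len srt ev evalp ms z] show thesis .
qed

lemma submatrix_map_mat:
  assumes M: "M \<in> carrier_mat n m" and I: "I \<in> ksubsets n k" and J: "J \<in> ksubsets m l"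
  shows "submatrix (map_mat f M) I J = map_mat f (submatrix M I J)"
proof -
  have fM: "map_mat f M \<in> carrier_mat n m" using M by simp
  show ?thesis
    unfolding submatrix_ksubsets[OF M I J] submatrix_ksubsets[OF fM I J]
    by (rule eq_matI) (use pick_ksubset[OF I] pick_ksubset[OF J] M in auto)
qed

lemma minor_sum_of_real:
  fixes M :: "real mat"
  assumes "M \<in> carrier_mat n n"
  shows "minor_sum k (map_mat complex_of_real M) = complex_of_real (minor_sum k M)"
  using assms unfolding minor_sum_def by (simp add: submatrix_map_mat of_real_hom.hom_det)

lemma map_mat_of_real_pow:
  fixes M :: "real mat"
  assumes M: "M \<in> carrier_mat n n"
  shows "map_mat complex_of_real M ^\<^sub>m q = map_mat complex_of_real (M ^\<^sub>m q)"
proof (induction q)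
  case (Suc q)
  then show ?case using M by (simp add: of_real_hom.mat_hom_mult[OF pow_carrier_mat[OF M] M])
qed (use M in \<open>auto simp: of_real_hom.mat_hom_one\<close>)

text \<open>The sum of all principal minors of \<open>M\<close> is the product of the \<open>1 + \<lambda>\<close> over the eigenvalues.\<close>

lemma P0_no_eigenvalue_minus_one:
  assumes "M \<in> P0_matrices"
  shows "\<not> eigenvalue (map_mat complex_of_real M) (-1)"
proof
  assume ev: "eigenvalue (map_mat complex_of_real M) (-1)"
  define n where "n = dim_row M"
  have M: "M \<in> carrier_mat n n" and P0: "\<And>I. I \<subseteq> {..<n} \<Longrightarrow> 0 \<le> det (submatrix M I I)"
    using assms unfolding P0_matrices_def n_def by auto
  let ?C = "map_mat complex_of_real M"
  have C: "?C \<in> carrier_mat n n" using M by simp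
  obtain es where es: "length es = n" "\<And>z. eigenvalue ?C z \<longleftrightarrow> z \<in> set es"
    and ms: "\<And>k q. minor_sum k (?C ^\<^sub>m q) = (\<Sum>I\<in>ksubsets n k. (\<Prod>i\<in>I. es ! i) ^ q)"
    by (rule complex_spectrum_minor_sums[OF C]) (rule that)
  have eq: "complex_of_real (minor_sum k M) = (\<Sum>I\<in>ksubsets n k. \<Prod>i\<in>I. es ! i)" for k
    using ms[of k 1] M by (simp add: minor_sum_of_real[OF M, symmetric])
  from ev es obtain i where i: "i < n" "es ! i = -1" by (metis in_set_conv_nth)
  have "0 = (\<Prod>i<n. 1 + es ! i)" using i by (subst prod_zero) force+
  also have "\<dots> = (\<Sum>I\<in>Pow {..<n}. \<Prod>i\<in>I. es ! i)"
    using prod_add[of "{..<n}" "\<lambda>i. es ! i" "\<lambda>_. 1"] by (simp add: add.commute)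
  also have "\<dots> = (\<Sum>k\<in>{..n}. \<Sum>I\<in>{I \<in> Pow {..<n}. card I = k}. \<Prod>i\<in>I. es ! i)"
    by (rule sum.group[symmetric]) (auto intro: order.trans[OF card_mono[of "{..<n}"]])
  also have "\<dots> = (\<Sum>k\<in>{..n}. complex_of_real (minor_sum k M))"
    unfolding eq ksubsets_def by (simp add: Pow_def)
  finally have "(\<Sum>k\<in>{..n}. minor_sum k M) = 0"
    by (metis of_real_0 of_real_eq_iff of_real_sum)
  moreover have nn: "minor_sum k M \<ge> 0" for k
    unfolding minor_sum_def using P0 M by (auto simp: ksubsets_def intro!: sum_nonneg)
  \<comment> \<open>Nonnegative summands with total \<open>0\<close> all vanish, but the empty
    principal minor is \<open>1\<close>.\<close>
  ultimately have "minor_sum 0 M = 0"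
    by (simp add: sum_nonneg_eq_0_iff)
  moreover have "ksubsets n 0 = {{}}" unfolding ksubsets_def by (auto dest: finite_subset)
  ultimately show False using M
    by (simp add: minor_sum_def submatrix_ksubsets[OF M, of _ 0 _ 0])
qed

section \<open>Nonnegative power sums\<close>

text \<open>For \<open>w \<noteq> 1\<close> the geometric sums stay bounded by
  \<open>2 / cmod (1 - w)\<close>, so their means tend to \<open>0\<close>.\<close>

lemma power_mean_tendsto:
  fixes w :: complex
  assumes "cmod w \<le> 1"
  shows "(\<lambda>N. (\<Sum>p<N. w ^ p) / of_nat N) \<longlonglongrightarrow> (if w = 1 then 1 else 0)"
proof (cases "w = 1")
  case True
  have "\<forall>\<^sub>F N in sequentially. 1 = (\<Sum>p<N. w ^ p) / of_nat N"
    using eventually_gt_at_top[of 0] by eventually_elim (simp add: True)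
  then show ?thesis using True by (simp add: tendsto_eventually eventually_mono)
next
  case False
  have "(\<lambda>N. (2 / cmod (1 - w)) * inverse (real N)) \<longlonglongrightarrow> (2 / cmod (1 - w)) * 0"
    by (intro tendsto_mult_left lim_inverse_n)
  then have lim: "(\<lambda>N. (2 / cmod (1 - w)) * inverse (real N)) \<longlonglongrightarrow> 0" by simp
  have "(\<lambda>N. (\<Sum>p<N. w ^ p) / of_nat N) \<longlonglongrightarrow> 0"
  proof (rule tendsto_norm_zero_cancel, rule tendsto_sandwich[OF _ _ tendsto_const lim]; intro always_eventually allI)
    fix N
    show "0 \<le> norm ((\<Sum>p<N. w ^ p) / of_nat N)" by simp
    have "cmod (1 - w ^ N) \<le> 1 + cmod w ^ N"
      using norm_triangle_ineq4[of 1 "w ^ N"] by (simp add: norm_power)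
    also have "\<dots> \<le> 2" using power_le_one[of "cmod w" N] assms by simp
    finally have "cmod (1 - w ^ N) \<le> 2" .
    moreover have "(\<Sum>p<N. w ^ p) = (1 - w ^ N) / (1 - w)"
      using sum_gp_strict[of w N] False by simp
    ultimately have "cmod (\<Sum>p<N. w ^ p) \<le> 2 / cmod (1 - w)"
      by (simp add: norm_divide divide_right_mono)
    then show "norm ((\<Sum>p<N. w ^ p) / of_nat N) \<le> (2 / cmod (1 - w)) * inverse (real N)"
      by (simp add: norm_divide divide_inverse norm_mult norm_inverse mult_right_mono)
  qed
  then show ?thesis using False by simp
qed

text \<open>A Pringsheim-type statement. If the normalised points avoided 1, the power sums would have
  Cesaro mean 0 while the mean of their squares stays at least 1; bounded nonnegative
  sequences do not do that.\<close>

lemma nonneg_power_sums_dominant: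
  fixes \<mu> :: "'i \<Rightarrow> complex"
  assumes fin: "finite S" and ne: "S \<noteq> {}"
    and pos: "\<And>p. \<exists>r\<ge>0. (\<Sum>i\<in>S. \<mu> i ^ p) = complex_of_real r"
  shows "\<exists>i\<in>S. \<mu> i = complex_of_real (cmod (\<mu> i)) \<and> (\<forall>j\<in>S. cmod (\<mu> j) \<le> cmod (\<mu> i))"
proof -
  define R where "R = Max ((\<lambda>i. cmod (\<mu> i)) ` S)"
  have le: "cmod (\<mu> j) \<le> R" if "j \<in> S" for j
    unfolding R_def using that fin by (intro Max_ge) auto
  have "R \<in> (\<lambda>i. cmod (\<mu> i)) ` S" unfolding R_def using fin ne by (intro Max_in) auto
  then obtain m where m: "m \<in> S" "cmod (\<mu> m) = R" by auto
  show ?thesis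
  proof (cases "R = 0")
    case True
    with m le show ?thesis by (intro bexI[of _ m]) auto
  next
    case False
    with m have R: "R > 0" by (metis norm_ge_zero order_le_less)
    define \<nu> where "\<nu> i = \<mu> i / of_real R" for i
    have n1: "cmod (\<nu> i) \<le> 1" if "i \<in> S" for i
      using le[OF that] R unfolding \<nu>_def by (simp add: norm_divide)
    show ?thesis
    proof (rule ccontr)
      assume contr: "\<not> ?thesis"
      have not1: "\<nu> i \<noteq> 1" if "i \<in> S" for i
      proof
        assume "\<nu> i = 1"
        then have "\<mu> i = of_real R" using R unfolding \<nu>_def by simp
        then have "\<mu> i = complex_of_real (cmod (\<mu> i)) \<and> (\<forall>j\<in>S. cmod (\<mu> j) \<le> cmod (\<mu> i))"
          using R le by simp
        with contr that show False by blast
      qed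
      define b where "b p = Re (\<Sum>i\<in>S. \<nu> i ^ p)" for p
      have b: "b p \<ge> 0 \<and> (\<Sum>i\<in>S. \<nu> i ^ p) = of_real (b p)" for p
      proof -
        obtain r where r: "r \<ge> 0" "(\<Sum>i\<in>S. \<mu> i ^ p) = complex_of_real r" using pos by blast
        have "(\<Sum>i\<in>S. \<nu> i ^ p) = (\<Sum>i\<in>S. \<mu> i ^ p) / of_real R ^ p"
          unfolding \<nu>_def by (simp add: power_divide sum_divide_distrib)
        also have "\<dots> = of_real (r / R ^ p)" using r by simp
        finally show ?thesis unfolding b_def using r R by simp
      qed
      have bound: "b p \<le> card S" for p
      proof -
        have "b p \<le> cmod (\<Sum>i\<in>S. \<nu> i ^ p)" unfolding b_def by (rule complex_Re_le_cmod)
        also have "\<dots> \<le> (\<Sum>i\<in>S. 1)"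
          by (rule sum_norm_le) (use n1 in \<open>auto simp: norm_power power_le_one\<close>)
        finally show ?thesis by simp
      qed
      have mean1: "(\<lambda>N. (\<Sum>p<N. b p) / N) \<longlonglongrightarrow> 0"
      proof -
        have "(\<lambda>N. (\<Sum>p<N. \<nu> i ^ p) / of_nat N) \<longlonglongrightarrow> 0" if "i \<in> S" for i
          using power_mean_tendsto[OF n1[OF that]] not1[OF that] by simp
        then have "(\<lambda>N. \<Sum>i\<in>S. (\<Sum>p<N. \<nu> i ^ p) / of_nat N) \<longlonglongrightarrow> (\<Sum>i\<in>S. 0)"
          by (intro tendsto_sum)
        also have "(\<lambda>N. \<Sum>i\<in>S. (\<Sum>p<N. \<nu> i ^ p) / of_nat N) =
            (\<lambda>N. complex_of_real ((\<Sum>p<N. b p) / N))"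
        proof
          fix N
          have "(\<Sum>i\<in>S. (\<Sum>p<N. \<nu> i ^ p) / of_nat N) = (\<Sum>p<N. \<Sum>i\<in>S. \<nu> i ^ p) / of_nat N"
            unfolding sum_divide_distrib[symmetric] by (subst sum.swap) simp
          also have "\<dots> = complex_of_real ((\<Sum>p<N. b p) / N)" using b by simp
          finally show "(\<Sum>i\<in>S. (\<Sum>p<N. \<nu> i ^ p) / of_nat N) =
            complex_of_real ((\<Sum>p<N. b p) / N)" .
        qed
        finally have "(\<lambda>N. complex_of_real ((\<Sum>p<N. b p) / N)) \<longlonglongrightarrow> of_real 0" by simp
        then show ?thesis unfolding tendsto_of_real_iff .
      qed
      \<comment> \<open>\<open>c\<close> is the limit of the means of \<open>b p * b p\<close>: as
        \<open>b p\<close> is real, its square is the power sum times its conjugate, a double sum of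
        powers of \<open>\<nu> i * cnj (\<nu> j)\<close>.\<close>
      define c where "c = (\<Sum>i\<in>S. \<Sum>j\<in>S. if \<nu> i * cnj (\<nu> j) = 1 then 1 else 0 :: complex)"
      have mean2: "(\<lambda>N. complex_of_real ((\<Sum>p<N. b p * b p) / N)) \<longlonglongrightarrow> c"
      proof -
        have "(\<lambda>N. \<Sum>i\<in>S. \<Sum>j\<in>S. (\<Sum>p<N. (\<nu> i * cnj (\<nu> j)) ^ p) / of_nat N) \<longlonglongrightarrow> c"
          unfolding c_def
        proof (intro tendsto_sum power_mean_tendsto)
          fix i j assume "i \<in> S" "j \<in> S"
          then show "cmod (\<nu> i * cnj (\<nu> j)) \<le> 1" using n1 by (simp add: norm_mult mult_le_one)
        qed
        also have "(\<lambda>N. \<Sum>i\<in>S. \<Sum>j\<in>S. (\<Sum>p<N. (\<nu> i * cnj (\<nu> j)) ^ p) / of_nat N) =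
            (\<lambda>N. complex_of_real ((\<Sum>p<N. b p * b p) / N))"
        proof
          fix N
          have sq: "(\<Sum>i\<in>S. \<Sum>j\<in>S. (\<nu> i * cnj (\<nu> j)) ^ p) = of_real (b p * b p)" for p
          proof -
            have "(\<Sum>i\<in>S. \<Sum>j\<in>S. (\<nu> i * cnj (\<nu> j)) ^ p) =
                (\<Sum>i\<in>S. \<nu> i ^ p) * cnj (\<Sum>j\<in>S. \<nu> j ^ p)"
              by (simp add: sum_product power_mult_distrib)
            then show ?thesis using b by simp
          qed
          have "(\<Sum>i\<in>S. \<Sum>j\<in>S. (\<Sum>p<N. (\<nu> i * cnj (\<nu> j)) ^ p) / of_nat N) =
              (\<Sum>p<N. \<Sum>i\<in>S. \<Sum>j\<in>S. (\<nu> i * cnj (\<nu> j)) ^ p) / of_nat N"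
          proof -
            have "(\<Sum>i\<in>S. \<Sum>j\<in>S. \<Sum>p<N. (\<nu> i * cnj (\<nu> j)) ^ p) =
                (\<Sum>i\<in>S. \<Sum>p<N. \<Sum>j\<in>S. (\<nu> i * cnj (\<nu> j)) ^ p)"
              by (rule sum.cong[OF refl], rule sum.swap)
            also have "\<dots> = (\<Sum>p<N. \<Sum>i\<in>S. \<Sum>j\<in>S. (\<nu> i * cnj (\<nu> j)) ^ p)"
              by (rule sum.swap)
            finally show ?thesis by (simp add: sum_divide_distrib[symmetric])
          qed
          also have "\<dots> = complex_of_real ((\<Sum>p<N. b p * b p) / N)" using sq by simp
          finally show "(\<Sum>i\<in>S. \<Sum>j\<in>S. (\<Sum>p<N. (\<nu> i * cnj (\<nu> j)) ^ p) / of_nat N) =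
            complex_of_real ((\<Sum>p<N. b p * b p) / N)" .
        qed
        finally show ?thesis .
      qed
      \<comment> \<open>Boundedness and nonnegativity enter here: \<open>b p * b p\<close> is at
        most \<open>card S * b p\<close>, so the squares inherit the mean \<open>0\<close>.\<close>
      have lim0: "(\<lambda>N. (\<Sum>p<N. b p * b p) / N) \<longlonglongrightarrow> 0"
      proof (rule tendsto_sandwich[of "\<lambda>_. 0"])
        show "(\<lambda>N. real (card S) * ((\<Sum>p<N. b p) / N)) \<longlonglongrightarrow> 0"
          using tendsto_mult_left[OF mean1, of "real (card S)"] by simp
        show "\<forall>\<^sub>F N in sequentially. 0 \<le> (\<Sum>p<N. b p * b p) / real N"
          using b by (intro always_eventually allI divide_nonneg_nonneg sum_nonneg) auto
        have "(\<Sum>p<N. b p * b p) \<le> real (card S) * (\<Sum>p<N. b p)" for N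
          unfolding sum_distrib_left using bound b by (intro sum_mono mult_right_mono) auto
        then show "\<forall>\<^sub>F N in sequentially. (\<Sum>p<N. b p * b p) / real N \<le> real (card S) * ((\<Sum>p<N. b p) / N)"
          by (intro always_eventually allI) (simp add: divide_right_mono)
      qed auto
      have "c = 0"
        using LIMSEQ_unique[OF mean2 tendsto_of_real[OF lim0]] by simp
      moreover have "Re c \<ge> 1"
      proof -
        \<comment> \<open>The pair \<open>(m, m)\<close>, with \<open>m\<close> of maximal modulus,
          already contributes \<open>1\<close> to \<open>c\<close>.\<close>
        have "cmod (\<nu> m) = 1" using m R unfolding \<nu>_def by (simp add: norm_divide)
        then have "\<nu> m * cnj (\<nu> m) = 1" by (simp add: complex_mult_cnj flip: cmod_power2)
        then have "1 = (if \<nu> m * cnj (\<nu> m) = 1 then 1 else 0 :: real)" by simp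
        also have "\<dots> \<le> (\<Sum>j\<in>S. if \<nu> m * cnj (\<nu> j) = 1 then 1 else 0)"
          by (rule member_le_sum) (use m fin in auto)
        also have "\<dots> \<le> (\<Sum>i\<in>S. \<Sum>j\<in>S. if \<nu> i * cnj (\<nu> j) = 1 then 1 else 0)"
          by (rule member_le_sum[of m]) (use m fin in \<open>auto intro: sum_nonneg\<close>)
        also have "\<dots> = Re c" unfolding c_def by (auto simp: Re_sum intro!: sum.cong)
        finally show ?thesis .
      qed
      ultimately show False by simp
    qed
  qed
qed

section \<open>Totally nonnegative matrices\<close>

lemma tendsto_det:
  fixes X :: "'b \<Rightarrow> 'a :: real_normed_field mat"
  assumes X: "\<And>s. X s \<in> carrier_mat n n" and M: "M \<in> carrier_mat n n"
    and lim: "\<And>i j. i < n \<Longrightarrow> j < n \<Longrightarrow> ((\<lambda>s. X s $$ (i, j)) \<longlongrightarrow> M $$ (i, j)) F"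
  shows "((\<lambda>s. det (X s)) \<longlongrightarrow> det M) F"
  unfolding det_def'[OF X] det_def'[OF M]
  by (intro tendsto_intros lim) (auto simp: permutes_below_iff)

lemma P0_matrices_closed:
  fixes X :: "'b \<Rightarrow> real mat"
  assumes X: "\<And>s. X s \<in> carrier_mat n n" and M: "M \<in> carrier_mat n n"
    and lim: "\<And>i j. i < n \<Longrightarrow> j < n \<Longrightarrow> ((\<lambda>s. X s $$ (i, j)) \<longlongrightarrow> M $$ (i, j)) F"
    and F: "F \<noteq> bot" and P0: "\<forall>\<^sub>F s in F. X s \<in> P0_matrices"
  shows "M \<in> P0_matrices"
proof -
  have "0 \<le> det (submatrix M I I)" if "I \<subseteq> {..<n}" for I
  proof -
    have I: "I \<in> ksubsets n (card I)" using that unfolding ksubsets_def by simp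
    have "((\<lambda>s. det (submatrix (X s) I I)) \<longlongrightarrow> det (submatrix M I I)) F"
      by (rule tendsto_det[OF submatrix_carrier[OF X I I] submatrix_carrier[OF M I I]])
        (use pick_ksubset[OF I] in \<open>auto simp: submatrix_ksubsets[OF X I I] submatrix_ksubsets[OF M I I] intro!: lim\<close>)
    moreover have "\<forall>\<^sub>F s in F. 0 \<le> det (submatrix (X s) I I)"
      using P0 by eventually_elim (use that in \<open>auto simp: P0_matrices_def carrier_matD[OF X]\<close>)
    ultimately show ?thesis using F by (rule tendsto_lowerbound)
  qed
  then show ?thesis using M unfolding P0_matrices_def by auto
qed

text \<open>Continuity of roots is avoided. If \<open>z\<close> keeps distance
  \<open>\<delta>\<close> from the nonnegative half-line, the characteristic polynomial of every
  matrix in the class has modulus at least \<open>\<delta> ^ n\<close> at \<open>z\<close>. This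
  bound survives in the limit, where the polynomial would have to vanish.\<close>

lemma PS_matrices_closed:
  fixes X :: "'b \<Rightarrow> real mat"
  assumes X: "\<And>s. X s \<in> carrier_mat n n" and M: "M \<in> carrier_mat n n"
    and lim: "\<And>i j. i < n \<Longrightarrow> j < n \<Longrightarrow> ((\<lambda>s. X s $$ (i, j)) \<longlongrightarrow> M $$ (i, j)) F"
    and F: "F \<noteq> bot" and PS: "\<forall>\<^sub>F s in F. X s \<in> PS_matrices"
  shows "M \<in> PS_matrices"
proof -
  let ?C = "\<lambda>M. map_mat complex_of_real M"
  have C: "?C N \<in> carrier_mat n n" if "N \<in> carrier_mat n n" for N using that by simp
  have "z \<in> \<real> \<and> 0 \<le> Re z" if ev: "eigenvalue (?C M) z" for z
  proof (rule ccontr)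
    assume nz: "\<not> (z \<in> \<real> \<and> 0 \<le> Re z)"
    \<comment> \<open>A positive lower bound for the distance from \<open>z\<close> to the
      nonnegative half-line, not always the distance itself.\<close>
    define \<delta> where "\<delta> = (if Im z = 0 then - Re z else \<bar>Im z\<bar>)"
    have \<delta>: "\<delta> > 0" using nz unfolding \<delta>_def by (auto simp: complex_is_Real_iff)
    have dist: "\<delta> \<le> cmod (z - a)" if "a \<in> \<real>" "0 \<le> Re a" for a
    proof (cases "Im z = 0")
      case True
      have "\<delta> \<le> \<bar>Re (z - a)\<bar>" using True that unfolding \<delta>_def by simp
      then show ?thesis using abs_Re_le_cmod[of "z - a"] by linarith
    next
      case False
      have "\<delta> = \<bar>Im (z - a)\<bar>" using False that unfolding \<delta>_def by (simp add: complex_is_Real_iff)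
      then show ?thesis using abs_Im_le_cmod[of "z - a"] by linarith
    qed
    have "((\<lambda>s. poly (char_poly (?C (X s))) z) \<longlongrightarrow> poly (char_poly (?C M)) z) F"
      unfolding char_poly_matrix[OF C[OF X]] char_poly_matrix[OF C[OF M]]
      by (rule tendsto_det[of _ n]) (use M in \<open>auto simp: char_matrix_def carrier_matD[OF X] X intro!: tendsto_intros lim\<close>)
    then have "((\<lambda>s. cmod (poly (char_poly (?C (X s))) z)) \<longlongrightarrow> cmod (poly (char_poly (?C M)) z)) F"
      by (rule tendsto_norm)
    moreover have "\<forall>\<^sub>F s in F. \<delta> ^ n \<le> cmod (poly (char_poly (?C (X s))) z)"
      using PS
    proof eventually_elim
      case (elim s)
      obtain es where es: "length es = n" "\<And>z. eigenvalue (?C (X s)) z \<longleftrightarrow> z \<in> set es"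
        "\<And>z. poly (char_poly (?C (X s))) z = (\<Prod>a\<leftarrow>es. z - a)"
        by (rule complex_spectrum_minor_sums[OF C[OF X]]) (rule that)
      have "\<forall>a\<in>set es. \<delta> \<le> cmod (z - a)"
        using elim es(2) dist unfolding PS_matrices_def by auto
      then have "\<delta> ^ length es \<le> cmod (\<Prod>a\<leftarrow>es. z - a)"
        using \<delta> by (induction es) (auto simp: norm_mult intro!: mult_mono)
      then show ?case using es by simp
    qed
    ultimately have "\<delta> ^ n \<le> cmod (poly (char_poly (?C M)) z)"
      using F by (rule tendsto_lowerbound)
    moreover have "poly (char_poly (?C M)) z = 0"
      using ev eigenvalue_root_char_poly[OF C[OF M]] by simp
    ultimately show False using zero_less_power[OF \<delta>, of n] by simp
  qed
  then show ?thesis using M unfolding PS_matrices_def by auto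
qed

section \<open>A kernel with positive minors\<close>

text \<open>The least moved point \<open>a\<close> is the image of some later \<open>b\<close>, and
  \<open>p a\<close> exceeds \<open>a = p b\<close>.\<close>

lemma permutes_inversion:
  assumes p: "p permutes {0..<k::nat}" and ne: "p \<noteq> id"
  obtains a b where "a < b" "b < k" "p b < p a"
proof -
  define a where "a = (LEAST a. p a \<noteq> a)"
  have ex: "\<exists>a. p a \<noteq> a" using ne by (auto simp: fun_eq_iff)
  have a: "p a \<noteq> a" unfolding a_def by (rule LeastI_ex[OF ex])
  have below: "p i = i" if "i < a" for i using not_less_Least[of i "\<lambda>a. p a \<noteq> a"] that unfolding a_def by blast
  have ak: "a < k" using a permutes_not_in[OF p, of a] by (cases "a < k") auto
  obtain b where b: "p b = a" using permutes_surj[OF p] by (metis surjD)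
  have inj: "inj p" using p by (rule permutes_inj)
  have "b \<noteq> a" using a b by auto
  moreover have "\<not> b < a" using below b by force
  ultimately have ab: "a < b" by simp
  have bk: "b < k" using permutes_below_iff[OF p, of b] b ak by simp
  have "\<not> p a < a" using below[of "p a"] injD[OF inj, of "p a" a] a by auto
  with a have "p b < p a" using b by simp
  with that ab bk show thesis by blast
qed

text \<open>Exchanging an inversion strictly lowers the cost, so the identity is the unique optimum.\<close>

lemma assignment_cost_min:
  fixes x y :: "nat \<Rightarrow> nat" and k :: nat
  defines "c \<equiv> \<lambda>p. \<Sum>i=0..<k. nat ((int (x i) - int (y (p i)))\<^sup>2)"
  assumes x: "\<And>a b. a < b \<Longrightarrow> b < k \<Longrightarrow> x a < x b" and y: "\<And>a b. a < b \<Longrightarrow> b < k \<Longrightarrow> y a < y b"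
    and p: "p permutes {0..<k}" "p \<noteq> id"
  shows "c id < c p"
  using p
proof (induction "c p" arbitrary: p rule: less_induct)
  case less
  obtain a b where ab: "a < b" "b < k" "p b < p a" using permutes_inversion[OF less.prems] .
  \<comment> \<open>Swapping the two images lowers the cost by twice the product of
    \<open>x b - x a\<close> and \<open>y (p a) - y (p b)\<close>, both positive.\<close>
  define q where "q = p \<circ> transpose a b"
  have q: "q permutes {0..<k}"
    unfolding q_def using ab by (intro permutes_compose[OF _ less.prems(1)] permutes_swap_id) auto
  define f where "f r i = nat ((int (x i) - int (y (r i)))\<^sup>2)" for r i
  have qq: "q a = p b" "q b = p a" "\<And>i. i \<noteq> a \<Longrightarrow> i \<noteq> b \<Longrightarrow> q i = p i"
    unfolding q_def by (auto simp: transpose_def)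
  have split: "c r = f r a + f r b + (\<Sum>i\<in>{0..<k} - {a, b}. f r i)" for r
  proof -
    have "c r = (\<Sum>i\<in>{a, b}. f r i) + (\<Sum>i\<in>{0..<k} - {a, b}. f r i)"
      unfolding c_def f_def[symmetric] using ab by (subst add.commute, intro sum.subset_diff) auto
    then show ?thesis using ab by simp
  qed
  have rest: "(\<Sum>i\<in>{0..<k} - {a, b}. f q i) = (\<Sum>i\<in>{0..<k} - {a, b}. f p i)"
    by (rule sum.cong) (auto simp: f_def qq)
  have "x a < x b" using x ab by simp
  moreover have "y (p b) < y (p a)" using y ab less.prems(1) by (auto simp: permutes_below_iff)
  ultimately have "0 < (int (x b) - int (x a)) * (int (y (p a)) - int (y (p b)))" by simp
  then have "(int (x a) - int (y (p b)))\<^sup>2 + (int (x b) - int (y (p a)))\<^sup>2 <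
      (int (x a) - int (y (p a)))\<^sup>2 + (int (x b) - int (y (p b)))\<^sup>2"
    by (simp add: power2_eq_square algebra_simps)
  then have "int (f q a) + int (f q b) < int (f p a) + int (f p b)"
    unfolding f_def qq by simp
  then have "c q < c p" unfolding split rest by linarith
  then show ?case using less.hyps[OF \<open>c q < c p\<close> q] by (cases "q = id") auto
qed

text \<open>With \<open>s = exp (- t)\<close> this is the Gaussian
  \<open>exp (- t * (i - j)\<^sup>2)\<close>. Its diagonal is \<open>s ^ 0 = 1\<close>, and it tends
  to the identity as \<open>s\<close> decreases to \<open>0\<close>.\<close>

definition gauss_kernel :: "nat \<Rightarrow> real \<Rightarrow> real mat" where
  "gauss_kernel n s = mat n n (\<lambda>(i, j). s ^ nat ((int i - int j)\<^sup>2))"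

lemma gauss_kernel_carrier [simp]: "gauss_kernel n s \<in> carrier_mat n n"
  unfolding gauss_kernel_def by simp

text \<open>In the Leibniz expansion each permutation contributes a power of \<open>s\<close> whose
  exponent is its assignment cost. The identity alone has the least exponent, and its sign is
  \<open>+1\<close>, so its term dominates for small \<open>s\<close>. There are finitely many
  minors, so one threshold serves all of them.\<close>

lemma gauss_kernel_minors_pos:
  "\<forall>\<^sub>F s in at_right 0. \<forall>k. \<forall>I\<in>ksubsets n k. \<forall>J\<in>ksubsets n k. 0 < det (submatrix (gauss_kernel n s) I J)"
proof -
  have one: "\<forall>\<^sub>F s in at_right 0. 0 < det (submatrix (gauss_kernel n s) I J)"
    if I: "I \<in> ksubsets n k" and J: "J \<in> ksubsets n k" for I J k
  proof -
    define c where "c p = (\<Sum>i=0..<k. nat ((int (pick I i) - int (pick J (p i)))\<^sup>2))" for p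
    let ?P = "{p. p permutes {0..<k}}"
    define e :: "nat \<Rightarrow> nat" where "e = id"
    have card: "card I = k" "card J = k" using I J unfolding ksubsets_def by auto
    have min: "c e < c p" if "p \<in> ?P - {e}" for p
      unfolding c_def using that card unfolding e_def by (intro assignment_cost_min) (auto simp: pick_mono_le)
    have D: "det (submatrix (gauss_kernel n s) I J) = (\<Sum>p\<in>?P. signof p * s ^ c p)" for s
    proof -
      have "(\<Prod>i = 0..<k. submatrix (gauss_kernel n s) I J $$ (i, p i)) = s ^ c p"
        if "p permutes {0..<k}" for p
        unfolding submatrix_ksubsets[OF gauss_kernel_carrier I J] c_def power_sum
        using pick_ksubset[OF I] pick_ksubset[OF J] that
        by (intro prod.cong) (auto simp: gauss_kernel_def permutes_below_iff)
      then show ?thesis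
        unfolding det_def'[OF submatrix_carrier[OF gauss_kernel_carrier I J]] by simp
    qed
    \<comment> \<open>After division by \<open>s ^ c e\<close> every term except that of the
      identity keeps a positive exponent and vanishes in the limit.\<close>
    have "((\<lambda>s. 1 + (\<Sum>p\<in>?P - {e}. signof p * s ^ (c p - c e))) \<longlongrightarrow>
        1 + (\<Sum>p\<in>?P - {e}. signof p * 0 ^ (c p - c e))) (at_right (0::real))"
      by (intro tendsto_intros)
    also have "(\<Sum>p\<in>?P - {e}. signof p * (0::real) ^ (c p - c e)) = 0"
      using min by (intro sum.neutral) auto
    finally have "\<forall>\<^sub>F s in at_right (0::real). 0 < 1 + (\<Sum>p\<in>?P - {e}. signof p * s ^ (c p - c e))"
      by (intro order_tendstoD) auto
    then show ?thesis
      using eventually_at_right_less[of "0::real"]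
    proof eventually_elim
      case (elim s)
      have "det (submatrix (gauss_kernel n s) I J) = s ^ c e + (\<Sum>p\<in>?P - {e}. signof p * s ^ c p)"
        unfolding D by (subst sum.remove[of _ e]) (auto simp: e_def permutes_id finite_permutations)
      also have "(\<Sum>p\<in>?P - {e}. signof p * s ^ c p) =
          s ^ c e * (\<Sum>p\<in>?P - {e}. signof p * s ^ (c p - c e))"
        unfolding sum_distrib_left using min
        by (intro sum.cong refl) (simp add: less_imp_le flip: power_add)
      finally have "det (submatrix (gauss_kernel n s) I J) =
          s ^ c e * (1 + (\<Sum>p\<in>?P - {e}. signof p * s ^ (c p - c e)))" by (simp add: algebra_simps)
      then show ?case using elim by simp
    qed
  qed
  have "\<forall>\<^sub>F s in at_right 0. \<forall>I\<in>Pow {..<n}. \<forall>J\<in>Pow {..<n}. card I = card J \<longrightarrow>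
      0 < det (submatrix (gauss_kernel n s) I J)"
  proof (intro eventually_ball_finite ballI)
    fix I J assume "I \<in> Pow {..<n}" "J \<in> Pow {..<n}"
    then show "\<forall>\<^sub>F s in at_right 0. card I = card J \<longrightarrow> 0 < det (submatrix (gauss_kernel n s) I J)"
      using one[of I "card I" J] unfolding ksubsets_def by (cases "card I = card J") auto
  qed auto
  then show ?thesis by eventually_elim (auto simp: ksubsets_def)
qed

section \<open>Compounds of totally nonnegative matrices\<close>

definition totally_nonneg :: "real mat \<Rightarrow> bool" where
  "totally_nonneg M \<longleftrightarrow> (\<forall>k. \<forall>I\<in>ksubsets (dim_row M) k. \<forall>J\<in>ksubsets (dim_col M) k.
     0 \<le> det (submatrix M I J))"

lemma totally_nonneg_mult:
  assumes "A \<in> carrier_mat n m" "B \<in> carrier_mat m l" "totally_nonneg A" "totally_nonneg B"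
  shows "totally_nonneg (A * B)"
  using assms unfolding totally_nonneg_def
  by (auto simp: Cauchy_Binet[OF assms(1,2)] intro!: sum_nonneg mult_nonneg_nonneg)

text \<open>Entries of \<open>(C - \<epsilon>)\<^sup>p C\<^sup>r\<close>, where \<open>C\<close> is a compound matrix of \<open>M\<close>.\<close>

primrec compound_diff :: "real \<Rightarrow> real mat \<Rightarrow> nat \<Rightarrow> nat \<Rightarrow> nat set \<Rightarrow> nat set \<Rightarrow> real" where
  "compound_diff \<epsilon> M 0 r I J = det (submatrix (M ^\<^sub>m r) I J)"
| "compound_diff \<epsilon> M (Suc p) r I J = compound_diff \<epsilon> M p (Suc r) I J - \<epsilon> * compound_diff \<epsilon> M p r I J"

text \<open>Cauchy--Binet says that compounds multiply, so raising \<open>r\<close> by one is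
  multiplication by the compound of \<open>M\<close> from the right. The recursion in
  \<open>p\<close> is linear and inherits this.\<close>

lemma compound_diff_step:
  assumes M: "M \<in> carrier_mat n n" and I: "I \<in> ksubsets n k" and J: "J \<in> ksubsets n k"
  shows "compound_diff \<epsilon> M p (Suc r) I J =
    (\<Sum>K\<in>ksubsets n k. compound_diff \<epsilon> M p r I K * det (submatrix M K J))"
proof (induction p arbitrary: r)
  case 0
  show ?case using Cauchy_Binet[OF pow_carrier_mat[OF M] M I J] by simp
next
  case (Suc p)
  show ?case
    unfolding compound_diff.simps Suc.IH[of r] Suc.IH[of "Suc r"]
    by (simp add: sum_distrib_left sum_subtractf algebra_simps)
qed

text \<open>The compound of the identity is the identity: if two index sets of equal size differ,
  some row of \<open>I\<close> has no matching column in \<open>J\<close> and is zero.\<close>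

lemma det_submatrix_one:
  assumes I: "I \<in> ksubsets n k" and J: "J \<in> ksubsets n k"
  shows "det (submatrix (1\<^sub>m n) I J) = (if I = J then 1 else 0 :: 'a :: comm_ring_1)"
proof (cases "I = J")
  case True
  have "card I = k" using I unfolding ksubsets_def by simp
  then have "inj_on (pick I) {0..<k}"
    using pick_bij_betw[OF finite_ksubset[OF I]] unfolding bij_betw_def by simp
  then have "submatrix (1\<^sub>m n :: 'a mat) I I = 1\<^sub>m k"
    unfolding submatrix_ksubsets[OF one_carrier_mat I I]
    by (intro eq_matI) (use pick_ksubset[OF I] in \<open>auto simp: inj_on_def\<close>)
  then show ?thesis using True by simp
next
  case False
  have fin: "finite I" "finite J" using finite_ksubset I J by auto
  have card: "card I = k" "card J = k" using I J unfolding ksubsets_def by auto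
  have "\<not> I \<subseteq> J" using False card card_subset_eq[OF fin(2)] by auto
  then obtain i where i: "i \<in> I" "i \<notin> J" by blast
  have "i \<in> pick I ` {0..<k}"
    using bij_betw_imp_surj_on[OF pick_bij_betw[OF fin(1)]] i(1) card by simp
  then obtain a where a: "a < k" "pick I a = i" by auto
  have "submatrix (1\<^sub>m n) I J $$ (a, b) = (0 :: 'a)" if "b < k" for b
    using pick_ksubset[OF I a(1)] pick_ksubset[OF J that] a i that
    by (auto simp: submatrix_ksubsets[OF one_carrier_mat I J])
  then have "(\<Prod>i = 0..<k. submatrix (1\<^sub>m n) I J $$ (i, p i)) = (0 :: 'a)" if "p permutes {0..<k}" for p
    using a that by (intro prod_zero) (auto simp: permutes_below_iff intro!: bexI[of _ a])
  then have "det (submatrix (1\<^sub>m n) I J) = (0 :: 'a)"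
    unfolding det_def'[OF submatrix_carrier[OF one_carrier_mat I J]] by simp
  then show ?thesis using False by simp
qed

text \<open>The entries of \<open>C - \<epsilon>\<close> are nonnegative: off the diagonal they are
  minors of \<open>M\<close>, and on the diagonal \<open>\<epsilon>\<close> does not exceed the
  principal minor. Its powers, built up from the identity, are then nonnegative too.\<close>

lemma compound_diff_nonneg:
  assumes M: "M \<in> carrier_mat n n" "totally_nonneg M"
    and \<epsilon>: "\<And>I. I \<in> ksubsets n k \<Longrightarrow> \<epsilon> \<le> det (submatrix M I I)"
    and I: "I \<in> ksubsets n k" and J: "J \<in> ksubsets n k"
  shows "0 \<le> compound_diff \<epsilon> M p 0 I J"
  using J
proof (induction p arbitrary: J)
  case 0
  then show ?case using det_submatrix_one[OF I 0, where 'a = real] M by simp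
next
  case (Suc p)
  let ?d = "compound_diff \<epsilon> M p 0 I"
  have "compound_diff \<epsilon> M (Suc p) 0 I J =
      (\<Sum>K\<in>ksubsets n k. ?d K * det (submatrix M K J)) - \<epsilon> * ?d J"
    by (simp add: compound_diff_step[OF M(1) I Suc.prems])
  also have "\<dots> = (\<Sum>K\<in>ksubsets n k - {J}. ?d K * det (submatrix M K J)) + ?d J * (det (submatrix M J J) - \<epsilon>)"
    using Suc.prems by (subst sum.remove[of _ J]) (auto simp: algebra_simps)
  also have "\<dots> \<ge> 0"
    using Suc M \<epsilon> unfolding totally_nonneg_def
    by (intro add_nonneg_nonneg sum_nonneg mult_nonneg_nonneg) auto
  finally show ?case .
qed

lemma pick_ge: "finite I \<Longrightarrow> a < card I \<Longrightarrow> a \<le> pick I a"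
  using card_pick_le[of a I] card_mono[of "{..<pick I a}" "{b \<in> I. b < pick I a}"] by auto

text \<open>Counting from \<open>0\<close>, the \<open>a\<close>-th smallest element of
  \<open>I\<close> is at least \<open>a\<close>, so the factors can be compared one by one with
  those of the initial segment.\<close>

lemma cmod_prod_sorted_le:
  assumes es: "length es = n" "sorted_wrt (\<lambda>a b. cmod b \<le> cmod a) es" and I: "I \<in> ksubsets n k"
  shows "cmod (\<Prod>i\<in>I. es ! i) \<le> cmod (\<Prod>i<k. es ! i)"
proof -
  have card: "card I = k" using I unfolding ksubsets_def by simp
  have "cmod (\<Prod>i\<in>I. es ! i) = (\<Prod>a\<in>{0..<k}. cmod (es ! pick I a))"
    using prod.reindex_bij_betw[OF pick_bij_betw[OF finite_ksubset[OF I]], of "\<lambda>i. cmod (es ! i)"] card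
    by (simp add: prod_norm)
  also have "\<dots> \<le> (\<Prod>a\<in>{0..<k}. cmod (es ! a))"
  proof (rule prod_mono, intro conjI)
    fix a assume a: "a \<in> {0..<k}"
    have "a \<le> pick I a" using pick_ge[OF finite_ksubset[OF I]] card a by simp
    moreover have "pick I a < n" using pick_ksubset[OF I] a by simp
    ultimately show "cmod (es ! pick I a) \<le> cmod (es ! a)"
      using es by (cases "a = pick I a") (auto simp: sorted_wrt_iff_nth_less)
  qed simp
  finally show ?thesis by (simp add: prod_norm atLeast0LessThan)
qed

text \<open>The disc of radius \<open>R\<close> about \<open>\<epsilon>\<close> lies inside the disc
  of radius \<open>R + \<epsilon>\<close> about \<open>0\<close>, and their boundaries touch only at
  \<open>R + \<epsilon>\<close>.\<close>

lemma complex_extremal_shift: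
  fixes z :: complex
  assumes "cmod (z - of_real \<epsilon>) \<le> R" "R + \<epsilon> \<le> cmod z" "\<epsilon> > 0" "R \<ge> 0"
  shows "z = of_real (R + \<epsilon>)"
proof -
  have "cmod z \<le> R + \<epsilon>"
    using norm_triangle_ineq[of "z - of_real \<epsilon>" "of_real \<epsilon>"] assms by simp
  with assms have cz: "cmod z = R + \<epsilon>" by simp
  have "(R + \<epsilon>)\<^sup>2 = (Re z)\<^sup>2 + (Im z)\<^sup>2" unfolding cz[symmetric] by (rule cmod_power2)
  moreover have "(cmod (z - of_real \<epsilon>))\<^sup>2 \<le> R\<^sup>2" using assms by (intro power_mono) auto
  then have "(Re z - \<epsilon>)\<^sup>2 + (Im z)\<^sup>2 \<le> R\<^sup>2" by (simp add: cmod_power2)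
  ultimately have "2 * \<epsilon> * (R + \<epsilon>) \<le> 2 * \<epsilon> * Re z" by (simp add: power2_eq_square algebra_simps)
  then have "R + \<epsilon> \<le> Re z" using assms by simp
  moreover have "Re z \<le> R + \<epsilon>" using complex_Re_le_cmod[of z] cz by simp
  ultimately have re: "Re z = R + \<epsilon>" by simp
  with \<open>(R + \<epsilon>)\<^sup>2 = (Re z)\<^sup>2 + (Im z)\<^sup>2\<close> have "Im z = 0" by simp
  with re show ?thesis by (simp add: complex_eq_iff)
qed

text \<open>The products \<open>\<mu> I\<close> are the eigenvalues of the \<open>k\<close>-th
  compound \<open>C\<close>. The nonnegative matrix \<open>C - \<epsilon>\<close> has a dominant
  eigenvalue \<open>R \<ge> 0\<close>, so \<open>R + \<epsilon>\<close> is one of the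
  \<open>\<mu> I\<close>. The product of the \<open>k\<close> eigenvalues of largest modulus has at
  least this modulus and lies within \<open>R\<close> of \<open>\<epsilon>\<close>, so it equals
  \<open>R + \<epsilon>\<close>.\<close>

lemma totally_nonneg_PS_primitive:
  assumes M: "M \<in> carrier_mat n n" "totally_nonneg M"
    and prim: "\<And>k. (\<forall>I\<in>ksubsets n k. \<forall>J\<in>ksubsets n k. det (submatrix M I J) = 0) \<or>
      (\<forall>I\<in>ksubsets n k. 0 < det (submatrix M I I))"
  shows "M \<in> PS_matrices"
proof -
  let ?C = "map_mat complex_of_real M"
  have C: "?C \<in> carrier_mat n n" using M by simp
  obtain es where es: "length es = n" "sorted_wrt (\<lambda>a b. cmod b \<le> cmod a) es"
    "\<And>z. eigenvalue ?C z \<longleftrightarrow> z \<in> set es"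
    and ms: "\<And>k q. minor_sum k (?C ^\<^sub>m q) = (\<Sum>I\<in>ksubsets n k. (\<Prod>i\<in>I. es ! i) ^ q)"
    and zero: "\<And>k I. \<forall>I\<in>ksubsets n k. \<forall>J\<in>ksubsets n k. det (submatrix ?C I J) = 0 \<Longrightarrow>
      I \<in> ksubsets n k \<Longrightarrow> (\<Prod>i\<in>I. es ! i) = 0"
    by (rule complex_spectrum_minor_sums[OF C]) (rule that)
  have top: "{..<k} \<in> ksubsets n k" if "k \<le> n" for k using that unfolding ksubsets_def by auto
  define P where "P k = (\<Prod>i<k. es ! i)" for k
  have P: "P k = 0 \<or> (\<exists>r>0. P k = complex_of_real r)" if k: "k \<le> n" for k
    using prim[of k]
  proof
    assume "\<forall>I\<in>ksubsets n k. \<forall>J\<in>ksubsets n k. det (submatrix M I J) = 0"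
    then have "P k = 0" unfolding P_def
      by (intro zero[OF _ top[OF k]]) (simp add: submatrix_map_mat[OF M(1)] of_real_hom.hom_det)
    then show ?thesis ..
  next
    assume pos: "\<forall>I\<in>ksubsets n k. 0 < det (submatrix M I I)"
    \<comment> \<open>The largest shift that keeps the diagonal of the compound nonnegative.\<close>
    define \<epsilon> where "\<epsilon> = Min ((\<lambda>I. det (submatrix M I I)) ` ksubsets n k)"
    have \<epsilon>0: "\<epsilon> > 0" unfolding \<epsilon>_def using pos top[OF k] by (subst Min_gr_iff) auto
    have \<epsilon>le: "\<epsilon> \<le> det (submatrix M I I)" if "I \<in> ksubsets n k" for I
      unfolding \<epsilon>_def using that by (intro Min_le) auto
    define \<mu> where "\<mu> I = (\<Prod>i\<in>I. es ! i)" for I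
    \<comment> \<open>Both sides are the trace of \<open>C ^ r * (C - \<epsilon>) ^ p\<close>. The
      induction needs all \<open>r\<close>, because a factor \<open>C - \<epsilon>\<close> is split
      into \<open>C\<close> and \<open>- \<epsilon>\<close>.\<close>
    have tr: "(\<Sum>I\<in>ksubsets n k. complex_of_real (compound_diff \<epsilon> M p r I I)) =
        (\<Sum>I\<in>ksubsets n k. \<mu> I ^ r * (\<mu> I - of_real \<epsilon>) ^ p)" for p r
    proof (induction p arbitrary: r)
      case 0
      have "(\<Sum>I\<in>ksubsets n k. complex_of_real (det (submatrix (M ^\<^sub>m r) I I))) =
          complex_of_real (minor_sum k (M ^\<^sub>m r))"
        unfolding minor_sum_def using M by simp
      also have "\<dots> = minor_sum k (?C ^\<^sub>m r)"
        using minor_sum_of_real[OF pow_carrier_mat[OF M(1)]] map_mat_of_real_pow[OF M(1)] by simp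
      finally show ?case using ms unfolding \<mu>_def by simp
    next
      case (Suc p)
      have "(\<Sum>I\<in>ksubsets n k. complex_of_real (compound_diff \<epsilon> M (Suc p) r I I)) =
          (\<Sum>I\<in>ksubsets n k. complex_of_real (compound_diff \<epsilon> M p (Suc r) I I)) -
          of_real \<epsilon> * (\<Sum>I\<in>ksubsets n k. complex_of_real (compound_diff \<epsilon> M p r I I))"
        by (simp add: sum_subtractf sum_distrib_left)
      also have "\<dots> = (\<Sum>I\<in>ksubsets n k. \<mu> I ^ r * (\<mu> I - of_real \<epsilon>) ^ Suc p)"
        unfolding Suc.IH sum_distrib_left sum_subtractf[symmetric]
        by (intro sum.cong) (auto simp: algebra_simps)
      finally show ?case .
    qed
    have "\<exists>i\<in>ksubsets n k. \<mu> i - of_real \<epsilon> = complex_of_real (cmod (\<mu> i - of_real \<epsilon>)) \<and>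
        (\<forall>j\<in>ksubsets n k. cmod (\<mu> j - of_real \<epsilon>) \<le> cmod (\<mu> i - of_real \<epsilon>))"
    proof (rule nonneg_power_sums_dominant)
      fix p
      show "\<exists>r\<ge>0. (\<Sum>I\<in>ksubsets n k. (\<mu> I - of_real \<epsilon>) ^ p) = complex_of_real r"
      proof (intro exI conjI)
        show "0 \<le> (\<Sum>I\<in>ksubsets n k. compound_diff \<epsilon> M p 0 I I)"
          by (intro sum_nonneg compound_diff_nonneg[OF M \<epsilon>le]) auto
        show "(\<Sum>I\<in>ksubsets n k. (\<mu> I - of_real \<epsilon>) ^ p) =
            complex_of_real (\<Sum>I\<in>ksubsets n k. compound_diff \<epsilon> M p 0 I I)"
          using tr[of p 0] by simp
      qed
    qed (use top[OF k] in auto)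
    then obtain I where I: "I \<in> ksubsets n k"
      and real: "\<mu> I - of_real \<epsilon> = complex_of_real (cmod (\<mu> I - of_real \<epsilon>))"
      and max: "\<And>J. J \<in> ksubsets n k \<Longrightarrow> cmod (\<mu> J - of_real \<epsilon>) \<le> cmod (\<mu> I - of_real \<epsilon>)" by blast
    define R where "R = cmod (\<mu> I - of_real \<epsilon>)"
    have R0: "R \<ge> 0" unfolding R_def by simp
    have "\<mu> I = of_real (R + \<epsilon>)" using real unfolding R_def by (simp add: algebra_simps)
    then have "R + \<epsilon> = cmod (\<mu> I)" using \<epsilon>0 R0 by (simp only: norm_of_real)
    also have "\<dots> \<le> cmod (P k)" unfolding P_def \<mu>_def by (rule cmod_prod_sorted_le[OF es(1,2) I])
    finally have "P k = of_real (R + \<epsilon>)"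
      using max[OF top[OF k]] \<epsilon>0 unfolding R_def P_def \<mu>_def by (intro complex_extremal_shift) auto
    moreover have "R + \<epsilon> > 0" using \<epsilon>0 unfolding R_def by (simp add: add_nonneg_pos)
    ultimately show ?thesis by blast
  qed
  have "z \<in> \<real> \<and> 0 \<le> Re z" if "eigenvalue ?C z" for z
  proof -
    from that es obtain i where i: "i < n" "z = es ! i" by (metis in_set_conv_nth)
    show ?thesis
    \<comment> \<open>If the product vanishes, some eigenvalue of index at most \<open>i\<close> is
      \<open>0\<close>, and by the ordering so is \<open>z\<close>. Otherwise \<open>z\<close> is a
      quotient of two positive products.\<close>
    proof (cases "P (Suc i) = 0")
      case True
      then have "\<exists>j\<in>{..<Suc i}. es ! j = 0" unfolding P_def by (simp del: prod.lessThan_Suc)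
      then obtain j where j: "j \<le> i" "es ! j = 0" by (auto simp: less_Suc_eq_le simp del: lessThan_Suc)
      then have "cmod z \<le> cmod (es ! j)"
        using sorted_wrt_nth_less[OF es(2), of j i] es(1) i by (cases "j = i") auto
      with j show ?thesis by simp
    next
      case False
      then obtain r where r: "r > 0" "P (Suc i) = of_real r" using P[of "Suc i"] i by auto
      have Ps: "P (Suc i) = P i * z" unfolding P_def i by simp
      with False have "P i \<noteq> 0" by auto
      then obtain r' where r': "r' > 0" "P i = of_real r'" using P[of i] i by auto
      have "z = P (Suc i) / P i" using Ps \<open>P i \<noteq> 0\<close> by simp
      then have "z = of_real (r / r')" unfolding r r' by simp
      with r r' show ?thesis by simp
    qed
  qed
  then show ?thesis using M unfolding PS_matrices_def by auto
qed

text \<open>By Cauchy--Binet a minor of \<open>X s\<close> combines the minors of \<open>M\<close>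
  of the same size with positive coefficients. So either all minors of that size vanish, or those of
  \<open>X s\<close> are positive: exactly the dichotomy of
  \<open>totally_nonneg_PS_primitive\<close>. Letting \<open>s\<close> tend to \<open>0\<close>
  recovers \<open>M\<close>.\<close>

theorem totally_nonneg_PS:
  assumes M: "M \<in> carrier_mat n n" "totally_nonneg M"
  shows "M \<in> PS_matrices"
proof -
  define X where "X s = gauss_kernel n s * M * gauss_kernel n s" for s
  have X: "X s \<in> carrier_mat n n" for s
    unfolding X_def
    by (rule mult_carrier_mat[OF mult_carrier_mat[OF gauss_kernel_carrier M(1)] gauss_kernel_carrier])
  have GM: "gauss_kernel n s * M \<in> carrier_mat n n" for s
    by (rule mult_carrier_mat[OF gauss_kernel_carrier M(1)])
  have lim: "((\<lambda>s. X s $$ (i, j)) \<longlongrightarrow> M $$ (i, j)) (at_right 0)" if ij: "i < n" "j < n" for i j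
  proof -
    define g where "g s i j = s ^ nat ((int i - int j)\<^sup>2)" for s :: real and i j
    have g: "((\<lambda>s. g s i j) \<longlongrightarrow> (if i = j then 1 else 0)) (at_right 0)" for i j
    proof -
      have "((\<lambda>s. g s i j) \<longlongrightarrow> 0 ^ nat ((int i - int j)\<^sup>2)) (at_right 0)"
        unfolding g_def by (intro tendsto_intros)
      then show ?thesis by (cases "i = j") (auto simp: power_0_left)
    qed
    have "X s $$ (i, j) = (\<Sum>l = 0..<n. (\<Sum>m = 0..<n. g s i m * M $$ (m, l)) * g s l j)" for s
      unfolding X_def using ij M
      by (auto simp: scalar_prod_def gauss_kernel_def g_def intro!: sum.cong)
    moreover have "((\<lambda>s. \<Sum>l = 0..<n. (\<Sum>m = 0..<n. g s i m * M $$ (m, l)) * g s l j) \<longlongrightarrow>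
      (\<Sum>l = 0..<n. (\<Sum>m = 0..<n. (if i = m then 1 else 0) * M $$ (m, l)) * (if l = j then 1 else 0))) (at_right 0)"
      by (intro tendsto_intros g)
    moreover have "(\<Sum>l = 0..<n. (\<Sum>m = 0..<n. (if i = m then 1 else 0) * M $$ (m, l)) * (if l = j then 1 else 0)) =
        M $$ (i, j)"
      using ij by (simp add: if_distrib[of "\<lambda>x. x * _"] if_distrib[of "\<lambda>x. _ * x"] sum.delta sum.delta' cong: if_cong)
    ultimately show ?thesis by simp
  qed
  have "\<forall>\<^sub>F s in at_right 0. X s \<in> PS_matrices"
    using gauss_kernel_minors_pos[of n]
  proof eventually_elim
    case (elim s)
    let ?G = "gauss_kernel n s"
    have G: "?G \<in> carrier_mat n n" by simp
    have TG: "totally_nonneg ?G" unfolding totally_nonneg_def using elim by (auto simp: carrier_matD[OF G] intro!: less_imp_le)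
    have TX: "totally_nonneg (X s)"
      unfolding X_def using totally_nonneg_mult[OF GM G totally_nonneg_mult[OF G M(1) TG M(2)] TG] .
    have minor: "det (submatrix (X s) I J) = (\<Sum>L\<in>ksubsets n k. (\<Sum>K\<in>ksubsets n k.
        det (submatrix ?G I K) * det (submatrix M K L)) * det (submatrix ?G L J))"
      if "I \<in> ksubsets n k" "J \<in> ksubsets n k" for I J k
      unfolding X_def using that by (simp add: Cauchy_Binet[OF GM G] Cauchy_Binet[OF G M(1)])
    show ?case
    proof (rule totally_nonneg_PS_primitive[OF X TX])
      fix k
      show "(\<forall>I\<in>ksubsets n k. \<forall>J\<in>ksubsets n k. det (submatrix (X s) I J) = 0) \<or>
        (\<forall>I\<in>ksubsets n k. 0 < det (submatrix (X s) I I))"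
      proof (cases "\<forall>K\<in>ksubsets n k. \<forall>L\<in>ksubsets n k. det (submatrix M K L) = 0")
        case True
        then show ?thesis using minor by simp
      next
        case False
        then obtain K L where KL: "K \<in> ksubsets n k" "L \<in> ksubsets n k" "det (submatrix M K L) \<noteq> 0" by blast
        have nn: "0 \<le> det (submatrix M K L)" if "K \<in> ksubsets n k" "L \<in> ksubsets n k" for K L
          using M that unfolding totally_nonneg_def by auto
        have "0 < det (submatrix (X s) I I)" if I: "I \<in> ksubsets n k" for I
        proof -
          have pos: "0 < det (submatrix ?G I K)" "0 < det (submatrix ?G K I)" if "K \<in> ksubsets n k" for K
            using elim I that by blast+
          have nn2: "0 \<le> det (submatrix ?G I K) * det (submatrix M K L)"
            if "K \<in> ksubsets n k" "L \<in> ksubsets n k" for K L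
            using pos(1)[OF that(1)] nn[OF that] by simp
          have "0 < det (submatrix ?G I K) * det (submatrix M K L)"
            using KL pos(1)[OF KL(1)] nn[OF KL(1,2)] by simp
          then have "0 < (\<Sum>K\<in>ksubsets n k. det (submatrix ?G I K) * det (submatrix M K L))"
            using KL nn2 by (intro sum_pos2[OF _ KL(1)]) auto
          then have "0 < (\<Sum>K\<in>ksubsets n k. det (submatrix ?G I K) * det (submatrix M K L)) * det (submatrix ?G L I)"
            using pos(2)[OF KL(2)] by simp
          note p = this
          have nn3: "0 \<le> (\<Sum>K\<in>ksubsets n k. det (submatrix ?G I K) * det (submatrix M K L)) * det (submatrix ?G L I)"
            if "L \<in> ksubsets n k" for L
            by (rule mult_nonneg_nonneg[OF sum_nonneg[OF nn2[OF _ that]] less_imp_le[OF pos(2)[OF that]]])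
          show ?thesis
            unfolding minor[OF I I] by (rule sum_pos2[where i = L]) (use KL(2) p nn3 in auto)
        qed
        then show ?thesis by blast
      qed
    qed
  qed
  then show ?thesis
    by (intro PS_matrices_closed[where X = X and F = "at_right 0", OF X M(1) lim]) simp_all
qed

section \<open>Staircase patterns\<close>

definition staircase :: "real mat \<Rightarrow> bool" where
  "staircase A \<longleftrightarrow> (\<forall>i i' j j'. i < i' \<longrightarrow> i' < dim_row A \<longrightarrow> j < dim_col A \<longrightarrow> j' < dim_col A \<longrightarrow>
     A $$ (i, j) \<noteq> 0 \<longrightarrow> A $$ (i', j') \<noteq> 0 \<longrightarrow> j \<le> j')"

text \<open>In the Leibniz expansion of a minor only the identity permutation contributes.\<close>

lemma staircase_totally_nonneg:
  assumes A: "A \<in> carrier_mat n m" and st: "staircase A"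
    and nn: "\<And>i j. i < n \<Longrightarrow> j < m \<Longrightarrow> 0 \<le> A $$ (i, j)"
  shows "totally_nonneg A"
  unfolding totally_nonneg_def
proof (intro allI ballI)
  fix k I J assume "I \<in> ksubsets (dim_row A) k" "J \<in> ksubsets (dim_col A) k"
  then have I: "I \<in> ksubsets n k" and J: "J \<in> ksubsets m k" using A by auto
  have card: "card I = k" "card J = k" using I J unfolding ksubsets_def by auto
  have "0 \<le> signof p * (\<Prod>i = 0..<k. submatrix A I J $$ (i, p i))" if p: "p permutes {0..<k}" for p
  proof (cases "p = id")
    case True
    have "0 \<le> (\<Prod>i = 0..<k. submatrix A I J $$ (i, i))"
      using nn pick_ksubset[OF I] pick_ksubset[OF J]
      by (intro prod_nonneg) (auto simp: submatrix_ksubsets[OF A I J])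
    then show ?thesis using True by simp
  next
    case False
    obtain a b where ab: "a < b" "b < k" "p b < p a" using permutes_inversion[OF p False] .
    have pk: "p a < k" "p b < k" using ab p by (auto simp: permutes_below_iff)
    \<comment> \<open>Otherwise both inverted positions would be nonzero, the later row having its
      entry strictly further left.\<close>
    have "A $$ (pick I a, pick J (p a)) = 0 \<or> A $$ (pick I b, pick J (p b)) = 0"
    proof (rule ccontr)
      assume "\<not> ?thesis"
      moreover have "pick I a < pick I b" using ab card by (simp add: pick_mono_le)
      moreover have "pick J (p b) < pick J (p a)" using ab pk card by (simp add: pick_mono_le)
      moreover have "pick I b < n" "pick J (p a) < m" "pick J (p b) < m"
        using pick_ksubset[OF I] pick_ksubset[OF J] ab pk by auto
      ultimately have "pick J (p a) \<le> pick J (p b)"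
        using st[unfolded staircase_def, rule_format, of "pick I a" "pick I b" "pick J (p a)" "pick J (p b)"] A
        by auto
      with \<open>pick J (p b) < pick J (p a)\<close> show False by simp
    qed
    then have "\<exists>i\<in>{0..<k}. submatrix A I J $$ (i, p i) = 0"
      using ab pk by (auto simp: submatrix_ksubsets[OF A I J] intro: bexI[of _ a] bexI[of _ b])
    then have "(\<Prod>i = 0..<k. submatrix A I J $$ (i, p i)) = 0" by (intro prod_zero) auto
    then show ?thesis by (simp only: mult_zero_right order_refl)
  qed
  then show "0 \<le> det (submatrix A I J)"
    unfolding det_def'[OF submatrix_carrier[OF A I J]] by (intro sum_nonneg) auto
qed

lemma staircase_transpose:
  assumes "staircase A"
  shows "staircase (transpose_mat A)"
  unfolding staircase_def
proof (intro allI impI)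
  fix i i' j j'
  assume h: "i < i'" "i' < dim_row A\<^sup>T" "j < dim_col A\<^sup>T" "j' < dim_col A\<^sup>T"
    "A\<^sup>T $$ (i, j) \<noteq> 0" "A\<^sup>T $$ (i', j') \<noteq> 0"
  show "j \<le> j'"
  proof (rule ccontr)
    assume "\<not> j \<le> j'"
    then have "i' \<le> i"
      using assms[unfolded staircase_def, rule_format, of j' j i' i] h by auto
    with h show False by simp
  qed
qed

section \<open>Alternating products under signed permutations\<close>

lemma totally_nonneg_one: "totally_nonneg (1\<^sub>m n)"
  unfolding totally_nonneg_def by (auto simp: det_submatrix_one[of _ n])

lemma alt_prod_carrier:
  assumes "\<And>i. i \<in> {1..2 * k} \<Longrightarrow> F i \<in> carrier_mat n m"
  shows "alt_prod n F k \<in> carrier_mat n n"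
  using assms
proof (induction k)
  case (Suc k)
  then have "alt_prod n F k \<in> carrier_mat n n" "F (2 * k + 1) \<in> carrier_mat n m"
    "(F (2 * k + 2))\<^sup>T \<in> carrier_mat m n" by auto
  then show ?case unfolding alt_prod.simps by (intro mult_carrier_mat)
qed simp

lemma totally_nonneg_alt_prod:
  assumes "\<And>i. i \<in> {1..2 * k} \<Longrightarrow> F i \<in> carrier_mat n m \<and> totally_nonneg (F i) \<and> totally_nonneg (F i)\<^sup>T"
  shows "totally_nonneg (alt_prod n F k)"
  using assms
proof (induction k)
  case 0
  show ?case by (simp add: totally_nonneg_one)
next
  case (Suc k)
  have c: "alt_prod n F k \<in> carrier_mat n n" using Suc.prems by (intro alt_prod_carrier[where m = m]) auto
  have f: "F (2 * k + 1) \<in> carrier_mat n m" "(F (2 * k + 2))\<^sup>T \<in> carrier_mat m n" using Suc.prems by auto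
  have "totally_nonneg (alt_prod n F k * F (2 * k + 1))"
    by (rule totally_nonneg_mult[OF c f(1)]) (use Suc in auto)
  then show ?case
    unfolding alt_prod.simps
    by (rule totally_nonneg_mult[OF mult_carrier_mat[OF c f(1)] f(2)]) (use Suc.prems in auto)
qed

text \<open>For \<open>\<rho> = \<kappa>\<close> and \<open>s = t\<close> this is conjugation by a
  signed permutation matrix. The signs are attached to the original indices, so they can be chosen
  independently of the sorting.\<close>

definition signed_reindex :: "(nat \<Rightarrow> nat) \<Rightarrow> (nat \<Rightarrow> nat) \<Rightarrow> (nat \<Rightarrow> real) \<Rightarrow> (nat \<Rightarrow> real) \<Rightarrow> real mat \<Rightarrow> real mat" where
  "signed_reindex \<rho> \<kappa> s t A = mat (dim_row A) (dim_col A) (\<lambda>(i, j). s (\<rho> i) * t (\<kappa> j) * A $$ (\<rho> i, \<kappa> j))"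

text \<open>The inner permutation only reorders the summation, and each inner sign occurs twice and
  cancels.\<close>

lemma signed_reindex_mult:
  assumes A: "A \<in> carrier_mat n m" and B: "B \<in> carrier_mat m l"
    and \<rho>: "bij_betw \<rho> {..<n} {..<n}" and \<kappa>: "bij_betw \<kappa> {..<m} {..<m}" and \<tau>: "bij_betw \<tau> {..<l} {..<l}"
    and t: "\<And>j. t j * t j = 1"
  shows "signed_reindex \<rho> \<tau> s u (A * B) = signed_reindex \<rho> \<kappa> s t A * signed_reindex \<kappa> \<tau> t u B"
proof (rule eq_matI)
  fix i j
  assume "i < dim_row (signed_reindex \<rho> \<kappa> s t A * signed_reindex \<kappa> \<tau> t u B)"
    "j < dim_col (signed_reindex \<rho> \<kappa> s t A * signed_reindex \<kappa> \<tau> t u B)"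
  then have ij: "i < n" "j < l" using A B unfolding signed_reindex_def by auto
  then have r: "\<rho> i < n" "\<tau> j < l" using \<rho> \<tau> unfolding bij_betw_def by auto
  have "(A * B) $$ (\<rho> i, \<tau> j) = (\<Sum>y<m. A $$ (\<rho> i, y) * B $$ (y, \<tau> j))"
    using A B r by (simp add: scalar_prod_def atLeast0LessThan)
  also have "\<dots> = (\<Sum>y<m. A $$ (\<rho> i, \<kappa> y) * B $$ (\<kappa> y, \<tau> j))"
    by (rule sum.reindex_bij_betw[OF \<kappa>, symmetric])
  finally have "s (\<rho> i) * u (\<tau> j) * (A * B) $$ (\<rho> i, \<tau> j) =
      (\<Sum>y<m. s (\<rho> i) * u (\<tau> j) * (t (\<kappa> y) * t (\<kappa> y)) * (A $$ (\<rho> i, \<kappa> y) * B $$ (\<kappa> y, \<tau> j)))"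
    by (simp add: sum_distrib_left t)
  also have "\<dots> = (\<Sum>y<m. (s (\<rho> i) * t (\<kappa> y) * A $$ (\<rho> i, \<kappa> y)) * (t (\<kappa> y) * u (\<tau> j) * B $$ (\<kappa> y, \<tau> j)))"
    by (intro sum.cong) (auto simp: algebra_simps)
  finally show "signed_reindex \<rho> \<tau> s u (A * B) $$ (i, j) =
      (signed_reindex \<rho> \<kappa> s t A * signed_reindex \<kappa> \<tau> t u B) $$ (i, j)"
    using A B ij r unfolding signed_reindex_def by (simp add: scalar_prod_def atLeast0LessThan)
qed (use A B in \<open>auto simp: signed_reindex_def\<close>)

lemma signed_reindex_carrier [simp]:
  "A \<in> carrier_mat n m \<Longrightarrow> signed_reindex \<rho> \<kappa> s t A \<in> carrier_mat n m"
  unfolding signed_reindex_def by auto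

lemma signed_reindex_transpose:
  assumes "A \<in> carrier_mat n m" "bij_betw \<rho> {..<n} {..<n}" "bij_betw \<kappa> {..<m} {..<m}"
  shows "signed_reindex \<kappa> \<rho> t s A\<^sup>T = (signed_reindex \<rho> \<kappa> s t A)\<^sup>T"
proof (rule eq_matI)
  fix i j assume "i < dim_row (signed_reindex \<rho> \<kappa> s t A)\<^sup>T" "j < dim_col (signed_reindex \<rho> \<kappa> s t A)\<^sup>T"
  then have "i < m" "j < n" using assms(1) unfolding signed_reindex_def by auto
  moreover from this have "\<kappa> i < m" "\<rho> j < n" using assms unfolding bij_betw_def by auto
  ultimately show "signed_reindex \<kappa> \<rho> t s A\<^sup>T $$ (i, j) = (signed_reindex \<rho> \<kappa> s t A)\<^sup>T $$ (i, j)"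
    using assms(1) unfolding signed_reindex_def by simp
qed (use assms in \<open>auto simp: signed_reindex_def\<close>)

text \<open>Factors alternate with transposes, so \<open>\<rho>\<close> and \<open>\<kappa>\<close>
  alternate as well: one choice of orders and signs serves all factors, and the product undergoes a
  signed permutation similarity.\<close>

lemma signed_reindex_alt_prod:
  assumes F: "\<And>i. i \<in> {1..2 * k} \<Longrightarrow> F i \<in> carrier_mat n m"
    and \<rho>: "bij_betw \<rho> {..<n} {..<n}" and \<kappa>: "bij_betw \<kappa> {..<m} {..<m}"
    and s: "\<And>j. s j * s j = 1" and t: "\<And>j. t j * t j = 1"
  shows "signed_reindex \<rho> \<rho> s s (alt_prod n F k) = alt_prod n (\<lambda>i. signed_reindex \<rho> \<kappa> s t (F i)) k"
  using F
proof (induction k)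
  case 0
  have "\<rho> i = \<rho> j \<longleftrightarrow> i = j" "\<rho> i < n" if "i < n" "j < n" for i j
    using \<rho> that unfolding bij_betw_def inj_on_def by auto
  then show ?case by (intro eq_matI) (auto simp: signed_reindex_def s)
next
  case (Suc k)
  have c: "alt_prod n F k \<in> carrier_mat n n" using Suc.prems by (intro alt_prod_carrier[where m = m]) auto
  have f: "F (2 * k + 1) \<in> carrier_mat n m" "F (2 * k + 2) \<in> carrier_mat n m"
    "(F (2 * k + 2))\<^sup>T \<in> carrier_mat m n" using Suc.prems by auto
  have "signed_reindex \<rho> \<rho> s s (alt_prod n F (Suc k)) =
      signed_reindex \<rho> \<kappa> s t (alt_prod n F k * F (2 * k + 1)) * signed_reindex \<kappa> \<rho> t s (F (2 * k + 2))\<^sup>T"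
    unfolding alt_prod.simps by (rule signed_reindex_mult[OF mult_carrier_mat[OF c f(1)] f(3) \<rho> \<kappa> \<rho> t])
  also have "signed_reindex \<rho> \<kappa> s t (alt_prod n F k * F (2 * k + 1)) =
      signed_reindex \<rho> \<rho> s s (alt_prod n F k) * signed_reindex \<rho> \<kappa> s t (F (2 * k + 1))"
    by (rule signed_reindex_mult[OF c f(1) \<rho> \<rho> \<kappa> s])
  also have "signed_reindex \<rho> \<rho> s s (alt_prod n F k) = alt_prod n (\<lambda>i. signed_reindex \<rho> \<kappa> s t (F i)) k"
    by (rule Suc.IH) (use Suc.prems in auto)
  also have "signed_reindex \<kappa> \<rho> t s (F (2 * k + 2))\<^sup>T = (signed_reindex \<rho> \<kappa> s t (F (2 * k + 2)))\<^sup>T"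
    by (rule signed_reindex_transpose[OF f(2) \<rho> \<kappa>])
  finally show ?case unfolding alt_prod.simps .
qed

text \<open>Every term of the Leibniz expansion contains each sign \<open>c a\<close> twice, once
  through its row and once through its column. Permuting rows and columns simultaneously contributes
  \<open>signof p\<close> twice.\<close>

lemma det_signed_permuted:
  fixes N :: "real mat"
  assumes N: "N \<in> carrier_mat k k" and p: "p permutes {0..<k}" and c: "\<And>a. a < k \<Longrightarrow> c a * c a = 1"
  shows "det (mat k k (\<lambda>(a, b). c a * c b * N $$ (p a, p b))) = det N"
proof -
  have "det (mat k k (\<lambda>(a, b). c a * c b * N $$ (p a, p b))) = det (mat k k (\<lambda>(a, b). N $$ (p a, p b)))"
    unfolding det_def'[OF mat_carrier]
  proof (intro sum.cong refl arg_cong[where f = "\<lambda>x. _ * x"])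
    fix q assume "q \<in> {q. q permutes {0..<k}}"
    then have q: "q permutes {0..<k}" by simp
    have "(\<Prod>i = 0..<k. mat k k (\<lambda>(a, b). c a * c b * N $$ (p a, p b)) $$ (i, q i)) =
        (\<Prod>i = 0..<k. c i) * (\<Prod>i = 0..<k. c (q i)) * (\<Prod>i = 0..<k. N $$ (p i, p (q i)))"
      unfolding prod.distrib[symmetric] using q by (intro prod.cong) (auto simp: permutes_below_iff)
    also have "(\<Prod>i = 0..<k. c (q i)) = (\<Prod>i = 0..<k. c i)"
      using prod.permute[OF q, of c] by (simp add: comp_def)
    also have "(\<Prod>i = 0..<k. c i) * (\<Prod>i = 0..<k. c i) = 1"
      unfolding prod.distrib[symmetric] using c by (intro prod.neutral) auto
    finally show "(\<Prod>i = 0..<k. mat k k (\<lambda>(a, b). c a * c b * N $$ (p a, p b)) $$ (i, q i)) =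
        (\<Prod>i = 0..<k. mat k k (\<lambda>(a, b). N $$ (p a, p b)) $$ (i, q i))"
      using q by (auto simp: permutes_below_iff intro!: prod.cong)
  qed
  also have "mat k k (\<lambda>(a, b). N $$ (p a, p b)) =
      mat k k (\<lambda>(a, b). (mat k k (\<lambda>(b, a). N\<^sup>T $$ (p b, a)))\<^sup>T $$ (p a, b))"
    by (rule eq_matI) (use p N in \<open>auto simp: permutes_below_iff\<close>)
  also have "det \<dots> = signof p * det ((mat k k (\<lambda>(b, a). N\<^sup>T $$ (p b, a)))\<^sup>T)"
    by (rule det_permute_rows[OF _ p]) simp
  also have "det ((mat k k (\<lambda>(b, a). N\<^sup>T $$ (p b, a)))\<^sup>T) = det (mat k k (\<lambda>(b, a). N\<^sup>T $$ (p b, a)))"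
    by (rule det_transpose[where n = k]) simp
  also have "\<dots> = signof p * det N\<^sup>T"
    by (rule det_permute_rows[OF _ p]) (use N in simp)
  also have "det N\<^sup>T = det N" by (rule det_transpose[OF N])
  also have "signof p * (signof p * det N) = det N"
    by (simp add: sign_def)
  finally show ?thesis .
qed

text \<open>The principal minor on \<open>I\<close> corresponds to the one on its preimage
  \<open>J\<close>. The map \<open>\<rho>\<close> need not carry the increasing order of
  \<open>J\<close> to that of \<open>I\<close>; the discrepancy is a permutation \<open>p\<close>
  acting on rows and columns alike.\<close>

lemma P0_signed_reindex:
  assumes M: "M \<in> carrier_mat n n" and \<rho>: "bij_betw \<rho> {..<n} {..<n}" and s: "\<And>j. s j * s j = (1::real)"
    and tn: "totally_nonneg (signed_reindex \<rho> \<rho> s s M)"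
  shows "M \<in> P0_matrices"
proof -
  let ?N = "signed_reindex \<rho> \<rho> s s M"
  have N: "?N \<in> carrier_mat n n" using M by simp
  have "0 \<le> det (submatrix M I I)" if "I \<subseteq> {..<n}" for I
  proof -
    define k where "k = card I"
    define J where "J = {j. j < n \<and> \<rho> j \<in> I}"
    have I: "I \<in> ksubsets n k" using that unfolding ksubsets_def k_def by simp
    have bJ: "bij_betw \<rho> J I"
    proof (rule bij_betwI')
      show "\<rho> x = \<rho> y \<longleftrightarrow> x = y" if "x \<in> J" "y \<in> J" for x y
        using that \<rho> unfolding J_def bij_betw_def inj_on_def by auto
      show "\<rho> x \<in> I" if "x \<in> J" for x using that unfolding J_def by simp
      show "\<exists>x\<in>J. y = \<rho> x" if "y \<in> I" for y
      proof -
        have "y \<in> \<rho> ` {..<n}" using \<rho> that \<open>I \<subseteq> {..<n}\<close> unfolding bij_betw_def by auto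
        then show ?thesis using that unfolding J_def by auto
      qed
    qed
    have J: "J \<in> ksubsets n k"
      using bij_betw_same_card[OF bJ] unfolding ksubsets_def k_def by (auto simp: J_def)
    have pI: "bij_betw (pick I) {0..<k} I"
      using pick_bij_betw[OF finite_ksubset[OF I]] unfolding k_def .
    have "bij_betw (pick J) {0..<k} J"
      using pick_bij_betw[OF finite_ksubset[OF J]] J unfolding ksubsets_def by simp
    then have pJ: "bij_betw (\<rho> \<circ> pick J) {0..<k} I" using bJ by (rule bij_betw_trans)
    define p where "p a = (if a < k then inv_into {0..<k} (\<rho> \<circ> pick J) (pick I a) else a)" for a
    have b1: "bij_betw (inv_into {0..<k} (\<rho> \<circ> pick J) \<circ> pick I) {0..<k} {0..<k}"
      by (rule bij_betw_trans[OF pI bij_betw_inv_into[OF pJ]])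
    have "bij_betw p {0..<k} {0..<k}"
      using b1 by (rule bij_betw_cong[THEN iffD1, rotated]) (simp add: p_def)
    then have p: "p permutes {0..<k}"
      by (rule bij_imp_permutes) (simp add: p_def)
    have pick: "pick I a = \<rho> (pick J (p a))" if "a < k" for a
    proof -
      have "pick I a \<in> (\<rho> \<circ> pick J) ` {0..<k}"
        using pI pJ that unfolding bij_betw_def by auto
      then show ?thesis using that f_inv_into_f[of "pick I a" "\<rho> \<circ> pick J" "{0..<k}"]
        unfolding p_def by simp
    qed
    have "submatrix M I I = mat k k (\<lambda>(a, b). s (pick I a) * s (pick I b) * submatrix ?N J J $$ (p a, p b))"
    proof (rule eq_matI)
      fix a b
      assume "a < dim_row (mat k k (\<lambda>(a, b). s (pick I a) * s (pick I b) * submatrix ?N J J $$ (p a, p b)))"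
        "b < dim_col (mat k k (\<lambda>(a, b). s (pick I a) * s (pick I b) * submatrix ?N J J $$ (p a, p b)))"
      then have ab: "a < k" "b < k" by auto
      then have pab: "p a < k" "p b < k" using p by (auto simp: permutes_below_iff)
      have "submatrix ?N J J $$ (p a, p b) = ?N $$ (pick J (p a), pick J (p b))"
        using pab by (simp add: submatrix_ksubsets[OF N J J])
      also have "\<dots> = s (pick I a) * s (pick I b) * M $$ (pick I a, pick I b)"
        using pick_ksubset[OF J] pab M
        by (simp add: signed_reindex_def pick[OF ab(1)] pick[OF ab(2)])
      also have "s (pick I a) * s (pick I b) * \<dots> =
          (s (pick I a) * s (pick I a)) * (s (pick I b) * s (pick I b)) * M $$ (pick I a, pick I b)"
        by (simp only: ac_simps)
      finally have "M $$ (pick I a, pick I b) = s (pick I a) * s (pick I b) * submatrix ?N J J $$ (p a, p b)"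
        by (simp add: s)
      then show "submatrix M I I $$ (a, b) =
          mat k k (\<lambda>(a, b). s (pick I a) * s (pick I b) * submatrix ?N J J $$ (p a, p b)) $$ (a, b)"
        using ab by (simp add: submatrix_ksubsets[OF M I I])
    qed (simp_all add: submatrix_ksubsets[OF M I I])
    then have "det (submatrix M I I) = det (submatrix ?N J J)"
      by (simp add: det_signed_permuted[OF submatrix_carrier[OF N J J] p] s)
    then show ?thesis using tn J N unfolding totally_nonneg_def by auto
  qed
  then show ?thesis using M unfolding P0_matrices_def by auto
qed

text \<open>A signed permutation is a similarity; \<open>w\<close> is the eigenvector
  \<open>v\<close> transported along it.\<close>

lemma PS_signed_reindex:
  assumes M: "M \<in> carrier_mat n n" and \<rho>: "bij_betw \<rho> {..<n} {..<n}" and s: "\<And>j. s j * s j = (1::real)"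
    and PS: "signed_reindex \<rho> \<rho> s s M \<in> PS_matrices"
  shows "M \<in> PS_matrices"
proof -
  let ?N = "signed_reindex \<rho> \<rho> s s M"
  have N: "?N \<in> carrier_mat n n" using M by simp
  have "z \<in> \<real> \<and> 0 \<le> Re z" if ev: "eigenvalue (map_mat complex_of_real M) z" for z
  proof -
    obtain v where v: "v \<in> carrier_vec n" "v \<noteq> 0\<^sub>v n" "map_mat complex_of_real M *\<^sub>v v = z \<cdot>\<^sub>v v"
      using ev M unfolding eigenvalue_def eigenvector_def by auto
    define w where "w = vec n (\<lambda>i. of_real (s (\<rho> i)) * v $ \<rho> i)"
    have \<rho>n: "\<rho> i < n" if "i < n" for i using \<rho> that unfolding bij_betw_def by auto
    have "\<exists>x<n. v $ x \<noteq> 0"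
    proof (rule ccontr)
      assume "\<not> ?thesis"
      then have "v = 0\<^sub>v n" using v(1) by (intro eq_vecI) auto
      with v(2) show False by simp
    qed
    then obtain x where x: "x < n" "v $ x \<noteq> 0" by blast
    then have "x \<in> \<rho> ` {..<n}" using bij_betw_imp_surj_on[OF \<rho>] by simp
    then obtain i where i: "i < n" "\<rho> i = x" by auto
    have "s (\<rho> i) \<noteq> 0" using s[of "\<rho> i"] by auto
    then have "w $ i \<noteq> 0" unfolding w_def using i x by simp
    then have w0: "w \<noteq> 0\<^sub>v n" using i by auto
    have "map_mat complex_of_real ?N *\<^sub>v w = z \<cdot>\<^sub>v w"
    proof (rule eq_vecI)
      fix i assume "i < dim_vec (z \<cdot>\<^sub>v w)"
      then have i: "i < n" unfolding w_def by simp
      have "z * v $ \<rho> i = (map_mat complex_of_real M *\<^sub>v v) $ \<rho> i" using v \<rho>n[OF i] by simp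
      also have "\<dots> = (\<Sum>x<n. of_real (M $$ (\<rho> i, x)) * v $ x)"
        using M v(1) \<rho>n[OF i] by (simp add: scalar_prod_def atLeast0LessThan)
      also have "\<dots> = (\<Sum>x<n. of_real (M $$ (\<rho> i, \<rho> x)) * v $ \<rho> x)"
        by (rule sum.reindex_bij_betw[OF \<rho>, symmetric])
      finally have e: "z * v $ \<rho> i = (\<Sum>x<n. of_real (M $$ (\<rho> i, \<rho> x)) * v $ \<rho> x)" .
      have "(map_mat complex_of_real ?N *\<^sub>v w) $ i =
          (\<Sum>x<n. of_real (s (\<rho> i) * s (\<rho> x) * M $$ (\<rho> i, \<rho> x)) * (of_real (s (\<rho> x)) * v $ \<rho> x))"
        using M i by (simp add: signed_reindex_def w_def scalar_prod_def atLeast0LessThan)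
      also have "\<dots> = (\<Sum>x<n. of_real (s (\<rho> i)) * (of_real (s (\<rho> x) * s (\<rho> x))) * (of_real (M $$ (\<rho> i, \<rho> x)) * v $ \<rho> x))"
        by (intro sum.cong) (auto simp: algebra_simps)
      also have "\<dots> = of_real (s (\<rho> i)) * (z * v $ \<rho> i)" unfolding e s by (simp add: sum_distrib_left)
      finally show "(map_mat complex_of_real ?N *\<^sub>v w) $ i = (z \<cdot>\<^sub>v w) $ i"
        using i unfolding w_def by simp
    qed (use N in \<open>simp add: w_def\<close>)
    then have "eigenvalue (map_mat complex_of_real ?N) z"
      unfolding eigenvalue_def eigenvector_def using w0 M
      by (intro exI[of _ w]) (auto simp: w_def signed_reindex_def)
    then show ?thesis using PS unfolding PS_matrices_def by auto
  qed
  then show ?thesis using M unfolding PS_matrices_def by auto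
qed

section \<open>From monotone keys to signs and orders\<close>

text \<open>Vertex-disjoint edges are strictly comparable. This is what a caterpillar forest provides
  when its vertices are listed along the spines.\<close>

definition monotone_keys :: "(nat \<times> nat) set \<Rightarrow> (nat \<Rightarrow> nat) \<Rightarrow> (nat \<Rightarrow> nat) \<Rightarrow> bool" where
  "monotone_keys S f g \<longleftrightarrow> (\<forall>x y x' y'. (x, y) \<in> S \<longrightarrow> (x', y') \<in> S \<longrightarrow> x \<noteq> x' \<longrightarrow> y \<noteq> y' \<longrightarrow>
     f x < f x' \<and> g y < g y' \<or> f x' < f x \<and> g y' < g y)"

text \<open>An edge of largest \<open>f x + g y\<close> has an endpoint on no other edge. Once the
  remaining edges are made positive, the sign at this free endpoint can be adjusted without
  affecting them.\<close>

lemma monotone_keys_signature: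
  fixes h :: "nat \<times> nat \<Rightarrow> real"
  assumes "finite S" "monotone_keys S f g" "\<And>e. e \<in> S \<Longrightarrow> h e \<noteq> 0"
  shows "\<exists>s t. (\<forall>x. s x * s x = 1) \<and> (\<forall>y. t y * t y = 1) \<and> (\<forall>(x, y)\<in>S. 0 < s x * t y * h (x, y))"
  using assms
proof (induction "card S" arbitrary: S)
  case 0
  then have "S = {}" by simp
  then show ?case by (intro exI[of _ "\<lambda>_. 1"]) simp
next
  case (Suc k)
  define w where "w e = f (fst e) + g (snd e)" for e
  have "S \<noteq> {}" using Suc.hyps(2) by auto
  then have "Max (w ` S) \<in> w ` S" using Suc.prems(1) by (intro Max_in) auto
  then obtain x y where xy: "(x, y) \<in> S" and mx: "w (x, y) = Max (w ` S)" by auto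
  have mx: "w e \<le> w (x, y)" if "e \<in> S" for e unfolding mx using that Suc.prems(1) by (intro Max_ge) auto
  define T where "T = S - {(x, y)}"
  \<comment> \<open>Two further edges \<open>(x, y')\<close> and \<open>(x', y)\<close> would be
    vertex-disjoint, hence strictly comparable, and then one of them would outweigh
    \<open>(x, y)\<close>.\<close>
  have free: "(\<forall>y'. (x, y') \<notin> T) \<or> (\<forall>x'. (x', y) \<notin> T)"
  proof (rule ccontr)
    assume "\<not> ?thesis"
    then obtain y' x' where e: "(x, y') \<in> S" "y' \<noteq> y" "(x', y) \<in> S" "x' \<noteq> x" unfolding T_def by auto
    have "f x < f x' \<and> g y' < g y \<or> f x' < f x \<and> g y < g y'"
      using Suc.prems(2) e unfolding monotone_keys_def by blast
    then show False using mx[OF e(1)] mx[OF e(3)] unfolding w_def by auto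
  qed
  have "k = card T" using Suc.hyps(2) xy Suc.prems(1) unfolding T_def by simp
  moreover have "finite T" "monotone_keys T f g" "\<And>e. e \<in> T \<Longrightarrow> h e \<noteq> 0"
    using Suc.prems unfolding T_def monotone_keys_def by auto
  ultimately obtain s t where "(\<forall>x. s x * s x = (1::real)) \<and> (\<forall>y. t y * t y = (1::real)) \<and>
    (\<forall>(x, y)\<in>T. 0 < s x * t y * h (x, y))" using Suc.hyps(1)[of T] by blast
  then have st: "s x * s x = 1" "t y * t y = 1" "(x, y) \<in> T \<Longrightarrow> 0 < s x * t y * h (x, y)" for x y
    by auto
  define c where "c = (if 0 < s x * t y * h (x, y) then 1 else -1 :: real)"
  have "s x \<noteq> 0" "t y \<noteq> 0" using st(1)[of x] st(2)[of y] by auto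
  then have c: "0 < c * (s x * t y * h (x, y))" "c * c = 1"
    using Suc.prems(3)[OF xy] unfolding c_def by (auto simp: not_less mult_less_0_iff zero_less_mult_iff less_le)
  from free show ?case
  proof
    assume fr: "\<forall>y'. (x, y') \<notin> T"
    show ?thesis
    proof (intro exI conjI allI)
      show "(s(x := c * s x)) a * (s(x := c * s x)) a = 1" for a
      proof (cases "a = x")
        case True
        have "(s(x := c * s x)) a * (s(x := c * s x)) a = (c * c) * (s a * s a)" using True by simp
        then show ?thesis using c(2) st(1)[of a] by simp
      qed (simp add: st)
      show "t a * t a = 1" for a by (rule st)
      show "\<forall>(a, b)\<in>S. 0 < (s(x := c * s x)) a * t b * h (a, b)"
      proof clarify
        fix a b assume ab: "(a, b) \<in> S"
        show "0 < (s(x := c * s x)) a * t b * h (a, b)"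
        proof (cases "a = x")
          case True
          with ab fr have "(a, b) = (x, y)" unfolding T_def by auto
          then show ?thesis using c(1) by (simp add: mult.assoc mult.left_commute)
        next
          case False
          with ab have "(a, b) \<in> T" unfolding T_def by auto
          then show ?thesis using st(3)[of a b] False by simp
        qed
      qed
    qed
  next
    assume fr: "\<forall>x'. (x', y) \<notin> T"
    show ?thesis
    proof (intro exI conjI allI)
      show "s a * s a = 1" for a by (rule st)
      show "(t(y := c * t y)) a * (t(y := c * t y)) a = 1" for a
      proof (cases "a = y")
        case True
        have "(t(y := c * t y)) a * (t(y := c * t y)) a = (c * c) * (t a * t a)" using True by simp
        then show ?thesis using c(2) st(2)[of a] by simp
      qed (simp add: st)
      show "\<forall>(a, b)\<in>S. 0 < s a * (t(y := c * t y)) b * h (a, b)"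
      proof clarify
        fix a b assume ab: "(a, b) \<in> S"
        show "0 < s a * (t(y := c * t y)) b * h (a, b)"
        proof (cases "b = y")
          case True
          with ab fr have "(a, b) = (x, y)" unfolding T_def by auto
          then show ?thesis using c(1) by (simp add: mult.assoc mult.left_commute)
        next
          case False
          with ab have "(a, b) \<in> T" unfolding T_def by auto
          then show ?thesis using st(3)[of a b] False by simp
        qed
      qed
    qed
  qed
qed

lemma sorting_bijection:
  fixes f :: "nat \<Rightarrow> nat"
  shows "\<exists>\<rho>. bij_betw \<rho> {..<n} {..<n} \<and> (\<forall>i j. i < j \<longrightarrow> j < n \<longrightarrow> f (\<rho> i) \<le> f (\<rho> j))"
proof -
  define xs where "xs = sort_key f [0..<n]"
  have xs: "distinct xs" "set xs = {..<n}" "length xs = n" unfolding xs_def by auto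
  have "bij_betw ((!) xs) {..<n} {..<n}"
    by (rule bij_betw_nth[OF xs(1)]) (simp_all add: xs(2,3))
  moreover have "f (xs ! i) \<le> f (xs ! j)" if "i < j" "j < n" for i j
    using sorted_nth_mono[of "map f xs" i j] that xs(3) sorted_sort_key[of f "[0..<n]"]
    by (simp flip: xs_def)
  ultimately show ?thesis by (intro exI[of _ "(!) xs"]) simp
qed

text \<open>Orders and signs depend only on the sign pattern of \<open>A\<close>, so a single choice
  turns every matrix of the class into a nonnegative staircase.\<close>

theorem monotone_keys_qual_power:
  assumes A: "A \<in> carrier_mat n m"
    and keys: "monotone_keys {(i, j). i < n \<and> j < m \<and> A $$ (i, j) \<noteq> 0} f g"
  shows "qual_power k A \<subseteq> P0_matrices \<inter> PS_matrices"
proof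
  fix M assume "M \<in> qual_power k A"
  then obtain F where M: "M = alt_prod n F k" and F: "\<And>i. i \<in> {1..2 * k} \<Longrightarrow> F i \<in> qual_class A"
    using A unfolding qual_power_def by auto
  let ?S = "{(i, j). i < n \<and> j < m \<and> A $$ (i, j) \<noteq> 0}"
  have "finite ?S" by (rule finite_subset[of _ "{..<n} \<times> {..<m}"]) auto
  then have "\<exists>s t. (\<forall>x. s x * s x = (1::real)) \<and> (\<forall>y. t y * t y = (1::real)) \<and>
    (\<forall>(x, y)\<in>?S. 0 < s x * t y * A $$ (x, y))"
    by (rule monotone_keys_signature[OF _ keys]) auto
  then obtain s t where "(\<forall>x. s x * s x = (1::real)) \<and> (\<forall>y. t y * t y = (1::real)) \<and>
    (\<forall>(x, y)\<in>?S. 0 < s x * t y * A $$ (x, y))" by (elim exE)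
  then have s: "s x * s x = 1" and t: "t y * t y = 1"
    and st: "(x, y) \<in> ?S \<Longrightarrow> 0 < s x * t y * A $$ (x, y)" for x y by auto
  obtain \<rho> where "bij_betw \<rho> {..<n} {..<n} \<and> (\<forall>i j. i < j \<longrightarrow> j < n \<longrightarrow> f (\<rho> i) \<le> f (\<rho> j))"
    using sorting_bijection[of n f] ..
  then have \<rho>: "bij_betw \<rho> {..<n} {..<n}" "\<And>i j. i < j \<Longrightarrow> j < n \<Longrightarrow> f (\<rho> i) \<le> f (\<rho> j)" by auto
  obtain \<kappa> where "bij_betw \<kappa> {..<m} {..<m} \<and> (\<forall>i j. i < j \<longrightarrow> j < m \<longrightarrow> g (\<kappa> i) \<le> g (\<kappa> j))"
    using sorting_bijection[of m g] ..
  then have \<kappa>: "bij_betw \<kappa> {..<m} {..<m}" "\<And>i j. i < j \<Longrightarrow> j < m \<Longrightarrow> g (\<kappa> i) \<le> g (\<kappa> j)" by auto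
  have \<rho>n: "\<rho> i < n" if "i < n" for i using \<rho>(1) that unfolding bij_betw_def by auto
  have \<kappa>m: "\<kappa> i < m" if "i < m" for i using \<kappa>(1) that unfolding bij_betw_def by auto
  have qc: "B \<in> carrier_mat n m" "\<And>i j. i < n \<Longrightarrow> j < m \<Longrightarrow> sgn (B $$ (i, j)) = sgn (A $$ (i, j))"
    if "B \<in> qual_class A" for B using that A unfolding qual_class_def by auto
  have TN: "totally_nonneg (signed_reindex \<rho> \<kappa> s t B) \<and> totally_nonneg (signed_reindex \<rho> \<kappa> s t B)\<^sup>T"
    if B: "B \<in> qual_class A" for B
  proof -
    let ?B = "signed_reindex \<rho> \<kappa> s t B"
    have Bc: "?B \<in> carrier_mat n m" using qc[OF B] by simp
    have ent: "?B $$ (i, j) = s (\<rho> i) * t (\<kappa> j) * B $$ (\<rho> i, \<kappa> j)" if "i < n" "j < m" for i j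
      using that qc(1)[OF B] unfolding signed_reindex_def by auto
    have nn: "0 \<le> ?B $$ (i, j)" if ij: "i < n" "j < m" for i j
    proof (cases "A $$ (\<rho> i, \<kappa> j) = 0")
      case True
      then have "B $$ (\<rho> i, \<kappa> j) = 0" using qc(2)[OF B \<rho>n[OF ij(1)] \<kappa>m[OF ij(2)]] by (simp add: sgn_0_0)
      then show ?thesis using ent[OF ij] by simp
    next
      case False
      then have "0 < s (\<rho> i) * t (\<kappa> j) * A $$ (\<rho> i, \<kappa> j)" using st \<rho>n \<kappa>m ij by simp
      then have "0 < sgn (s (\<rho> i) * t (\<kappa> j) * A $$ (\<rho> i, \<kappa> j))" by simp
      also have "\<dots> = sgn (?B $$ (i, j))"
        using qc(2)[OF B \<rho>n[OF ij(1)] \<kappa>m[OF ij(2)]] ent[OF ij] by (simp add: sgn_mult)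
      finally show ?thesis by simp
    qed
    have stair: "staircase ?B"
      unfolding staircase_def
    proof (intro allI impI, rule ccontr)
      fix i i' j j'
      assume h: "i < i'" "i' < dim_row ?B" "j < dim_col ?B" "j' < dim_col ?B"
        "?B $$ (i, j) \<noteq> 0" "?B $$ (i', j') \<noteq> 0" "\<not> j \<le> j'"
      then have ij: "i < n" "i' < n" "j < m" "j' < m" using Bc by auto
      have nz: "A $$ (\<rho> i, \<kappa> j) \<noteq> 0" "A $$ (\<rho> i', \<kappa> j') \<noteq> 0"
        using h(5,6) ent[of i j] ent[of i' j'] ij qc(2)[OF B \<rho>n \<kappa>m, of i j] qc(2)[OF B \<rho>n \<kappa>m, of i' j']
        by (auto simp: sgn_0_0)
      have ne: "\<rho> i \<noteq> \<rho> i'" "\<kappa> j \<noteq> \<kappa> j'"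
        using inj_onD[OF bij_betw_imp_inj_on[OF \<rho>(1)], of i i'] inj_onD[OF bij_betw_imp_inj_on[OF \<kappa>(1)], of j j'] h(1,7) ij
        by auto
      \<comment> \<open>Sorting may leave ties, but entries in different rows and columns are
        disjoint edges and compare strictly in both keys, in the same direction.\<close>
      have "f (\<rho> i) < f (\<rho> i') \<and> g (\<kappa> j) < g (\<kappa> j') \<or> f (\<rho> i') < f (\<rho> i) \<and> g (\<kappa> j') < g (\<kappa> j)"
        using keys[unfolded monotone_keys_def, rule_format, of "\<rho> i" "\<kappa> j" "\<rho> i'" "\<kappa> j'"] nz ne \<rho>n \<kappa>m ij
        by simp
      moreover have "f (\<rho> i) \<le> f (\<rho> i')" "g (\<kappa> j') \<le> g (\<kappa> j)" using \<rho>(2) \<kappa>(2) h ij by auto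
      ultimately show False by auto
    qed
    have nn': "0 \<le> ?B\<^sup>T $$ (j, i)" if "j < m" "i < n" for i j using nn[OF that(2,1)] Bc that by simp
    have BT: "?B\<^sup>T \<in> carrier_mat m n" using Bc by simp
    show ?thesis
      using staircase_totally_nonneg[OF Bc stair nn] staircase_totally_nonneg[OF BT staircase_transpose[OF stair] nn']
      by simp
  qed
  have Fc: "F i \<in> carrier_mat n m" if "i \<in> {1..2 * k}" for i using qc(1)[OF F[OF that]] .
  have Mc: "M \<in> carrier_mat n n" unfolding M by (rule alt_prod_carrier[OF Fc])
  have "totally_nonneg (alt_prod n (\<lambda>i. signed_reindex \<rho> \<kappa> s t (F i)) k)"
    by (rule totally_nonneg_alt_prod[of _ _ _ m]) (use Fc TN[OF F] in simp)
  then have tn: "totally_nonneg (signed_reindex \<rho> \<rho> s s M)"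
    unfolding M using signed_reindex_alt_prod[OF Fc \<rho>(1) \<kappa>(1) s t] by simp
  have "signed_reindex \<rho> \<rho> s s M \<in> PS_matrices"
    by (rule totally_nonneg_PS[OF signed_reindex_carrier[OF Mc] tn])
  then show "M \<in> P0_matrices \<inter> PS_matrices"
    using P0_signed_reindex[OF Mc \<rho>(1) s tn] PS_signed_reindex[where s = s, OF Mc \<rho>(1) s] by blast
qed

section \<open>Eigenvalues in the closure of the qualitative class\<close>

lemma mult_transpose_entry:
  fixes P :: "'a :: comm_semiring_1 mat"
  assumes P: "P \<in> carrier_mat n n" and X: "X \<in> carrier_mat n m" and Y: "Y \<in> carrier_mat n m"
    and "x < n" "y < n"
  shows "(P * X * Y\<^sup>T) $$ (x, y) = (\<Sum>j<m. (\<Sum>i<n. P $$ (x, i) * X $$ (i, j)) * Y $$ (y, j))"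
proof -
  define Z where "Z = P * X"
  have Z: "Z \<in> carrier_mat n m" "\<And>j. j < m \<Longrightarrow> Z $$ (x, j) = (\<Sum>i<n. P $$ (x, i) * X $$ (i, j))"
    unfolding Z_def using assms by (auto simp: scalar_prod_def atLeast0LessThan)
  show ?thesis
    unfolding Z_def[symmetric] using Z Y assms(4,5) by (simp add: scalar_prod_def atLeast0LessThan)
qed

lemma alt_prod_tendsto:
  assumes X: "\<And>s i. i \<in> {1..2 * k} \<Longrightarrow> X s i \<in> carrier_mat n m"
    and L: "\<And>i. i \<in> {1..2 * k} \<Longrightarrow> L i \<in> carrier_mat n m"
    and lim: "\<And>i x y. i \<in> {1..2 * k} \<Longrightarrow> x < n \<Longrightarrow> y < m \<Longrightarrow>
      ((\<lambda>s. X s i $$ (x, y)) \<longlongrightarrow> L i $$ (x, y)) F"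
    and "x < n" "y < n"
  shows "((\<lambda>s. alt_prod n (X s) k $$ (x, y)) \<longlongrightarrow> alt_prod n L k $$ (x, y)) F"
  using assms
proof (induction k arbitrary: x y)
  case (Suc k)
  have entry: "alt_prod n G (Suc k) $$ (x, y) =
      (\<Sum>j<m. (\<Sum>i<n. alt_prod n G k $$ (x, i) * G (2 * k + 1) $$ (i, j)) * G (2 * k + 2) $$ (y, j))"
    if G: "\<And>i. i \<in> {1..2 * Suc k} \<Longrightarrow> G i \<in> carrier_mat n m" for G
    unfolding alt_prod.simps
    by (rule mult_transpose_entry[OF alt_prod_carrier[where m = m]]) (use G Suc.prems(4,5) in auto)
  have eX: "alt_prod n (X s) (Suc k) $$ (x, y) = (\<Sum>j<m. (\<Sum>i<n. alt_prod n (X s) k $$ (x, i) *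
      X s (2 * k + 1) $$ (i, j)) * X s (2 * k + 2) $$ (y, j))" for s
    by (rule entry) (rule Suc.prems(1))
  have eL: "alt_prod n L (Suc k) $$ (x, y) = (\<Sum>j<m. (\<Sum>i<n. alt_prod n L k $$ (x, i) *
      L (2 * k + 1) $$ (i, j)) * L (2 * k + 2) $$ (y, j))"
    by (rule entry) (rule Suc.prems(2))
  show ?case
    unfolding eX eL
    using Suc.prems by (intro tendsto_sum tendsto_mult Suc.IH) auto
qed simp

text \<open>Membership in the closure of the qualitative class.\<close>

definition sign_dominated :: "real mat \<Rightarrow> (nat \<Rightarrow> nat \<Rightarrow> real) \<Rightarrow> bool" where
  "sign_dominated A B \<longleftrightarrow> (\<forall>i < dim_row A. \<forall>j < dim_col A. B i j \<noteq> 0 \<longrightarrow> sgn (B i j) = sgn (A $$ (i, j)))"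

text \<open>Adding \<open>s * A\<close> with \<open>s > 0\<close> gives the zero entries the signs
  of \<open>A\<close> and preserves the signs of the others, so the perturbed product lies in
  \<open>qual_power k A\<close>; then \<open>s\<close> tends to \<open>0\<close>.\<close>

lemma alt_prod_closure:
  assumes A: "A \<in> carrier_mat n m" and G: "\<And>i. i \<in> {1..2 * k} \<Longrightarrow> sign_dominated A (G i)"
  shows "qual_power k A \<subseteq> P0_matrices \<Longrightarrow> alt_prod n (\<lambda>i. mat n m (\<lambda>(x, y). G i x y)) k \<in> P0_matrices"
    and "qual_power k A \<subseteq> PS_matrices \<Longrightarrow> alt_prod n (\<lambda>i. mat n m (\<lambda>(x, y). G i x y)) k \<in> PS_matrices"
proof -
  let ?L = "alt_prod n (\<lambda>i. mat n m (\<lambda>(x, y). G i x y)) k"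
  define X where "X s = alt_prod n (\<lambda>i. mat n m (\<lambda>(x, y). G i x y + s * A $$ (x, y))) k" for s :: real
  have X: "X s \<in> carrier_mat n n" for s unfolding X_def by (rule alt_prod_carrier[where m = m]) simp
  have L: "?L \<in> carrier_mat n n" by (rule alt_prod_carrier[where m = m]) simp
  have lim: "((\<lambda>s. X s $$ (x, y)) \<longlongrightarrow> ?L $$ (x, y)) (at_right 0)" if "x < n" "y < n" for x y
    unfolding X_def
  proof (rule alt_prod_tendsto[where m = m])
    fix i x y assume "x < n" "y < m"
    have "((\<lambda>s. G i x y + s * A $$ (x, y)) \<longlongrightarrow> G i x y + 0 * A $$ (x, y)) (at_right 0)"
      by (intro tendsto_intros)
    then show "((\<lambda>s. mat n m (\<lambda>(x, y). G i x y + s * A $$ (x, y)) $$ (x, y)) \<longlongrightarrow>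
        mat n m (\<lambda>(x, y). G i x y) $$ (x, y)) (at_right 0)"
      using \<open>x < n\<close> \<open>y < m\<close> by simp
  qed (use that in auto)
  have mem: "\<forall>\<^sub>F s in at_right 0. X s \<in> qual_power k A"
    using eventually_at_right_less[of "0::real"]
  proof eventually_elim
    case (elim s)
    have "sgn (G i x y + s * A $$ (x, y)) = sgn (A $$ (x, y))" if "i \<in> {1..2 * k}" "x < n" "y < m" for i x y
    proof (cases "G i x y = 0")
      case False
      then have "sgn (G i x y) = sgn (A $$ (x, y))"
        using G[OF that(1)] A that(2,3) unfolding sign_dominated_def by auto
      then show ?thesis
        using elim False mult_pos_pos[of s "A $$ (x, y)"] mult_pos_neg[of s "A $$ (x, y)"]
        by (auto simp: sgn_if add_pos_pos split: if_splits)
    qed (use elim in \<open>simp add: sgn_mult\<close>)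
    then show ?case
      unfolding X_def qual_power_def qual_class_def using A by auto
  qed
  show "?L \<in> P0_matrices" if "qual_power k A \<subseteq> P0_matrices"
    by (rule P0_matrices_closed[where X = X and F = "at_right 0", OF X L lim])
      (use mem that in \<open>auto elim: eventually_mono\<close>)
  show "?L \<in> PS_matrices" if "qual_power k A \<subseteq> PS_matrices"
    by (rule PS_matrices_closed[where X = X and F = "at_right 0", OF X L lim])
      (use mem that in \<open>auto elim: eventually_mono\<close>)
qed

section \<open>Eigenvalues through actions on vectors\<close>

text \<open>Vectors and matrices are plain functions here, so rows and columns are addressed without
  dimension side conditions. \<open>pair_act\<close> is one pair of consecutive factors of the
  alternating product, the second one transposed.\<close>

definition row_act :: "nat \<Rightarrow> (nat \<Rightarrow> nat \<Rightarrow> real) \<Rightarrow> (nat \<Rightarrow> complex) \<Rightarrow> nat \<Rightarrow> complex" where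
  "row_act m B u i = (\<Sum>j<m. of_real (B i j) * u j)"

definition col_act :: "nat \<Rightarrow> (nat \<Rightarrow> nat \<Rightarrow> real) \<Rightarrow> (nat \<Rightarrow> complex) \<Rightarrow> nat \<Rightarrow> complex" where
  "col_act n B v j = (\<Sum>i<n. of_real (B i j) * v i)"

definition pair_act :: "nat \<Rightarrow> nat \<Rightarrow> (nat \<Rightarrow> nat \<Rightarrow> real) \<times> (nat \<Rightarrow> nat \<Rightarrow> real) \<Rightarrow> (nat \<Rightarrow> complex) \<Rightarrow> nat \<Rightarrow> complex" where
  "pair_act n m p v = row_act m (fst p) (col_act n (snd p) v)"

text \<open>\<open>z\<close> is an eigenvalue of a product of \<open>2k\<close> matrices from the closure of the qualitative class.\<close>

definition closure_eigenvalue :: "real mat \<Rightarrow> nat \<Rightarrow> complex \<Rightarrow> bool" where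
  "closure_eigenvalue A k z \<longleftrightarrow> (\<exists>ps v. length ps = k \<and>
     (\<forall>p\<in>set ps. sign_dominated A (fst p) \<and> sign_dominated A (snd p)) \<and>
     (\<exists>i<dim_row A. v i \<noteq> 0) \<and>
     (\<forall>i<dim_row A. foldr (pair_act (dim_row A) (dim_col A)) ps v i = z * v i))"

text \<open>\<open>foldr\<close> applies the last pair first, as a matrix product does, so prefixes
  of \<open>ps\<close> match the partial products of \<open>alt_prod\<close>.\<close>

lemma closure_eigenvalue_alt_prod:
  assumes A: "A \<in> carrier_mat n m" and z: "closure_eigenvalue A k z"
  obtains G where "\<forall>i\<in>{1..2 * k}. sign_dominated A (G i)"
    "eigenvalue (map_mat complex_of_real (alt_prod n (\<lambda>i. mat n m (\<lambda>(x, y). G i x y)) k)) z"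
proof -
  obtain ps v where ps: "length ps = k" "\<And>p. p \<in> set ps \<Longrightarrow> sign_dominated A (fst p) \<and> sign_dominated A (snd p)"
    and v: "\<exists>i<n. v i \<noteq> 0" and act: "\<And>i. i < n \<Longrightarrow> foldr (pair_act n m) ps v i = z * v i"
    using z A unfolding closure_eigenvalue_def by auto
  \<comment> \<open>Both \<open>2 * l + 1\<close> and \<open>2 * l + 2\<close> lead to the pair
    number \<open>l\<close>; even positions, which enter transposed, take its second
    component.\<close>
  define G where "G i = (if odd i then fst (ps ! ((i - 1) div 2)) else snd (ps ! ((i - 1) div 2)))" for i
  have dom: "sign_dominated A (G i)" if "i \<in> {1..2 * k}" for i
  proof -
    have "ps ! ((i - 1) div 2) \<in> set ps" using that ps(1) by (intro nth_mem) auto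
    then show ?thesis using ps(2) unfolding G_def by auto
  qed
  define P where "P l = alt_prod n (\<lambda>i. mat n m (\<lambda>(x, y). G i x y)) l" for l
  have P: "P l \<in> carrier_mat n n" for l unfolding P_def by (rule alt_prod_carrier[where m = m]) simp
  \<comment> \<open>The vector \<open>w\<close> stays arbitrary, since splitting off the last pair
    replaces it by its image under that pair.\<close>
  have main: "(\<Sum>x<n. of_real (P l $$ (i, x)) * w x) = foldr (pair_act n m) (take l ps) w i"
    if "l \<le> k" "i < n" for l w i
    using that
  proof (induction l arbitrary: w)
    case 0
    have "(\<Sum>x<n. of_real (P 0 $$ (i, x)) * w x) = (\<Sum>x<n. if x = i then w x else 0)"
      unfolding P_def using 0 by (intro sum.cong) auto
    then show ?case using 0 by simp
  next
    case (Suc l)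
    let ?p = "ps ! l"
    have G: "G (2 * l + 1) = fst ?p" "G (2 * l + 2) = snd ?p" unfolding G_def by auto
    have PS: "P (Suc l) = P l * mat n m (\<lambda>(x, y). fst ?p x y) * (mat n m (\<lambda>(x, y). snd ?p x y))\<^sup>T"
      unfolding P_def alt_prod.simps G ..
    have e: "P (Suc l) $$ (i, x) = (\<Sum>j<m. (\<Sum>y<n. P l $$ (i, y) * fst ?p y j) * snd ?p x j)" if "x < n" for x
      unfolding PS
      by (subst mult_transpose_entry[OF P mat_carrier mat_carrier]) (use that Suc.prems in \<open>auto intro!: sum.cong\<close>)
    have "(\<Sum>x<n. of_real (P (Suc l) $$ (i, x)) * w x) =
        (\<Sum>x<n. \<Sum>j<m. \<Sum>y<n. of_real (P l $$ (i, y)) * (of_real (fst ?p y j) * (of_real (snd ?p x j) * w x)))"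
      by (intro sum.cong refl) (simp add: e sum_distrib_right mult.assoc)
    also have "\<dots> = (\<Sum>j<m. \<Sum>x<n. \<Sum>y<n. of_real (P l $$ (i, y)) * (of_real (fst ?p y j) * (of_real (snd ?p x j) * w x)))"
      by (rule sum.swap)
    also have "\<dots> = (\<Sum>j<m. \<Sum>y<n. \<Sum>x<n. of_real (P l $$ (i, y)) * (of_real (fst ?p y j) * (of_real (snd ?p x j) * w x)))"
      by (rule sum.cong[OF refl], rule sum.swap)
    also have "\<dots> = (\<Sum>y<n. \<Sum>j<m. \<Sum>x<n. of_real (P l $$ (i, y)) * (of_real (fst ?p y j) * (of_real (snd ?p x j) * w x)))"
      by (rule sum.swap)
    also have "\<dots> = (\<Sum>y<n. of_real (P l $$ (i, y)) * pair_act n m ?p w y)"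
      unfolding pair_act_def row_act_def col_act_def by (simp add: sum_distrib_left)
    also have "\<dots> = foldr (pair_act n m) (take l ps) (pair_act n m ?p w) i"
      using Suc by simp
    also have "\<dots> = foldr (pair_act n m) (take (Suc l) ps) w i"
      using Suc.prems ps(1) by (simp add: take_Suc_conv_app_nth)
    finally show ?case .
  qed
  have "eigenvalue (map_mat complex_of_real (P k)) z"
    unfolding eigenvalue_def eigenvector_def
  proof (intro exI conjI)
    show "vec n v \<in> carrier_vec (dim_row (map_mat complex_of_real (P k)))" using P[of k] by simp
    show "vec n v \<noteq> 0\<^sub>v (dim_row (map_mat complex_of_real (P k)))"
    proof
      assume "vec n v = 0\<^sub>v (dim_row (map_mat complex_of_real (P k)))"
      moreover obtain i where "i < n" "v i \<noteq> 0" using v by blast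
      ultimately show False using P[of k] by (metis carrier_matD(1) index_map_mat(2) index_vec index_zero_vec(1))
    qed
    show "map_mat complex_of_real (P k) *\<^sub>v vec n v = z \<cdot>\<^sub>v vec n v"
    proof (rule eq_vecI)
      fix i assume "i < dim_vec (z \<cdot>\<^sub>v vec n v)"
      then have i: "i < n" by simp
      have "(map_mat complex_of_real (P k) *\<^sub>v vec n v) $ i = (\<Sum>x<n. of_real (P k $$ (i, x)) * v x)"
        using P[of k] i by (simp add: scalar_prod_def atLeast0LessThan)
      also have "\<dots> = z * v i" using main[of k i v] i act ps(1) by simp
      finally show "(map_mat complex_of_real (P k) *\<^sub>v vec n v) $ i = (z \<cdot>\<^sub>v vec n v) $ i" using i by simp
    qed (use P[of k] in simp)
  qed
  with dom show thesis unfolding P_def by (intro that[of G]) auto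
qed

lemma closure_eigenvalue_P0:
  assumes "A \<in> carrier_mat n m" "qual_power k A \<subseteq> P0_matrices"
  shows "\<not> closure_eigenvalue A k (-1)"
proof
  assume "closure_eigenvalue A k (-1)"
  from closure_eigenvalue_alt_prod[OF assms(1) this] obtain G where
    G: "\<forall>i\<in>{1..2 * k}. sign_dominated A (G i)"
    "eigenvalue (map_mat complex_of_real (alt_prod n (\<lambda>i. mat n m (\<lambda>(x, y). G i x y)) k)) (-1)" .
  then show False
    using alt_prod_closure(1)[OF assms(1) _ assms(2), of G] P0_no_eigenvalue_minus_one by blast
qed

lemma closure_eigenvalue_PS:
  assumes "A \<in> carrier_mat n m" "qual_power k A \<subseteq> PS_matrices" "closure_eigenvalue A k z"
  shows "z \<in> \<real>" "0 \<le> Re z"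
proof -
  from closure_eigenvalue_alt_prod[OF assms(1,3)] obtain G where
    G: "\<forall>i\<in>{1..2 * k}. sign_dominated A (G i)"
    "eigenvalue (map_mat complex_of_real (alt_prod n (\<lambda>i. mat n m (\<lambda>(x, y). G i x y)) k)) z" .
  have "alt_prod n (\<lambda>i. mat n m (\<lambda>(x, y). G i x y)) k \<in> PS_matrices"
    using alt_prod_closure(2)[OF assms(1) _ assms(2), of G] G(1) by blast
  with G(2) show "z \<in> \<real>" "0 \<le> Re z" unfolding PS_matrices_def by auto
qed

lemma foldr_pair_act_scale:
  "foldr (pair_act n m) ps (\<lambda>i. z * v i) = (\<lambda>i. z * foldr (pair_act n m) ps v i)"
  by (induction ps) (auto simp: pair_act_def row_act_def col_act_def sum_distrib_left fun_eq_iff algebra_simps)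

text \<open>\<open>XY\<close> and \<open>YX\<close> have the same nonzero eigenvalues, so cyclically shifting the factors by one
  exchanges the roles of rows and columns.\<close>

lemma closure_eigenvalue_transpose:
  assumes z: "closure_eigenvalue A\<^sup>T k z" and z0: "z \<noteq> 0" and k: "k > 0"
  shows "closure_eigenvalue A k z"
proof -
  define n m where "n = dim_row A" and "m = dim_col A"
  define T where "T B = (\<lambda>i j. B j i)" for B :: "nat \<Rightarrow> nat \<Rightarrow> real"
  have domT: "sign_dominated A (T B)" if "sign_dominated A\<^sup>T B" for B
    using that unfolding sign_dominated_def T_def by simp
  have act: "pair_act m n p = (\<lambda>u. col_act n (T (fst p)) (row_act m (T (snd p)) u))" for p
    unfolding pair_act_def row_act_def col_act_def T_def ..
  obtain ps u where ps: "length ps = k" "\<And>p. p \<in> set ps \<Longrightarrow> sign_dominated A\<^sup>T (fst p) \<and> sign_dominated A\<^sup>T (snd p)"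
    and u: "\<exists>i<m. u i \<noteq> 0" and pu: "\<And>i. i < m \<Longrightarrow> foldr (pair_act m n) ps u i = z * u i"
    using z unfolding closure_eigenvalue_def n_def m_def by auto
  obtain p rest where p: "ps = p # rest" using ps(1) k by (cases ps) auto
  \<comment> \<open>Each pair for the transpose is cut in the middle and its halves join the
    neighbouring factors; one row action \<open>B\<close> is left over at the end.\<close>
  have shift: "\<exists>qs B. length qs = length rest \<and> sign_dominated A B \<and>
      (\<forall>q\<in>set qs. sign_dominated A (fst q) \<and> sign_dominated A (snd q)) \<and>
      (\<forall>u. row_act m C (foldr (pair_act m n) rest u) = foldr (pair_act n m) qs (row_act m B u))"
    if "sign_dominated A C" "\<And>p. p \<in> set rest \<Longrightarrow> sign_dominated A\<^sup>T (fst p) \<and> sign_dominated A\<^sup>T (snd p)"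
    for C rest
    using that
  proof (induction rest arbitrary: C)
    case Nil
    then show ?case by (intro exI[of _ "[]"] exI[of _ C]) auto
  next
    case (Cons p rest)
    have "sign_dominated A (T (snd p))" using domT Cons.prems by simp
    then obtain qs B where qs: "length qs = length rest" "sign_dominated A B"
      "\<forall>q\<in>set qs. sign_dominated A (fst q) \<and> sign_dominated A (snd q)"
      "\<forall>u. row_act m (T (snd p)) (foldr (pair_act m n) rest u) = foldr (pair_act n m) qs (row_act m B u)"
      using Cons.IH[of "T (snd p)"] Cons.prems by auto
    have "row_act m C (foldr (pair_act m n) (p # rest) u) =
        foldr (pair_act n m) ((C, T (fst p)) # qs) (row_act m B u)" for u
      using qs(4) by (simp add: act) (simp add: pair_act_def)
    moreover have "sign_dominated A (T (fst p))" using domT Cons.prems by simp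
    ultimately show ?case using qs Cons.prems
      by (intro exI[of _ "(C, T (fst p)) # qs"] exI[of _ B]) auto
  qed
  have "sign_dominated A (T (snd p))" using domT ps(2) p by simp
  then obtain qs B where qs: "length qs = length rest" "sign_dominated A B"
    "\<forall>q\<in>set qs. sign_dominated A (fst q) \<and> sign_dominated A (snd q)"
    "\<forall>u. row_act m (T (snd p)) (foldr (pair_act m n) rest u) = foldr (pair_act n m) qs (row_act m B u)"
    using shift[of "T (snd p)" rest] ps(2) p by (auto simp del: foldr.simps)
  \<comment> \<open>If \<open>u\<close> is an eigenvector of \<open>X * Y\<close> for
    \<open>z \<noteq> 0\<close>, then \<open>w = Y * u\<close> is one of \<open>Y * X\<close>,
    nonzero because \<open>X * w = z * u\<close>.\<close>
  define w where "w = foldr (pair_act n m) qs (row_act m B u)"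
  have cw: "col_act n (T (fst p)) w j = z * u j" if "j < m" for j
    using pu[OF that] qs(4)[rule_format, of u] unfolding w_def p by (simp add: act)
  have "foldr (pair_act n m) (qs @ [(B, T (fst p))]) w = foldr (pair_act n m) qs (row_act m B (col_act n (T (fst p)) w))"
    by (simp add: pair_act_def)
  also have "row_act m B (col_act n (T (fst p)) w) = (\<lambda>i. z * row_act m B u i)"
    unfolding row_act_def by (auto simp: cw sum_distrib_left algebra_simps)
  also have "foldr (pair_act n m) qs (\<lambda>i. z * row_act m B u i) = (\<lambda>i. z * w i)"
    unfolding foldr_pair_act_scale w_def ..
  finally have ev: "foldr (pair_act n m) (qs @ [(B, T (fst p))]) w = (\<lambda>i. z * w i)" .
  have "\<exists>i<n. w i \<noteq> 0"
  proof (rule ccontr)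
    assume "\<not> ?thesis"
    then have "col_act n (T (fst p)) w j = 0" for j unfolding col_act_def by simp
    then show False using cw u z0 by force
  qed
  moreover have "sign_dominated A (T (fst p))" using domT ps(2) p by simp
  ultimately show ?thesis
    unfolding closure_eigenvalue_def n_def[symmetric] m_def[symmetric]
    using ev qs ps(1) p by (intro exI[of _ "qs @ [(B, T (fst p))]"] exI[of _ w]) auto
qed

section \<open>Tokens on rows\<close>

text \<open>Coordinates indexed by tokens instead of rows: a simultaneous move then only relabels
  the tokens and multiplies by signs, whichever rows are occupied.\<close>

definition spread :: "('t \<Rightarrow> nat) \<Rightarrow> 't set \<Rightarrow> ('t \<Rightarrow> complex) \<Rightarrow> nat \<Rightarrow> complex" where
  "spread r T x i = (if i \<in> r ` T then x (the_inv_into T r i) else 0)"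

lemma spread_eqI:
  assumes "inj_on r T" "\<And>t. t \<in> T \<Longrightarrow> f (r t) = x t" "\<And>i. i \<notin> r ` T \<Longrightarrow> f i = 0"
  shows "f = spread r T x"
  using assms by (auto simp: spread_def the_inv_into_f_f fun_eq_iff)

lemma spread_apply: "inj_on r T \<Longrightarrow> t \<in> T \<Longrightarrow> spread r T x (r t) = x t"
  by (simp add: spread_def the_inv_into_f_f)

lemma spread_cong: "inj_on r T \<Longrightarrow> (\<And>t. t \<in> T \<Longrightarrow> x t = y t) \<Longrightarrow> spread r T x = spread r T y"
  by (auto simp: spread_def the_inv_into_f_f fun_eq_iff)

text \<open>A token sitting on row \<open>r t\<close> moves along the edges to column \<open>c t\<close> and on to row \<open>r (e t)\<close>;
  all tokens of \<open>T\<close> move simultaneously.\<close>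

lemma token_step:
  assumes A: "A \<in> carrier_mat n m" and r: "inj_on r (T \<union> T')" and c: "inj_on c T" and e: "e ` T \<subseteq> T'"
    and nz: "\<And>t. t \<in> T \<Longrightarrow> c t < m \<and> r (e t) < n \<and> A $$ (r t, c t) \<noteq> 0 \<and> A $$ (r (e t), c t) \<noteq> 0"
  shows "\<exists>p. sign_dominated A (fst p) \<and> sign_dominated A (snd p) \<and>
    (\<forall>x. pair_act n m p (spread r T' x) =
      spread r T (\<lambda>t. of_real (sgn (A $$ (r t, c t)) * sgn (A $$ (r (e t), c t))) * x (e t)))"
proof -
  \<comment> \<open>Injectivity leaves one nonzero entry of \<open>B\<close> in each row
    \<open>r t\<close> and one of \<open>C\<close> in each column \<open>c t\<close>. On vectors,
    the pair pulls the value at \<open>e t\<close> back to \<open>t\<close>.\<close>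
  define B where "B i j = (if \<exists>t\<in>T. i = r t \<and> j = c t then sgn (A $$ (i, j)) else 0)" for i j
  define C where "C i j = (if \<exists>t\<in>T. i = r (e t) \<and> j = c t then sgn (A $$ (i, j)) else 0)" for i j
  have rT: "inj_on r T" and rT': "inj_on r T'" using r by (auto simp: inj_on_Un)
  have C: "col_act n C v (c t) = of_real (sgn (A $$ (r (e t), c t))) * v (r (e t))" if t: "t \<in> T" for v t
  proof -
    have "col_act n C v (c t) = (\<Sum>i<n. if i = r (e t) then of_real (sgn (A $$ (r (e t), c t))) * v (r (e t)) else 0)"
      unfolding col_act_def C_def using t inj_onD[OF c] by (intro sum.cong) auto
    then show ?thesis using nz[OF t] by simp
  qed
  have B: "row_act m B u (r t) = of_real (sgn (A $$ (r t, c t))) * u (c t)" if t: "t \<in> T" for u t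
  proof -
    have "row_act m B u (r t) = (\<Sum>j<m. if j = c t then of_real (sgn (A $$ (r t, c t))) * u (c t) else 0)"
      unfolding row_act_def B_def using t inj_onD[OF rT] by (intro sum.cong) auto
    then show ?thesis using nz[OF t] by simp
  qed
  have B0: "row_act m B u i = 0" if "i \<notin> r ` T" for u i
    unfolding row_act_def B_def using that by (intro sum.neutral) auto
  show ?thesis
  proof (intro exI[of _ "(B, C)"] conjI allI)
    show "sign_dominated A (fst (B, C))" "sign_dominated A (snd (B, C))"
      unfolding sign_dominated_def B_def C_def by auto
    fix x
    show "pair_act n m (B, C) (spread r T' x) =
      spread r T (\<lambda>t. of_real (sgn (A $$ (r t, c t)) * sgn (A $$ (r (e t), c t))) * x (e t))"
    proof (rule spread_eqI[OF rT])
      fix t assume t: "t \<in> T"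
      then have "spread r T' x (r (e t)) = x (e t)" using e by (intro spread_apply[OF rT']) auto
      then show "pair_act n m (B, C) (spread r T' x) (r t) =
          of_real (sgn (A $$ (r t, c t)) * sgn (A $$ (r (e t), c t))) * x (e t)"
        unfolding pair_act_def using B[OF t] C[OF t] by simp
    qed (simp add: pair_act_def B0)
  qed
qed

text \<open>Let \<open>c = \<plusminus>1\<close> be the product of the signs along the cycle. If \<open>c = (-1)\<^sup>l\<close>, rotating tokens on all
  \<open>l\<close> rows by one place has eigenvalue \<open>-1\<close>. Otherwise leave the last row empty: the token next to
  the gap first moves into it, and then all \<open>l - 1\<close> tokens rotate.\<close>

lemma cycle_closure_eigenvalue:
  assumes A: "A \<in> carrier_mat n m" and l: "l \<ge> 2"
    and r: "inj_on r {..<l}" and q: "inj_on q {..<l}"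
    and nz: "\<And>t. t < l \<Longrightarrow> r t < n \<and> q t < m \<and> A $$ (r t, q t) \<noteq> 0 \<and> A $$ (r t, q (Suc t mod l)) \<noteq> 0"
    and k: "k \<ge> 2"
  shows "closure_eigenvalue A k (-1)"
proof -
  define a b where "a t = sgn (A $$ (r t, q t))" and "b t = sgn (A $$ (r t, q (Suc t mod l)))" for t
  have ab: "a t * a t = 1" "b t * b t = 1" if "t < l" for t
    unfolding a_def b_def using nz[OF that] by (auto simp: sgn_if)
  \<comment> \<open>As the signs square to \<open>1\<close>, this solves
    \<open>b t * a (Suc t) * w (Suc t) = - w t\<close> with \<open>w 0 = 1\<close>: every step of
    the rotation except the closing one gives the factor \<open>-1\<close>.\<close>
  define w where "w t = (\<Prod>u<t. - (b u * a (Suc u)))" for t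
  have w0: "w 0 = 1" and wS: "w (Suc t) = - (b t * a (Suc t)) * w t" for t
    unfolding w_def by (auto simp: algebra_simps)
  have wsq: "w t * w t = 1" if "t < l" for t
    using that
  proof (induction t)
    case (Suc t)
    have "w (Suc t) * w (Suc t) = (b t * b t) * (a (Suc t) * a (Suc t)) * (w t * w t)"
      unfolding wS by (simp add: algebra_simps)
    then show ?case using Suc ab by simp
  qed (simp add: w0)
  let ?x = "\<lambda>t. complex_of_real (w t)"
  have stay: "\<exists>p. sign_dominated A (fst p) \<and> sign_dominated A (snd p) \<and>
      (\<forall>x. pair_act n m p (spread r T x) = spread r T x)" if T: "T \<subseteq> {..<l}" for T
  proof -
    have rT: "inj_on r T" using inj_on_subset[OF r T] .
    have "\<exists>p. sign_dominated A (fst p) \<and> sign_dominated A (snd p) \<and>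
      (\<forall>x. pair_act n m p (spread r T x) =
        spread r T (\<lambda>t. of_real (sgn (A $$ (r t, q t)) * sgn (A $$ (r (id t), q t))) * x (id t)))"
      by (rule token_step[OF A]) (use nz T rT inj_on_subset[OF q T] in auto)
    moreover have "spread r T (\<lambda>t. of_real (sgn (A $$ (r t, q t)) * sgn (A $$ (r (id t), q t))) * x (id t)) =
        spread r T x" for x
      using ab(1) T unfolding a_def id_apply by (intro spread_cong[OF rT]) (auto simp del: of_real_mult)
    ultimately show ?thesis by (simp only:)
  qed
  \<comment> \<open>Two pairs do the work. Any further pairs leave all tokens in place, which yields
    every \<open>k \<ge> 2\<close>.\<close>
  have finish: "closure_eigenvalue A k (-1)"
    if T: "T \<subseteq> {..<l}" "0 \<in> T" and dom: "sign_dominated A (fst p)" "sign_dominated A (snd p)"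
      "sign_dominated A (fst p')" "sign_dominated A (snd p')"
      and eq: "pair_act n m p (pair_act n m p' (spread r T ?x)) = spread r T (\<lambda>t. - ?x t)" for T p p'
  proof -
    have rT: "inj_on r T" using inj_on_subset[OF r T(1)] .
    obtain i where i: "sign_dominated A (fst i)" "sign_dominated A (snd i)"
      and i3: "\<forall>x. pair_act n m i (spread r T x) = spread r T x"
      using stay[OF T(1)] by (elim exE conjE)
    have rep: "(pair_act n m i ^^ c) (spread r T x) = spread r T x" for c x
      by (induction c) (auto simp: i3)
    have neg: "spread r T (\<lambda>t. - ?x t) = (\<lambda>i. - spread r T ?x i)" unfolding spread_def by auto
    have "spread r T ?x (r 0) = 1" using spread_apply[OF rT T(2)] w0 by simp
    then have "\<exists>i<n. spread r T ?x i \<noteq> 0" using nz[of 0] l by (intro exI[of _ "r 0"]) auto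
    then show ?thesis
      unfolding closure_eigenvalue_def carrier_matD[OF A]
      by (intro exI[of _ "p # p' # replicate (k - 2) i"] exI[of _ "spread r T ?x"] conjI)
        (use dom i k in \<open>auto simp: rep eq neg\<close>)
  qed
  have cyc: "\<exists>p. sign_dominated A (fst p) \<and> sign_dominated A (snd p) \<and>
      (\<forall>x. pair_act n m p (spread r {..<l} x) =
        spread r T (\<lambda>t. of_real (b t * a (Suc t mod l)) * x (Suc t mod l)))" if "T \<subseteq> {..<l}" for T
  proof -
    have "inj_on (\<lambda>t. q (Suc t mod l)) T"
    proof (rule inj_onI)
      fix s t assume st: "s \<in> T" "t \<in> T" "q (Suc s mod l) = q (Suc t mod l)"
      have "Suc s mod l = Suc t mod l" by (rule inj_onD[OF q st(3)]) (use l in auto)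
      moreover have "s < l" "t < l" using st that by auto
      ultimately show "s = t"
        by (cases "Suc s = l"; cases "Suc t = l") auto
    qed
    moreover have "T \<union> {..<l} = {..<l}" using that by auto
    moreover have "q (Suc t mod l) < m \<and> r (Suc t mod l) < n \<and>
        A $$ (r t, q (Suc t mod l)) \<noteq> 0 \<and> A $$ (r (Suc t mod l), q (Suc t mod l)) \<noteq> 0" if "t \<in> T" for t
      using nz[of "Suc t mod l"] nz[of t] l that \<open>T \<subseteq> {..<l}\<close> by auto
    ultimately show ?thesis
      unfolding a_def b_def by (intro token_step[OF A]) (use r l in auto)
  qed
  define L where "L = l - 1"
  have L: "l = Suc L" "L \<ge> 1" using l unfolding L_def by auto
  have "(b L * a 0) * (b L * a 0) = (b L * b L) * (a 0 * a 0)" by simp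
  also have "\<dots> = w L * w L" using wsq[of L] ab[of L] ab[of 0] L by simp
  \<comment> \<open>The closing step gives the factor \<open>-1\<close> in the first case and
    \<open>1\<close> in the second.\<close>
  finally have "w L = - (b L * a 0) \<or> w L = b L * a 0" using square_eq_iff[of "w L" "b L * a 0"] by auto
  then show ?thesis
  proof
    assume wL: "w L = - (b L * a 0)"
    obtain p' where p': "sign_dominated A (fst p')" "sign_dominated A (snd p')"
      "\<forall>x. pair_act n m p' (spread r {..<l} x) = spread r {..<l} x"
      using stay[OF order_refl] by (elim exE conjE)
    obtain p where p: "sign_dominated A (fst p)" "sign_dominated A (snd p)"
      "\<forall>x. pair_act n m p (spread r {..<l} x) = spread r {..<l} (\<lambda>t. of_real (b t * a (Suc t mod l)) * x (Suc t mod l))"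
      using cyc[OF order_refl] by (elim exE conjE)
    have "of_real (b t * a (Suc t mod l)) * ?x (Suc t mod l) = - ?x t"
      if "t < l" for t
    proof (cases "t = L")
      case True
      moreover have "Suc L mod l = 0" using L by simp
      ultimately show ?thesis using wL w0 by simp
    next
      case False
      then have "Suc t < l" using that L by simp
      have "(b t * a (Suc t)) * w (Suc t) = - ((b t * b t) * (a (Suc t) * a (Suc t)) * w t)"
        unfolding wS by (simp only: mult_minus_left mult_minus_right ac_simps)
      also have "\<dots> = - w t" using ab[of t] ab[of "Suc t"] that \<open>Suc t < l\<close> by simp
      finally have "complex_of_real ((b t * a (Suc t)) * w (Suc t)) = - ?x t" by simp
      then show ?thesis using \<open>Suc t < l\<close> by simp
    qed
    then have fin: "pair_act n m p (pair_act n m p' (spread r {..<l} ?x)) = spread r {..<l} (\<lambda>t. - ?x t)"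
      unfolding p'(3)[rule_format] p(3)[rule_format] by (intro spread_cong[OF r]) auto
    show ?thesis by (rule finish[OF _ _ p(1,2) p'(1,2) fin]) (use l in auto)
  next
    assume wL: "w L = b L * a 0"
    \<comment> \<open>Row \<open>L\<close> starts empty. The token on row \<open>L - 1\<close>
      crosses it and reaches row \<open>0\<close> after both moves, which combines a factor
      \<open>-1\<close> with the closing factor \<open>1\<close>; every other token advances by one
      step with factor \<open>-1\<close>.\<close>
    let ?T = "{..<L}" and ?T1 = "{..<l} - {L - 1}"
    define c where "c t = (if t = L - 1 then q L else q t)" for t
    define e where "e t = (if t = L - 1 then L else t)" for t
    have "\<exists>p. sign_dominated A (fst p) \<and> sign_dominated A (snd p) \<and>
      (\<forall>x. pair_act n m p (spread r ?T1 x) =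
        spread r ?T (\<lambda>t. of_real (sgn (A $$ (r t, c t)) * sgn (A $$ (r (e t), c t))) * x (e t)))"
    proof (rule token_step[OF A])
      show "inj_on r (?T \<union> ?T1)" by (rule inj_on_subset[OF r]) (use L in auto)
      show "inj_on c ?T"
      proof (rule inj_onI)
        fix s t assume st: "s \<in> ?T" "t \<in> ?T" "c s = c t"
        have "(if s = L - 1 then L else s) = (if t = L - 1 then L else t)"
          by (rule inj_onD[OF q]) (use st L in \<open>auto simp: c_def split: if_splits\<close>)
        then show "s = t" using st by (auto split: if_splits)
      qed
      show "e ` ?T \<subseteq> ?T1" unfolding e_def using L by auto
      fix t assume t: "t \<in> ?T"
      show "c t < m \<and> r (e t) < n \<and> A $$ (r t, c t) \<noteq> 0 \<and> A $$ (r (e t), c t) \<noteq> 0"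
        using nz[of t] nz[of L] t L unfolding c_def e_def by (cases "t = L - 1") auto
    qed
    then obtain p where p: "sign_dominated A (fst p)" "sign_dominated A (snd p)"
      "\<forall>x. pair_act n m p (spread r ?T1 x) =
        spread r ?T (\<lambda>t. of_real (sgn (A $$ (r t, c t)) * sgn (A $$ (r (e t), c t))) * x (e t))" by (elim exE conjE)
    have r1: "inj_on r ?T1" "inj_on r ?T" by (rule inj_on_subset[OF r], use L in auto)+
    define e' where "e' t = (if t = L then 0 else Suc t)" for t
    have "\<exists>p. sign_dominated A (fst p) \<and> sign_dominated A (snd p) \<and>
      (\<forall>x. pair_act n m p (spread r ?T x) =
        spread r ?T1 (\<lambda>t. of_real (sgn (A $$ (r t, q (e' t))) * sgn (A $$ (r (e' t), q (e' t)))) * x (e' t)))"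
    proof (rule token_step[OF A])
      show "inj_on r (?T1 \<union> ?T)" by (rule inj_on_subset[OF r]) (use L in auto)
      show "inj_on (\<lambda>t. q (e' t)) ?T1"
      proof (rule inj_onI)
        fix s t assume st: "s \<in> ?T1" "t \<in> ?T1" "q (e' s) = q (e' t)"
        have "e' s = e' t"
          by (rule inj_onD[OF q st(3)]) (use st L in \<open>auto simp: e'_def split: if_splits\<close>)
        then show "s = t" by (auto simp: e'_def split: if_splits)
      qed
      show "e' ` ?T1 \<subseteq> ?T" unfolding e'_def using L by auto
      fix t assume t: "t \<in> ?T1"
      show "q (e' t) < m \<and> r (e' t) < n \<and> A $$ (r t, q (e' t)) \<noteq> 0 \<and> A $$ (r (e' t), q (e' t)) \<noteq> 0"
        using nz[of t] nz[of "e' t"] t L unfolding e'_def by (cases "t = L") auto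
    qed
    then obtain p' where p': "sign_dominated A (fst p')" "sign_dominated A (snd p')"
      "\<forall>x. pair_act n m p' (spread r ?T x) =
        spread r ?T1 (\<lambda>t. of_real (sgn (A $$ (r t, q (e' t))) * sgn (A $$ (r (e' t), q (e' t)))) * x (e' t))" by (elim exE conjE)
    have "of_real (sgn (A $$ (r t, c t)) * sgn (A $$ (r (e t), c t))) *
        (of_real (sgn (A $$ (r (e t), q (e' (e t)))) * sgn (A $$ (r (e' (e t)), q (e' (e t))))) * ?x (e' (e t))) = - ?x t"
      if t: "t < L" for t
    proof (cases "t = L - 1")
      case True
      have "w L = - (b t * a L) * w t" using wS[of t] True L by simp
      then have "(b t * a L) * (b L * a 0) = - ((b t * b t) * (a L * a L) * w t)"
        using wL by (simp add: algebra_simps)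
      also have "\<dots> = - w t" using ab[of t] ab[of L] t L by simp
      finally have "(b t * a L) * ((b L * a 0) * w 0) = - w t" using w0 by simp
      then have "complex_of_real ((b t * a L) * ((b L * a 0) * w 0)) = - ?x t" by simp
      moreover have "c t = q L" "e t = L" "e' (e t) = 0" "Suc t mod l = L" "Suc L mod l = 0"
        unfolding c_def e_def e'_def using True L by auto
      ultimately show ?thesis unfolding a_def b_def by (simp add: mult.assoc)
    next
      case False
      have "w (Suc t) = - (b t * a (Suc t)) * w t" by (rule wS)
      then have "(a t * a t) * ((b t * a (Suc t)) * w (Suc t)) = - ((a t * a t) * (b t * b t) * (a (Suc t) * a (Suc t)) * w t)"
        by (simp add: algebra_simps)
      also have "\<dots> = - w t" using ab[of t] ab[of "Suc t"] t L by simp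
      finally have "complex_of_real ((a t * a t) * ((b t * a (Suc t)) * w (Suc t))) = - ?x t" by simp
      moreover have "c t = q t" "e t = t" "e' (e t) = Suc t" "Suc t mod l = Suc t"
        unfolding c_def e_def e'_def using False t L by auto
      ultimately show ?thesis unfolding a_def b_def by (simp add: mult.assoc)
    qed
    then have fin: "pair_act n m p (pair_act n m p' (spread r ?T ?x)) = spread r ?T (\<lambda>t. - ?x t)"
      unfolding p'(3)[rule_format] p(3)[rule_format] by (intro spread_cong[OF r1(2)]) auto
    show ?thesis by (rule finish[OF _ _ p(1,2) p'(1,2) fin]) (use L in auto)
  qed
qed


section \<open>The junction of three legs\<close>

text \<open>The three rows meet in column \<open>c\<close>, and each also uses a column
  \<open>q t\<close> of its own. Column \<open>c\<close> contributes the rank-one matrix with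
  entries \<open>p t * p' u\<close>, the columns \<open>q t\<close> the diagonal matrix with entries
  \<open>d t\<close>. Measuring coordinates in units of \<open>\<sigma> t\<close> removes all
  signs.\<close>

lemma spider_step:
  fixes r q :: "nat \<Rightarrow> nat" and p p' d :: "nat \<Rightarrow> real"
  assumes A: "A \<in> carrier_mat n m" and r: "inj_on r {..<3}" and q: "inj_on q {..<3}" and c: "c < m" "c \<notin> q ` {..<3}"
    and nz: "\<And>t. t < 3 \<Longrightarrow> r t < n \<and> q t < m \<and> A $$ (r t, c) \<noteq> 0 \<and> A $$ (r t, q t) \<noteq> 0"
    and nn: "\<And>t. p t \<ge> 0" "\<And>t. p' t \<ge> 0" "\<And>t. d t \<ge> 0"
  defines "\<sigma> \<equiv> \<lambda>t. complex_of_real (sgn (A $$ (r t, c)))"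
  shows "\<exists>P. sign_dominated A (fst P) \<and> sign_dominated A (snd P) \<and>
    (\<forall>x. pair_act n m P (spread r {..<3} (\<lambda>t. \<sigma> t * x t)) =
      spread r {..<3} (\<lambda>t. \<sigma> t * (of_real (p t) * (\<Sum>u<3. of_real (p' u) * x u) + of_real (d t) * x t)))"
proof -
  define tt where "tt = the_inv_into {..<3} r"
  have tt: "tt (r t) = t" if "t < 3" for t unfolding tt_def using r that by (simp add: the_inv_into_f_f)
  define H where "H f g i j = (if i \<in> r ` {..<3} then (if j = c then sgn (A $$ (i, c)) * f (tt i)
      else if j = q (tt i) then sgn (A $$ (i, j)) * g (tt i) else 0) else 0)" for f g :: "nat \<Rightarrow> real" and i j
  have dom: "sign_dominated A (H f g)" if "\<And>t. f t \<ge> 0" "\<And>t. g t \<ge> 0" for f g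
  proof -
    have "sgn (sgn a * b) = sgn a" if "b \<ge> 0" "sgn a * b \<noteq> 0" for a b :: real
      using that by (auto simp: sgn_if split: if_splits)
    then show ?thesis using that unfolding sign_dominated_def H_def by auto
  qed
  have row: "row_act m (H f g) u (r t) = of_real (sgn (A $$ (r t, c)) * f t) * u c + of_real (sgn (A $$ (r t, q t)) * g t) * u (q t)"
    if t: "t < 3" for f g u t
  proof -
    have ne: "c \<noteq> q t" using c t by auto
    have "row_act m (H f g) u (r t) = (\<Sum>j\<in>{c, q t}. of_real (H f g (r t) j) * u j)"
      unfolding row_act_def by (rule sum.mono_neutral_right) (use c nz[OF t] t in \<open>auto simp: H_def tt\<close>)
    then show ?thesis using ne t by (simp add: H_def tt)
  qed
  have row0: "row_act m (H f g) u i = 0" if "i \<notin> r ` {..<3}" for f g u i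
    unfolding row_act_def H_def using that by simp
  have col: "col_act n (H f g) v j = (\<Sum>t<3. of_real (H f g (r t) j) * v (r t))" for f g v j
  proof -
    have "col_act n (H f g) v j = (\<Sum>i\<in>r ` {..<3}. of_real (H f g i j) * v i)"
      unfolding col_act_def by (rule sum.mono_neutral_right) (use nz in \<open>auto simp: H_def\<close>)
    then show ?thesis by (simp add: sum.reindex[OF r] del: sum.lessThan_Suc)
  qed
  have col_q: "col_act n (H f (\<lambda>_. 1)) v (q s) = of_real (sgn (A $$ (r s, q s))) * v (r s)" if s: "s < 3" for f v s
  proof -
    have "q s \<noteq> c" using c s by auto
    moreover have "q s = q t \<longleftrightarrow> s = t" if "t < 3" for t using inj_on_eq_iff[OF q] s that by auto
    ultimately have "of_real (H f (\<lambda>_. 1) (r t) (q s)) * v (r t) =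
        (if t = s then of_real (sgn (A $$ (r s, q s))) * v (r s) else 0)" if "t < 3" for t
      using that by (auto simp: H_def tt)
    then show ?thesis unfolding col using s by simp
  qed
  have sq: "sgn (A $$ (r t, q t)) * sgn (A $$ (r t, q t)) = 1" "sgn (A $$ (r t, c)) * sgn (A $$ (r t, c)) = 1"
    if "t < 3" for t using nz[OF that] by (auto simp: sgn_if)
  have \<sigma>2: "\<sigma> t * \<sigma> t = 1" if "t < 3" for t
    unfolding \<sigma>_def of_real_mult[symmetric] sq(2)[OF that] by simp
  show ?thesis
  proof (intro exI[of _ "(H p d, H p' (\<lambda>_. 1))"] conjI allI)
    show "sign_dominated A (fst (H p d, H p' (\<lambda>_. 1)))" "sign_dominated A (snd (H p d, H p' (\<lambda>_. 1)))"
      using dom nn by auto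
    fix x
    let ?v = "spread r {..<3} (\<lambda>t. \<sigma> t * x t)"
    have v: "?v (r t) = \<sigma> t * x t" if "t < 3" for t using that by (simp add: spread_apply[OF r])
    have cc: "col_act n (H p' (\<lambda>_. 1)) ?v c = (\<Sum>u<3. of_real (p' u) * x u)"
      unfolding col
    proof (rule sum.cong[OF refl])
      fix t assume "t \<in> {..<3::nat}"
      then have t: "t < 3" by simp
      have "of_real (H p' (\<lambda>_. 1) (r t) c) * ?v (r t) = (\<sigma> t * \<sigma> t) * (of_real (p' t) * x t)"
        using t v[OF t] unfolding H_def \<sigma>_def by (simp add: tt)
      then show "of_real (H p' (\<lambda>_. 1) (r t) c) * ?v (r t) = of_real (p' t) * x t" using \<sigma>2[OF t] by simp
    qed
    show "pair_act n m (H p d, H p' (\<lambda>_. 1)) ?v =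
      spread r {..<3} (\<lambda>t. \<sigma> t * (of_real (p t) * (\<Sum>u<3. of_real (p' u) * x u) + of_real (d t) * x t))"
    proof (rule spread_eqI[OF r])
      fix t assume "t \<in> {..<3::nat}"
      then have t: "t < 3" by simp
      have "complex_of_real (sgn (A $$ (r t, q t))) * complex_of_real (sgn (A $$ (r t, q t))) = 1"
        unfolding of_real_mult[symmetric] sq(1)[OF t] by simp
      then have "pair_act n m (H p d, H p' (\<lambda>_. 1)) ?v (r t) =
          \<sigma> t * of_real (p t) * (\<Sum>u<3. of_real (p' u) * x u) +
          of_real (sgn (A $$ (r t, q t)) * sgn (A $$ (r t, q t))) * (of_real (d t) * (\<sigma> t * x t))"
        unfolding pair_act_def fst_conv snd_conv row[OF t] cc col_q[OF t] v[OF t]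
        using nz[OF t] by (simp add: \<sigma>_def)
      then show "pair_act n m (H p d, H p' (\<lambda>_. 1)) ?v (r t) =
          \<sigma> t * (of_real (p t) * (\<Sum>u<3. of_real (p' u) * x u) + of_real (d t) * x t)"
        unfolding sq(1)[OF t] by (simp add: algebra_simps)
    qed (simp add: pair_act_def row0)
  qed
qed

text \<open>The first eigenvalue comes from interchanging tokens on rows \<open>0\<close> and \<open>1\<close> using row \<open>2\<close> as a
  siding. The second one, found by search, belongs up to signs to the matrix with rows
  \<open>(10, 10, 0)\<close>, \<open>(1, 7, 5)\<close>, \<open>(2, 2, 10)\<close>, whose characteristic polynomial is \<open>(x - 15) (x\<^sup>2 - 12 x + 40)\<close>.\<close>

lemma spider_closure_eigenvalue:
  fixes r q :: "nat \<Rightarrow> nat"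
  assumes A: "A \<in> carrier_mat n m" and r: "inj_on r {..<3}" and q: "inj_on q {..<3}" and c: "c < m" "c \<notin> q ` {..<3}"
    and nz: "\<And>t. t < 3 \<Longrightarrow> r t < n \<and> q t < m \<and> A $$ (r t, c) \<noteq> 0 \<and> A $$ (r t, q t) \<noteq> 0"
  shows "closure_eigenvalue A 3 (-1)" and "closure_eigenvalue A 2 (Complex 6 2)"
proof -
  define \<sigma> where "\<sigma> t = complex_of_real (sgn (A $$ (r t, c)))" for t
  have \<sigma>0: "\<sigma> t \<noteq> 0" if "t < 3" for t unfolding \<sigma>_def using nz[OF that] by (simp add: sgn_0_0)
  let ?S = "\<lambda>x. spread r {..<3} (\<lambda>t. \<sigma> t * x t)"
  have step: "\<exists>P. sign_dominated A (fst P) \<and> sign_dominated A (snd P) \<and>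
    (\<forall>x. pair_act n m P (?S x) = ?S (\<lambda>t. of_real (p t) * (\<Sum>u<3. of_real (p' u) * x u) + of_real (d t) * x t))"
    if "\<And>t. p t \<ge> 0" "\<And>t. p' t \<ge> 0" "\<And>t. d t \<ge> 0" for p p' d
    unfolding \<sigma>_def by (rule spider_step[OF A r q c nz that])
  have three: "x 0 = y 0 \<and> x 1 = y 1 \<and> x 2 = y 2 \<Longrightarrow> ?S x = ?S y" for x y :: "nat \<Rightarrow> complex"
    by (rule spread_cong[OF r]) (auto simp: numeral_3_eq_3 less_Suc_eq numeral_2_eq_2)
  have nonzero: "\<exists>i<n. ?S x i \<noteq> 0" if "x 0 \<noteq> 0" for x
    using nz[of 0] \<sigma>0[of 0] that by (intro exI[of _ "r 0"]) (simp add: spread_apply[OF r])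
  have scale: "?S (\<lambda>t. z * x t) = (\<lambda>i. z * ?S x i)" for z x
    unfolding spread_def by (auto simp: algebra_simps)
  have s3: "(\<Sum>u<3. f u) = f 0 + f 1 + f 2" for f :: "nat \<Rightarrow> complex"
    by (simp add: numeral_3_eq_3 numeral_2_eq_2)
  define e where "e i j = (if i = j then 1 else 0 :: real)" for i j :: nat
  have e0: "e i j \<ge> 0" for i j unfolding e_def by simp
  show "closure_eigenvalue A 3 (-1)"
  proof -
    \<comment> \<open>\<open>P3\<close> acts first and parks entry \<open>1\<close> at place
      \<open>2\<close>, \<open>P2\<close> moves entry \<open>0\<close> to place \<open>1\<close>,
      and \<open>P1\<close> brings the parked entry to place \<open>0\<close>. This turns
      \<open>(x0, x1, 0)\<close> into \<open>(x1, x0, 0)\<close>, with eigenvector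
      \<open>(1, -1, 0)\<close> for \<open>-1\<close>.\<close>
    obtain P1 where P1: "sign_dominated A (fst P1)" "sign_dominated A (snd P1)"
      "\<forall>x. pair_act n m P1 (?S x) = ?S (\<lambda>t. of_real (e 0 t) * (\<Sum>u<3. of_real (e 2 u) * x u) + of_real (e 1 t) * x t)"
      using step[of "e 0" "e 2" "e 1", OF e0 e0 e0] by (elim exE conjE)
    obtain P2 where P2: "sign_dominated A (fst P2)" "sign_dominated A (snd P2)"
      "\<forall>x. pair_act n m P2 (?S x) = ?S (\<lambda>t. of_real (e 1 t) * (\<Sum>u<3. of_real (e 0 u) * x u) + of_real (e 2 t) * x t)"
      using step[of "e 1" "e 0" "e 2", OF e0 e0 e0] by (elim exE conjE)
    obtain P3 where P3: "sign_dominated A (fst P3)" "sign_dominated A (snd P3)"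
      "\<forall>x. pair_act n m P3 (?S x) = ?S (\<lambda>t. of_real (e 2 t) * (\<Sum>u<3. of_real (e 1 u) * x u) + of_real (e 0 t) * x t)"
      using step[of "e 2" "e 1" "e 0", OF e0 e0 e0] by (elim exE conjE)
    define x where "x t = (if t = 0 then 1 else if t = 1 then - 1 else 0 :: complex)" for t :: nat
    have "pair_act n m P1 (pair_act n m P2 (pair_act n m P3 (?S x))) = ?S (\<lambda>t. -1 * x t)"
      unfolding P1(3)[rule_format] P2(3)[rule_format] P3(3)[rule_format] s3
      by (rule three) (simp add: e_def x_def)
    then have "foldr (pair_act n m) [P1, P2, P3] (?S x) = (\<lambda>i. -1 * ?S x i)" unfolding scale by simp
    moreover have "\<exists>i<n. ?S x i \<noteq> 0" by (rule nonzero) (simp add: x_def)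
    ultimately show ?thesis
      unfolding closure_eigenvalue_def carrier_matD[OF A]
      by (intro exI[of _ "[P1, P2, P3]"] exI[of _ "?S x"] conjI) (use P1 P2 P3 in auto)
  qed
  show "closure_eigenvalue A 2 (Complex 6 2)"
  proof -
    \<comment> \<open>The two factors have the rows \<open>(10, 0, 0)\<close>,
      \<open>(1, 2, 1)\<close>, \<open>(2, 0, 2)\<close> and \<open>(1, 1, 0)\<close>,
      \<open>(0, 3, 0)\<close>, \<open>(0, 0, 5)\<close>; each is diagonal plus rank one.\<close>
    define p p' d where "p = (\<lambda>t::nat. if t = 0 then 0 else if t = 1 then 1 else 2::real)"
      and "p' = (\<lambda>t::nat. if t = 1 then 0 else 1::real)"
      and "d = (\<lambda>t::nat. if t = 0 then 10 else if t = 1 then 2 else 0::real)"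
    define d' where "d' = (\<lambda>t::nat. if t = 0 then 1 else if t = 1 then 3 else 5::real)"
    have nn: "p t \<ge> 0" "p' t \<ge> 0" "d t \<ge> 0" "d' t \<ge> 0" for t unfolding p_def p'_def d_def d'_def by auto
    obtain P1 where P1: "sign_dominated A (fst P1)" "sign_dominated A (snd P1)"
      "\<forall>x. pair_act n m P1 (?S x) = ?S (\<lambda>t. of_real (p t) * (\<Sum>u<3. of_real (p' u) * x u) + of_real (d t) * x t)"
      using step[of p p' d, OF nn(1,2,3)] by (elim exE conjE)
    obtain P2 where P2: "sign_dominated A (fst P2)" "sign_dominated A (snd P2)"
      "\<forall>x. pair_act n m P2 (?S x) = ?S (\<lambda>t. of_real (e 0 t) * (\<Sum>u<3. of_real (e 1 u) * x u) + of_real (d' t) * x t)"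
      using step[of "e 0" "e 1" d', OF e0 e0 nn(4)] by (elim exE conjE)
    \<comment> \<open>The eigenvector \<open>(5, -2 + i, -1 - i)\<close> for the root
      \<open>6 + 2 i\<close> of the quadratic factor.\<close>
    define x where "x t = (if t = 0 then 5 else if t = 1 then Complex (-2) 1 else Complex (-1) (-1))" for t :: nat
    have "pair_act n m P1 (pair_act n m P2 (?S x)) = ?S (\<lambda>t. Complex 6 2 * x t)"
      unfolding P1(3)[rule_format] P2(3)[rule_format] s3
      by (rule three) (simp add: e_def x_def p_def p'_def d_def d'_def complex_eq_iff)
    then have "foldr (pair_act n m) [P1, P2] (?S x) = (\<lambda>i. Complex 6 2 * ?S x i)" unfolding scale by simp
    moreover have "\<exists>i<n. ?S x i \<noteq> 0" by (rule nonzero) (simp add: x_def)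
    ultimately show ?thesis
      unfolding closure_eigenvalue_def carrier_matD[OF A]
      by (intro exI[of _ "[P1, P2]"] exI[of _ "?S x"] conjI) (use P1 P2 in auto)
  qed
qed

section \<open>Caterpillar forests\<close>

definition vertex_cycle :: "('a \<times> 'a) set \<Rightarrow> nat \<Rightarrow> (nat \<Rightarrow> 'a) \<Rightarrow> bool" where
  "vertex_cycle E L y \<longleftrightarrow> 3 \<le> L \<and> inj_on y {..<L} \<and> y L = y 0 \<and> (\<forall>j<L. (y j, y (Suc j)) \<in> E)"

definition neighbours :: "('a \<times> 'a) set \<Rightarrow> 'a \<Rightarrow> 'a set" where
  "neighbours E v = {w. (v, w) \<in> E}"

text \<open>Three edges at \<open>v\<close>, each extended by one further edge: together with acyclicity this is the
  smallest tree that is not a caterpillar.\<close>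

definition spider :: "('a \<times> 'a) set \<Rightarrow> 'a \<Rightarrow> (nat \<Rightarrow> 'a) \<Rightarrow> (nat \<Rightarrow> 'a) \<Rightarrow> bool" where
  "spider E v a b \<longleftrightarrow> inj_on a {..<3} \<and> (\<forall>t<3. (v, a t) \<in> E \<and> (a t, b t) \<in> E \<and> b t \<noteq> v)"

lemma vwalk_arcs_iff:
  "(u, w) \<in> set (vwalk_arcs vs) \<longleftrightarrow> (\<exists>t. Suc t < length vs \<and> u = vs ! t \<and> w = vs ! Suc t)"
proof (induction vs rule: vwalk_arcs.induct)
  case (3 x y xs)
  let ?Q = "\<lambda>vs t. Suc t < length vs \<and> u = vs ! t \<and> w = vs ! Suc t"
  have "(\<exists>t. ?Q (x # y # xs) t) \<longleftrightarrow> ?Q (x # y # xs) 0 \<or> (\<exists>t. ?Q (x # y # xs) (Suc t))"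
    by (metis not0_implies_Suc)
  then show ?case using 3 by simp
qed auto

text \<open>Arcs are pairs of vertices, so the arc set is the adjacency relation itself and walks
  can be handled as sequences of vertices.\<close>

locale simple_graph = graph G for G :: "('a, 'a \<times> 'a) pre_digraph" (structure) +
  assumes tail_fst: "tail G = fst" and head_snd: "head G = snd"
begin

abbreviation E where "E \<equiv> arcs G"

lemma arcs_ends_eq: "arcs_ends G = E"
  unfolding arcs_ends_def arc_to_ends_def tail_fst head_snd by simp

lemma E_sym: "(u, v) \<in> E \<Longrightarrow> (v, u) \<in> E"
  using arcs_ends_symmetric[OF sym_arcs] unfolding arcs_ends_eq by blast

lemma E_irrefl: "(u, u) \<notin> E"
  using no_loops[of "(u, u)"] unfolding tail_fst head_snd by auto

lemma E_verts: "(u, v) \<in> E \<Longrightarrow> u \<in> verts G \<and> v \<in> verts G"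
  using wellformed[of "(u, v)"] unfolding tail_fst head_snd by auto

lemma awalk_verts_seq:
  assumes "set p \<subseteq> E" "cas u p v"
  shows "length (awalk_verts u p) = Suc (length p) \<and> awalk_verts u p ! 0 = u \<and>
    awalk_verts u p ! length p = v \<and> (\<forall>j<length p. (awalk_verts u p ! j, awalk_verts u p ! Suc j) \<in> E)"
  using assms
proof (induction p arbitrary: u)
  case (Cons e p)
  then have IH: "length (awalk_verts (head G e) p) = Suc (length p) \<and> awalk_verts (head G e) p ! 0 = head G e \<and>
    awalk_verts (head G e) p ! length p = v \<and>
    (\<forall>j<length p. (awalk_verts (head G e) p ! j, awalk_verts (head G e) p ! Suc j) \<in> E)" by simp
  have e: "(tail G e, head G e) \<in> E" using Cons.prems unfolding tail_fst head_snd by simp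
  have "(awalk_verts u (e # p) ! j, awalk_verts u (e # p) ! Suc j) \<in> E" if "j < length (e # p)" for j
    using that IH e by (cases j) auto
  then show ?case using IH Cons.prems by simp
qed simp

lemma seq_awalk:
  assumes "i \<le> k"
  shows "cas (y i) (map (\<lambda>j. (y j, y (Suc j))) [i..<k]) (y k) \<and>
    awalk_verts (y i) (map (\<lambda>j. (y j, y (Suc j))) [i..<k]) = map y [i..<Suc k]"
  using assms
proof (induction "k - i" arbitrary: i)
  case 0
  then show ?case by simp
next
  case (Suc d)
  then have i: "i < k" by simp
  have IH: "cas (y (Suc i)) (map (\<lambda>j. (y j, y (Suc j))) [Suc i..<k]) (y k) \<and>
    awalk_verts (y (Suc i)) (map (\<lambda>j. (y j, y (Suc j))) [Suc i..<k]) = map y [Suc i..<Suc k]"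
    using Suc.hyps(1)[of "Suc i"] Suc.hyps(2) i by simp
  have "[i..<k] = i # [Suc i..<k]" "[i..<Suc k] = i # [Suc i..<Suc k]" using i upt_conv_Cons by auto
  then show ?case using IH by (simp add: tail_fst head_snd del: upt_Suc)
qed

text \<open>\<open>cycle\<close> demands distinct vertices at the positions \<open>1\<close> to
  \<open>L\<close>, \<open>vertex_cycle\<close> at \<open>0\<close> to \<open>L - 1\<close>. The
  positions \<open>0\<close> and \<open>L\<close> carry the same vertex, so the two conditions
  agree.\<close>

lemma cycle_iff_vertex_cycle:
  "(\<exists>p. cycle p \<and> 3 \<le> length p) \<longleftrightarrow> (\<exists>L y. vertex_cycle E L y)"
proof
  assume "\<exists>p. cycle p \<and> 3 \<le> length p"
  then obtain p u where p: "3 \<le> length p" "set p \<subseteq> E" "cas u p u" "distinct (tl (awalk_verts u p))"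
    unfolding cycle_def awalk_def by (elim exE conjE)
  let ?w = "awalk_verts u p" and ?L = "length p"
  note w = awalk_verts_seq[OF p(2,3)]
  have tl: "tl ?w ! i = ?w ! Suc i" if "i < ?L" for i using w that by (simp add: nth_tl)
  have inj: "i = j" if "?w ! i = ?w ! j" "0 < i" "i \<le> ?L" "0 < j" "j \<le> ?L" for i j
  proof -
    have "tl ?w ! (i - 1) = tl ?w ! (j - 1)" using tl[of "i - 1"] tl[of "j - 1"] that by simp
    moreover have "length (tl ?w) = ?L" using w by simp
    ultimately have "i - 1 = j - 1"
      using nth_eq_iff_index_eq[OF p(4), of "i - 1" "j - 1"] that by linarith
    then show ?thesis using that by linarith
  qed
  have L0: "0 < ?L" using p(1) by linarith
  have "inj_on (\<lambda>j. ?w ! j) {..<?L}"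
  proof (rule inj_onI)
    fix i j assume ij: "i \<in> {..<?L}" "j \<in> {..<?L}" "?w ! i = ?w ! j"
    show "i = j"
    proof (cases "i = 0"; cases "j = 0")
      assume "i = 0" "j \<noteq> 0"
      then have "?w ! ?L = ?w ! j" using ij w by simp
      from inj[OF this L0 order_refl] have "?L = j" using ij \<open>j \<noteq> 0\<close> by simp
      then show ?thesis using ij by simp
    next
      assume "i \<noteq> 0" "j = 0"
      then have "?w ! i = ?w ! ?L" using ij w by simp
      from inj[OF this _ _ L0 order_refl] have "i = ?L" using ij \<open>i \<noteq> 0\<close> by simp
      then show ?thesis using ij by simp
    next
      assume "i \<noteq> 0" "j \<noteq> 0"
      then show ?thesis using inj[of i j] ij by auto
    qed simp
  qed
  then have "vertex_cycle E ?L (\<lambda>j. ?w ! j)" unfolding vertex_cycle_def using p(1) w by simp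
  then show "\<exists>L y. vertex_cycle E L y" by (intro exI[of _ ?L] exI[of _ "\<lambda>j. ?w ! j"])
next
  assume "\<exists>L y. vertex_cycle E L y"
  then obtain L y where "vertex_cycle E L y" by (elim exE)
  then have y: "3 \<le> L" "inj_on y {..<L}" "y L = y 0" "\<And>j. j < L \<Longrightarrow> (y j, y (Suc j)) \<in> E"
    unfolding vertex_cycle_def by auto
  let ?p = "map (\<lambda>j. (y j, y (Suc j))) [0..<L]"
  have s: "cas (y 0) ?p (y L)" "awalk_verts (y 0) ?p = map y [0..<Suc L]"
    using seq_awalk[of 0 L y] by (auto simp del: upt_Suc)
  have "y 0 \<in> verts G" using y(1) E_verts[OF y(4)[of 0]] by simp
  then have "awalk (y 0) ?p (y 0)" unfolding awalk_def using y s by auto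
  moreover have "distinct (tl (awalk_verts (y 0) ?p))"
  proof -
    have "tl (awalk_verts (y 0) ?p) = map y [Suc 0..<Suc L]"
      unfolding s(2) map_tl[symmetric] tl_upt ..
    moreover have "inj_on y {Suc 0..<Suc L}"
    proof (rule inj_onI)
      fix i j assume ij: "i \<in> {Suc 0..<Suc L}" "j \<in> {Suc 0..<Suc L}" "y i = y j"
      have ym: "y (h mod L) = y h" if "h \<in> {Suc 0..<Suc L}" for h
        using that y(3) by (cases "h = L") auto
      have "y (i mod L) = y (j mod L)" unfolding ym[OF ij(1)] ym[OF ij(2)] by (rule ij(3))
      then have "i mod L = j mod L" by (rule inj_onD[OF y(2)]) (use y(1) in auto)
      then show "i = j" using ij by (cases "i = L"; cases "j = L") auto
    qed
    ultimately show ?thesis by (simp add: distinct_map del: upt_Suc)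
  qed
  ultimately have "cycle ?p" unfolding cycle_def using y(1) by (intro exI[of _ "y 0"]) auto
  then show "\<exists>p. cycle p \<and> 3 \<le> length p" using y(1) by (intro exI[of _ ?p]) auto
qed

lemma graph_forest_iff: "graph_forest G \<longleftrightarrow> (\<nexists>L y. vertex_cycle E L y)"
  unfolding graph_forest_def cycle_iff_vertex_cycle using graph_axioms by blast

section \<open>Components and their spines\<close>

lemma induced_simple_graph:
  assumes "S \<subseteq> verts G"
  shows "simple_graph (G \<restriction> S)"
proof -
  have ind: "induced_subgraph (G \<restriction> S) G" using assms by (rule induced_induce)
  interpret H: wf_digraph "G \<restriction> S" by (rule wellformed_induce_subgraph)
  show ?thesis
  proof
    show "finite (verts (G \<restriction> S))" using finite_subset[OF assms finite_verts] by simp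
    show "finite (arcs (G \<restriction> S))" by simp
    show "tail (G \<restriction> S) e \<noteq> head (G \<restriction> S) e" if "e \<in> arcs (G \<restriction> S)" for e
      using that no_loops by simp
    show "e1 = e2" if "e1 \<in> arcs (G \<restriction> S)" "e2 \<in> arcs (G \<restriction> S)"
      "arc_to_ends (G \<restriction> S) e1 = arc_to_ends (G \<restriction> S) e2" for e1 e2
      using that no_multi_arcs[of e1 e2] by (simp add: arc_to_ends_def)
    show "symmetric (G \<restriction> S)" using induced_graph_imp_symmetric[OF sym_arcs ind] .
  qed (simp_all add: tail_fst head_snd)
qed

lemma scc_closed:
  assumes "S \<in> sccs_verts" "u \<in> S" "(u, v) \<in> E"
  shows "v \<in> S"
proof (rule ccontr)
  assume "v \<notin> S"
  moreover have "u \<rightarrow>\<^sup>* v" "v \<rightarrow>\<^sup>* u" using assms(3) E_sym[OF assms(3)] by (auto simp: arcs_ends_eq)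
  ultimately show False using assms(1,2) unfolding in_sccs_verts_conv_reachable by blast
qed

text \<open>Connectedness as an invariance principle: it shows that a set closed under adjacency
  fills a whole component.\<close>

lemma scc_connected:
  assumes "S \<in> sccs_verts" "u \<in> S" "v \<in> S" "\<And>x y. x \<in> R \<Longrightarrow> (x, y) \<in> E \<Longrightarrow> y \<in> R" "u \<in> R"
  shows "v \<in> R"
proof -
  have "u \<rightarrow>\<^sup>* v" using assms(1-3) unfolding in_sccs_verts_conv_reachable by blast
  then show ?thesis
  proof (induction rule: reachable_induct)
    case base
    then show ?case using assms(5) by simp
  next
    case (step x y)
    then show ?case using assms(4) by (simp add: arcs_ends_eq)
  qed
qed

lemma scc_leaves:
  assumes "S \<in> sccs_verts"
  shows "leaves (G \<restriction> S) = {v \<in> S. card (neighbours E v) = 1}"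
proof -
  have "out_degree (G \<restriction> S) v = card (neighbours E v)" if v: "v \<in> S" for v
  proof -
    have "out_arcs (G \<restriction> S) v = Pair v ` neighbours E v"
      unfolding out_arcs_def neighbours_def using scc_closed[OF assms v] v
      by (auto simp: tail_fst head_snd)
    then show ?thesis unfolding out_degree_def by (simp add: card_image inj_on_def)
  qed
  then show ?thesis unfolding leaves_def by auto
qed

text \<open>Degree \<open>0\<close> counts as non-leaf, so an isolated vertex is its own spine,
  while a component that is a single edge has the empty spine.\<close>

definition spine :: "'a set \<Rightarrow> 'a list \<Rightarrow> bool" where
  "spine S vs \<longleftrightarrow> distinct vs \<and> set vs = {v \<in> S. card (neighbours E v) \<noteq> 1} \<and>
     E \<inter> set vs \<times> set vs = set (vwalk_arcs vs) \<union> (set (vwalk_arcs vs))\<inverse>"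

text \<open>Components inherit acyclicity and are connected, and vertices keep their degree in them,
  so only the path condition on the non-leaves remains.\<close>

lemma caterpillar_forest_iff_spines:
  assumes "\<nexists>L y. vertex_cycle E L y"
  shows "caterpillar_forest G \<longleftrightarrow> (\<forall>S\<in>sccs_verts. \<exists>vs. spine S vs)"
proof -
  have "caterpillar (G \<restriction> S) \<longleftrightarrow> (\<exists>vs. spine S vs)" if S: "S \<in> sccs_verts" for S
  proof -
    have SV: "S \<subseteq> verts G" using sccs_verts_subsets[OF S] .
    interpret H: simple_graph "G \<restriction> S" by (rule induced_simple_graph[OF SV])
    have "vertex_cycle E L y" if "vertex_cycle (arcs (G \<restriction> S)) L y" for L y
      using that unfolding vertex_cycle_def by simp
    then have "graph_forest (G \<restriction> S)" unfolding H.graph_forest_iff using assms by blast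
    moreover have "Digraph_Component.connected (G \<restriction> S)"
    proof -
      have "G \<restriction> S \<in> sccs" using in_verts_sccsD_sccs[OF S] .
      then have "strongly_connected (G \<restriction> S)" unfolding sccs_def by blast
      moreover have "(arcs_ends (G \<restriction> S))\<^sup>s = arcs_ends (G \<restriction> S)"
        unfolding symcl_def using H.E_sym unfolding H.arcs_ends_eq by auto
      ultimately show ?thesis unfolding connected_conv strongly_connected_def reachable_def by simp
    qed
    ultimately have tree: "graph_tree (G \<restriction> S)" unfolding graph_tree_def by blast
    let ?V = "{v \<in> S. card (neighbours E v) \<noteq> 1}"
    have V: "verts (G \<restriction> S) - leaves (G \<restriction> S) = ?V" unfolding scc_leaves[OF S] by auto
    interpret K: simple_graph "(G \<restriction> S) \<restriction> ?V" by (rule H.induced_simple_graph) auto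
    have arcs: "arcs_ends ((G \<restriction> S) \<restriction> ?V) = E \<inter> ?V \<times> ?V"
      unfolding K.arcs_ends_eq by (auto simp: tail_fst head_snd)
    have "caterpillar (G \<restriction> S) \<longleftrightarrow> (\<exists>vs. distinct vs \<and> set vs = ?V \<and>
        E \<inter> ?V \<times> ?V = set (vwalk_arcs vs) \<union> (set (vwalk_arcs vs))\<inverse>)"
      unfolding caterpillar_def V path_graph_def arcs using tree K.graph_axioms by (simp only: induce_subgraph_verts simp_thms)
    also have "\<dots> \<longleftrightarrow> (\<exists>vs. spine S vs)"
      unfolding spine_def by (rule ex_cong1, rule conj_cong[OF refl], rule conj_cong[OF refl]) (simp only:)
    finally show ?thesis .
  qed
  then show ?thesis
    unfolding caterpillar_forest_def sccs_conv_sccs_verts using assms graph_forest_iff by auto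
qed

text \<open>A longest path through non-leaves is a spine. A further non-leaf adjacent to it would
  prolong the path at an end or produce a spider at an inner vertex, and a chord would close a
  cycle.\<close>

lemma spine_exists:
  assumes S: "S \<in> sccs_verts" and cyc: "\<nexists>L y. vertex_cycle E L y" and spi: "\<nexists>v a b. spider E v a b"
  shows "\<exists>vs. spine S vs"
proof (cases "{v \<in> S. card (neighbours E v) \<noteq> 1} = {}")
  case True
  then show ?thesis unfolding spine_def by (intro exI[of _ "[]"]) simp
next
  case False
  define V where "V = {v \<in> S. card (neighbours E v) \<noteq> 1}"
  have finV: "finite V" unfolding V_def using finite_subset[OF sccs_verts_subsets[OF S] finite_verts] by simp
  define P where "P vs \<longleftrightarrow> vs \<noteq> [] \<and> distinct vs \<and> set vs \<subseteq> V \<and> (\<forall>t. Suc t < length vs \<longrightarrow> (vs ! t, vs ! Suc t) \<in> E)" for vs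
  obtain v0 where v0: "v0 \<in> V" using False unfolding V_def by auto
  have "P [v0]" unfolding P_def using v0 by simp
  moreover have bound: "length vs \<le> card V" if "P vs" for vs
    using that card_mono[OF finV, of "set vs"] unfolding P_def by (simp add: distinct_card)
  ultimately have "\<exists>vs. P vs \<and> (\<forall>ws. P ws \<longrightarrow> length ws \<le> length vs)"
    by (intro ex_has_greatest_nat[of P "[v0]" length "Suc (card V)"]) (auto simp: less_Suc_eq_le)
  then obtain vs where vs: "P vs" and mx: "\<And>ws. P ws \<Longrightarrow> length ws \<le> length vs" by blast
  have ne: "vs \<noteq> []" and dist: "distinct vs" and sub: "set vs \<subseteq> V"
    and adj: "\<And>t. Suc t < length vs \<Longrightarrow> (vs ! t, vs ! Suc t) \<in> E" using vs unfolding P_def by auto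
  have deg: "\<exists>b. (a, b) \<in> E \<and> b \<noteq> v" if "a \<in> V" "(v, a) \<in> E" for a v
  proof (rule ccontr)
    assume "\<not> ?thesis"
    then have only: "b = v" if "(a, b) \<in> E" for b using that by metis
    have "w \<in> neighbours E a \<longleftrightarrow> w \<in> {v}" for w
      unfolding neighbours_def using only[of w] E_sym[OF that(2)] by (cases "w = v") auto
    then have "neighbours E a = {v}" by (simp add: set_eq_iff)
    then show False using that unfolding V_def by simp
  qed
  have closed: "w \<in> set vs" if v: "v \<in> set vs" and w: "w \<in> V" "(v, w) \<in> E" for v w
  proof (rule ccontr)
    assume wn: "w \<notin> set vs"
    obtain i where i: "i < length vs" "v = vs ! i" using v by (metis in_set_conv_nth)
    consider "i = 0" | "Suc i = length vs" | "0 < i" "Suc i < length vs" using i by linarith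
    then show False
    proof cases
      case 1
      have "P (w # vs)"
        unfolding P_def using wn w dist sub adj i 1 E_sym[OF w(2)] by (auto simp: nth_Cons split: nat.splits)
      then show False using mx[of "w # vs"] by simp
    next
      case 2
      have "(vs @ [w]) ! Suc t = vs ! Suc t" "(vs @ [w]) ! t = vs ! t" if "Suc t < length vs" for t
        using that by (auto simp: nth_append)
      moreover have "(vs @ [w]) ! i = v" "(vs @ [w]) ! Suc i = w" using i 2 by (auto simp: nth_append)
      ultimately have "((vs @ [w]) ! t, (vs @ [w]) ! Suc t) \<in> E" if "Suc t < length (vs @ [w])" for t
        using that adj[of t] w 2 by (cases "t = i") auto
      then have "P (vs @ [w])" unfolding P_def using wn w dist sub by auto
      then show False using mx[of "vs @ [w]"] by simp
    next
      case 3
      \<comment> \<open>The three legs start with the predecessor, the successor and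
        \<open>w\<close>. All are non-leaves, so each continues to a vertex other than
        \<open>v\<close>.\<close>
      define a where "a t = (if t = 0 then vs ! (i - 1) else if t = 1 then vs ! Suc i else w)" for t :: nat
      have mem: "vs ! (i - 1) \<in> set vs" "vs ! Suc i \<in> set vs" using 3 i by auto
      have "vs ! (i - 1) \<noteq> vs ! Suc i" using dist 3 by (simp add: nth_eq_iff_index_eq)
      then have inj: "inj_on a {..<3}"
        unfolding a_def inj_on_def using mem wn by auto
      have aE: "(v, a t) \<in> E" if "t < 3" for t
      proof -
        have "(v, vs ! (i - 1)) \<in> E" using adj[of "i - 1"] 3 i E_sym by simp
        moreover have "(v, vs ! Suc i) \<in> E" using adj[of i] 3 i by simp
        ultimately show ?thesis unfolding a_def using w by auto
      qed
      have aV: "a t \<in> V" for t unfolding a_def using mem sub w by auto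
      define b where "b t = (SOME b. (a t, b) \<in> E \<and> b \<noteq> v)" for t
      have "(a t, b t) \<in> E \<and> b t \<noteq> v" if "t < 3" for t
        unfolding b_def by (rule someI_ex[OF deg[OF aV aE[OF that]]])
      then have "spider E v a b" unfolding spider_def using inj aE by blast
      then show False using spi by blast
    qed
  qed
  \<comment> \<open>The path with its attached leaves is closed under adjacency and therefore fills
    the component.\<close>
  define R where "R = set vs \<union> {x. card (neighbours E x) = 1 \<and> (\<exists>v\<in>set vs. (v, x) \<in> E)}"
  have Rc: "y \<in> R" if xR: "x \<in> R" "(x, y) \<in> E" for x y
  proof (cases "x \<in> set vs")
    case True
    then have "y \<in> S" using scc_closed[OF S _ that(2)] sub unfolding V_def by auto
    then show ?thesis using closed[OF True _ that(2)] True that(2) unfolding R_def V_def by auto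
  next
    case False
    then obtain v where v: "card (neighbours E x) = 1" "v \<in> set vs" "(v, x) \<in> E" using xR(1) unfolding R_def by auto
    have "y \<in> neighbours E x" "v \<in> neighbours E x" using that(2) E_sym[OF v(3)] unfolding neighbours_def by auto
    then have "y = v" using v(1) by (metis card_1_singletonE singletonD)
    then show ?thesis using v unfolding R_def by simp
  qed
  have all: "set vs = V"
  proof
    show "V \<subseteq> set vs"
    proof
      fix x assume x: "x \<in> V"
      have "hd vs \<in> set vs" using ne by simp
      then have "x \<in> R"
        using scc_connected[OF S _ _ Rc, of "hd vs" x] x sub unfolding V_def R_def by auto
      then show "x \<in> set vs" using x unfolding R_def V_def by auto
    qed
  qed (rule sub)
  \<comment> \<open>A chord between the positions \<open>i\<close> and \<open>j\<close> closes the
    path segment between them to a cycle of length \<open>j - i + 1\<close>.\<close>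
  have consec: "Suc i = j" if ij: "i < j" "j < length vs" "(vs ! j, vs ! i) \<in> E" for i j
  proof (rule ccontr)
    assume "Suc i \<noteq> j"
    define L where "L = Suc (j - i)"
    define y where "y t = (if t < L then vs ! (i + t) else vs ! i)" for t
    have "inj_on y {..<L}"
    proof (rule inj_onI)
      fix s t assume st: "s \<in> {..<L}" "t \<in> {..<L}" "y s = y t"
      then have "vs ! (i + s) = vs ! (i + t)" unfolding y_def by simp
      then have "i + s = i + t" using dist st ij unfolding L_def by (subst (asm) nth_eq_iff_index_eq) auto
      then show "s = t" by simp
    qed
    moreover have "(y t, y (Suc t)) \<in> E" if "t < L" for t
    proof (cases "Suc t < L")
      case True
      then show ?thesis unfolding y_def using adj[of "i + t"] ij unfolding L_def by simp
    next
      case False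
      then have "i + t = j" using that ij unfolding L_def by simp
      then show ?thesis unfolding y_def using False that ij by simp
    qed
    moreover have "3 \<le> L" unfolding L_def using ij \<open>Suc i \<noteq> j\<close> by simp
    ultimately have "vertex_cycle E L y" unfolding vertex_cycle_def y_def by auto
    then show False using cyc by blast
  qed
  have "E \<inter> set vs \<times> set vs = set (vwalk_arcs vs) \<union> (set (vwalk_arcs vs))\<inverse>" (is "?A = ?B")
  proof
    show "?A \<subseteq> ?B"
    proof (rule subrelI)
      fix u w assume "(u, w) \<in> ?A"
      then have uw: "(u, w) \<in> E" "u \<in> set vs" "w \<in> set vs" by auto
      obtain i j where ij: "i < length vs" "u = vs ! i" "j < length vs" "w = vs ! j"
        using uw by (metis in_set_conv_nth)
      have "i \<noteq> j" using E_irrefl uw(1) ij by auto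
      then consider "i < j" | "j < i" by linarith
      then show "(u, w) \<in> ?B"
      proof cases
        case 1
        then have "Suc i = j" using consec[of i j] ij E_sym[OF uw(1)] by simp
        then have "(u, w) \<in> set (vwalk_arcs vs)" unfolding vwalk_arcs_iff using ij by blast
        then show ?thesis by simp
      next
        case 2
        then have "Suc j = i" using consec[of j i] ij uw(1) by simp
        then have "(w, u) \<in> set (vwalk_arcs vs)" unfolding vwalk_arcs_iff using ij by blast
        then show ?thesis by simp
      qed
    qed
    show "?B \<subseteq> ?A" using adj E_sym by (auto simp: vwalk_arcs_iff)
  qed
  then show ?thesis unfolding spine_def using dist all unfolding V_def by blast
qed

text \<open>Vertices get the position of their spine vertex, so two disjoint edges of a caterpillar
  occupy disjoint sets of one or two consecutive positions.\<close>

lemma spine_positions: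
  assumes S: "S \<in> sccs_verts" and vs: "spine S vs"
  obtains pos where "\<forall>v. pos v \<le> length vs"
    "\<forall>u\<in>S. \<forall>u'\<in>S. \<forall>w w'. (u, w) \<in> E \<longrightarrow> (u', w') \<in> E \<longrightarrow> {u, w} \<inter> {u', w'} = {} \<longrightarrow>
      pos u < pos u' \<and> pos w < pos w' \<or> pos u' < pos u \<and> pos w' < pos w"
proof -
  have dist: "distinct vs" and set: "set vs = {v \<in> S. card (neighbours E v) \<noteq> 1}"
    and arcs: "E \<inter> set vs \<times> set vs = set (vwalk_arcs vs) \<union> (set (vwalk_arcs vs))\<inverse>"
    using vs unfolding spine_def by auto
  define idx where "idx v = (THE i. i < length vs \<and> vs ! i = v)" for v
  have idx: "idx (vs ! i) = i" if "i < length vs" for i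
    unfolding idx_def using that dist by (intro the_equality) (auto simp: nth_eq_iff_index_eq)
  define nb where "nb v = (THE w. neighbours E v = {w})" for v
  \<comment> \<open>Within \<open>S\<close> the default \<open>0\<close> is reached only if a leaf
    is joined to a leaf; such an edge is the entire component and has no disjoint partner in
    it.\<close>
  define pos where "pos v = (if v \<in> set vs then idx v else if nb v \<in> set vs then idx (nb v) else 0)" for v
  have bound: "pos v \<le> length vs" for v
  proof -
    have "idx x \<le> length vs" if "x \<in> set vs" for x using that idx by (auto simp: in_set_conv_nth)
    then show ?thesis unfolding pos_def by auto
  qed
  have leaf: "neighbours E u = {w}" if "u \<in> S" "u \<notin> set vs" "(u, w) \<in> E" for u w
  proof -
    have "card (neighbours E u) = 1" using that set by auto
    moreover have "w \<in> neighbours E u" using that unfolding neighbours_def by simp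
    ultimately show ?thesis by (metis card_1_singletonE singletonD)
  qed
  have edge: "\<exists>a b. a \<le> b \<and> b \<le> Suc a \<and> b < length vs \<and> vs ! a \<in> {u, w} \<and> vs ! b \<in> {u, w} \<and>
      pos u \<in> {a, b} \<and> pos w \<in> {a, b}" if u: "u \<in> S" and e: "(u, w) \<in> E" and sp: "u \<in> set vs \<or> w \<in> set vs" for u w
  proof -
    have w: "w \<in> S" using scc_closed[OF S u e] .
    have one: "\<exists>i. i < length vs \<and> vs ! i = x \<and> pos x = i \<and> pos z = i"
      if xz: "x \<in> set vs" "z \<notin> set vs" "z \<in> S" "(z, x) \<in> E" for x z
    proof -
      obtain i where i: "i < length vs" "vs ! i = x" using xz(1) by (metis in_set_conv_nth)
      have "nb z = x" unfolding nb_def using leaf[OF that(3,2,4)] by simp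
      then show ?thesis using i idx[OF i(1)] xz(1,2) unfolding pos_def by (intro exI[of _ i]) simp
    qed
    consider "u \<in> set vs" "w \<in> set vs" | "u \<in> set vs" "w \<notin> set vs" | "u \<notin> set vs" "w \<in> set vs" using sp by blast
    then show ?thesis
    proof cases
      case 1
      then have "(u, w) \<in> set (vwalk_arcs vs) \<or> (w, u) \<in> set (vwalk_arcs vs)" using arcs e by auto
      then obtain t where "Suc t < length vs" "(u = vs ! t \<and> w = vs ! Suc t) \<or> (w = vs ! t \<and> u = vs ! Suc t)"
        unfolding vwalk_arcs_iff by blast
      then show ?thesis using idx[of t] idx[of "Suc t"] 1 unfolding pos_def
        by (intro exI[of _ t] exI[of _ "Suc t"]) auto
    next
      case 2
      then obtain i where "i < length vs" "vs ! i = u" "pos u = i" "pos w = i"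
        using one[OF _ _ w E_sym[OF e]] by blast
      then show ?thesis by (intro exI[of _ i]) simp
    next
      case 3
      then obtain i where "i < length vs" "vs ! i = w" "pos w = i" "pos u = i"
        using one[OF _ _ u e] by blast
      then show ?thesis by (intro exI[of _ i]) simp
    qed
  qed
  have isolated: "v \<in> {u, w}" if uw: "u \<in> S" "(u, w) \<in> E" "u \<notin> set vs" "w \<notin> set vs" and v: "v \<in> S" for u v w
  proof (rule scc_connected[OF S uw(1) v])
    have "neighbours E u = {w}" "neighbours E w = {u}"
      using leaf[OF uw(1,3,2)] leaf[OF scc_closed[OF S uw(1,2)] uw(4) E_sym[OF uw(2)]] by auto
    then show "y \<in> {u, w}" if "x \<in> {u, w}" "(x, y) \<in> E" for x y
      using that unfolding neighbours_def by auto
  qed simp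
  have main: "pos u < pos u' \<and> pos w < pos w' \<or> pos u' < pos u \<and> pos w' < pos w"
    if u: "u \<in> S" "u' \<in> S" and e: "(u, w) \<in> E" "(u', w') \<in> E" and disj: "{u, w} \<inter> {u', w'} = {}" for u u' w w'
  proof -
    have "u \<in> set vs \<or> w \<in> set vs" using isolated[OF u(1) e(1) _ _ u(2)] disj by auto
    then obtain a b where ab: "a \<le> b" "b \<le> Suc a" "b < length vs" "vs ! a \<in> {u, w}" "vs ! b \<in> {u, w}"
      "pos u \<in> {a, b}" "pos w \<in> {a, b}" using edge[OF u(1) e(1)] by blast
    have "u' \<in> set vs \<or> w' \<in> set vs" using isolated[OF u(2) e(2) _ _ u(1)] disj by auto
    then obtain a' b' where ab': "a' \<le> b'" "b' \<le> Suc a'" "b' < length vs" "vs ! a' \<in> {u', w'}" "vs ! b' \<in> {u', w'}"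
      "pos u' \<in> {a', b'}" "pos w' \<in> {a', b'}" using edge[OF u(2) e(2)] by blast
    have "a \<noteq> a'" "a \<noteq> b'" "b \<noteq> a'" "b \<noteq> b'" using ab(4,5) ab'(4,5) disj by auto
    \<comment> \<open>Two disjoint sets, each of one or two consecutive numbers, cannot
      interleave.\<close>
    then have "b < a' \<or> b' < a" using ab(1,2) ab'(1,2) by linarith
    then show ?thesis using ab(1,6,7) ab'(1,6,7) by auto
  qed
  show thesis
  proof (rule that[of pos]; intro allI ballI impI)
    show "pos v \<le> length vs" for v by (rule bound)
  qed (rule main)
qed

text \<open>The key orders vertices lexicographically, by the number of their component and then by
  position; \<open>N\<close> exceeds every position, so the blocks of different components do not
  overlap.\<close>

lemma forest_keys:
  assumes "\<forall>S\<in>sccs_verts. \<exists>vs. spine S vs"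
  shows "\<exists>key :: 'a \<Rightarrow> nat. \<forall>u w u' w'. (u, w) \<in> E \<longrightarrow> (u', w') \<in> E \<longrightarrow> {u, w} \<inter> {u', w'} = {} \<longrightarrow>
    key u < key u' \<and> key w < key w' \<or> key u' < key u \<and> key w' < key w"
proof -
  define N where "N = Suc (card (verts G))"
  define Q where "Q S pos \<longleftrightarrow> (\<forall>v. pos v < N) \<and>
      (\<forall>u\<in>S. \<forall>u'\<in>S. \<forall>w w'. (u, w) \<in> E \<longrightarrow> (u', w') \<in> E \<longrightarrow> {u, w} \<inter> {u', w'} = {} \<longrightarrow>
      pos u < pos u' \<and> pos w < pos w' \<or> pos u' < pos u \<and> pos w' < pos w)" for S and pos :: "'a \<Rightarrow> nat"
  have ex: "\<exists>pos. Q S pos" if S: "S \<in> sccs_verts" for S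
  proof -
    obtain vs where vs: "spine S vs" using assms S by blast
    obtain pos where pos: "\<forall>v. pos v \<le> length vs"
      "\<forall>u\<in>S. \<forall>u'\<in>S. \<forall>w w'. (u, w) \<in> E \<longrightarrow> (u', w') \<in> E \<longrightarrow> {u, w} \<inter> {u', w'} = {} \<longrightarrow>
        pos u < pos u' \<and> pos w < pos w' \<or> pos u' < pos u \<and> pos w' < pos w"
      by (rule spine_positions[OF S vs])
    have "set vs \<subseteq> verts G" using vs sccs_verts_subsets[OF S] unfolding spine_def by auto
    then have "length vs \<le> card (verts G)"
      using card_mono[OF finite_verts, of "set vs"] distinct_card[of vs] vs unfolding spine_def by linarith
    then have "\<forall>v. pos v < N" unfolding N_def using pos(1) by (meson le_imp_less_Suc order_trans)
    then have "Q S pos" unfolding Q_def using pos(2) by (intro conjI)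
    then show ?thesis by (rule exI[where x = pos])
  qed
  define pos where "pos S = (SOME pos. Q S pos)" for S
  have Qpos: "Q S (pos S)" if "S \<in> sccs_verts" for S
    unfolding pos_def by (rule someI_ex[OF ex[OF that]])
  obtain num :: "'a set \<Rightarrow> nat" where num: "inj_on num sccs_verts"
    using finite_imp_inj_to_nat_seg[OF finite_sccs_verts] by blast
  define key where "key v = num (scc_of v) * N + pos (scc_of v) v" for v
  have less: "a * N + b < c * N + d" if "a < c" "b < N" for a b c d :: nat
  proof -
    have "a * N + b < Suc a * N" using that by simp
    also have "\<dots> \<le> c * N" using that by (intro mult_right_mono) auto
    finally show ?thesis by simp
  qed
  have "key u < key u' \<and> key w < key w' \<or> key u' < key u \<and> key w' < key w"
    if e: "(u, w) \<in> E" "(u', w') \<in> E" and disj: "{u, w} \<inter> {u', w'} = {}" for u w u' w'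
  proof -
    have V: "u \<in> verts G" "u' \<in> verts G" using E_verts e by auto
    then have S: "scc_of u \<in> sccs_verts" "scc_of u' \<in> sccs_verts" "u \<in> scc_of u" "u' \<in> scc_of u'"
      using scc_of_in_sccs_verts in_scc_of_self by auto
    have same: "scc_of w = scc_of u" "scc_of w' = scc_of u'"
      using scc_of_eq scc_closed[OF S(1,3) e(1)] scc_closed[OF S(2,4) e(2)] by auto
    show ?thesis
    proof (cases "scc_of u = scc_of u'")
      case True
      have "pos (scc_of u) u < pos (scc_of u) u' \<and> pos (scc_of u) w < pos (scc_of u) w' \<or>
          pos (scc_of u) u' < pos (scc_of u) u \<and> pos (scc_of u) w' < pos (scc_of u) w"
        using Qpos[OF S(1)] S(3,4) True e disj unfolding Q_def by simp
      then show ?thesis unfolding key_def same True by auto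
    next
      case False
      then have "num (scc_of u) \<noteq> num (scc_of u')" using num S unfolding inj_on_def by blast
      then consider "num (scc_of u) < num (scc_of u')" | "num (scc_of u') < num (scc_of u)" by linarith
      moreover have "pos (scc_of u) x < N" "pos (scc_of u') x < N" for x
        using Qpos[OF S(1)] Qpos[OF S(2)] unfolding Q_def by auto
      ultimately show ?thesis unfolding key_def same by cases (simp_all add: less)
    qed
  qed
  then show ?thesis by (intro exI[of _ key] allI impI)
qed

end

section \<open>The bipartite graph of a matrix\<close>

text \<open>If two legs ended in the same vertex, they would close a cycle of length four through
  \<open>v\<close>.\<close>

lemma (in simple_graph) spider_inj:
  assumes cyc: "\<nexists>L y. vertex_cycle E L y" and sp: "spider E v a b"
  shows "inj_on b {..<3}"
proof (rule inj_onI, rule ccontr)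
  fix s t assume st: "s \<in> {..<3::nat}" "t \<in> {..<3}" "b s = b t" "s \<noteq> t"
  have s: "(v, a s) \<in> E" "(a s, b s) \<in> E" "b s \<noteq> v" and t: "(v, a t) \<in> E" "(a t, b s) \<in> E"
    using sp st unfolding spider_def by auto
  have "a s \<noteq> a t" using sp st unfolding spider_def inj_on_def by auto
  moreover have "v \<noteq> a s" "v \<noteq> a t" "a s \<noteq> b s" "a t \<noteq> b s" using s t E_irrefl by metis+
  ultimately have dist: "distinct [v, a s, b s, a t]" using s(3) by auto
  define y where "y j = [v, a s, b s, a t, v] ! j" for j
  have "inj_on y {..<4}"
  proof (rule inj_onI)
    fix i j assume ij: "i \<in> {..<4::nat}" "j \<in> {..<4}" "y i = y j"
    then have "[v, a s, b s, a t] ! i = [v, a s, b s, a t] ! j"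
      unfolding y_def using nth_append[of "[v, a s, b s, a t]" "[v]"] by simp
    then show "i = j" using ij nth_eq_iff_index_eq[OF dist, of i j] by simp
  qed
  moreover have "(y j, y (Suc j)) \<in> E" if "j < 4" for j
  proof -
    from that consider "j = 0" | "j = 1" | "j = 2" | "j = 3" by linarith
    then show ?thesis using s t E_sym by cases (simp_all add: y_def)
  qed
  ultimately have "vertex_cycle E 4 y" unfolding vertex_cycle_def by (simp add: y_def)
  with cyc show False by blast
qed

context
  fixes A :: "real mat" and n m :: nat
  assumes A: "A \<in> carrier_mat n m"
begin

abbreviation (input) "\<Gamma> \<equiv> with_proj (bipartite_graph A)"

lemma bipartite_verts: "verts \<Gamma> = Inl ` {..<n} \<union> Inr ` {..<m}"
  using A unfolding bipartite_graph_def Let_def by simp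

lemma bipartite_arcs:
  "(Inl i, Inr j) \<in> parcs (bipartite_graph A) \<longleftrightarrow> i < n \<and> j < m \<and> A $$ (i, j) \<noteq> 0"
  "(Inr j, Inl i) \<in> parcs (bipartite_graph A) \<longleftrightarrow> i < n \<and> j < m \<and> A $$ (i, j) \<noteq> 0"
  "(Inl i, Inl i') \<notin> parcs (bipartite_graph A)" "(Inr j, Inr j') \<notin> parcs (bipartite_graph A)"
  using A unfolding bipartite_graph_def Let_def by auto

lemma bipartite_arcs_cases:
  assumes "(u, w) \<in> parcs (bipartite_graph A)"
  obtains i j where "u = Inl i" "w = Inr j" "i < n" "j < m" "A $$ (i, j) \<noteq> 0"
  | i j where "u = Inr j" "w = Inl i" "i < n" "j < m" "A $$ (i, j) \<noteq> 0"
  using assms by (cases u; cases w) (auto simp: bipartite_arcs)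

lemma bipartite_simple_graph: "simple_graph \<Gamma>"
proof
  have sub: "u \<in> verts \<Gamma> \<and> w \<in> verts \<Gamma>" if "(u, w) \<in> arcs \<Gamma>" for u w
    using that[unfolded with_proj_simps] unfolding bipartite_verts by (cases rule: bipartite_arcs_cases) auto
  show "tail \<Gamma> e \<in> verts \<Gamma>" "head \<Gamma> e \<in> verts \<Gamma>" if "e \<in> arcs \<Gamma>" for e
    using sub[of "fst e" "snd e"] that by auto
  show fin: "finite (verts \<Gamma>)" unfolding bipartite_verts by simp
  have "arcs \<Gamma> \<subseteq> verts \<Gamma> \<times> verts \<Gamma>" using sub by auto
  then show "finite (arcs \<Gamma>)" using fin by (meson finite_SigmaI finite_subset)
  show "tail \<Gamma> e \<noteq> head \<Gamma> e" if "e \<in> arcs \<Gamma>" for e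
    using that by (cases e) (auto elim: bipartite_arcs_cases)
  show "e1 = e2" if "arc_to_ends \<Gamma> e1 = arc_to_ends \<Gamma> e2" for e1 e2
    using that by (simp add: arc_to_ends_def prod_eq_iff)
  show "symmetric \<Gamma>"
  proof -
    have sy: "(w, u) \<in> parcs (bipartite_graph A)" if "(u, w) \<in> parcs (bipartite_graph A)" for u w
      using that by (cases rule: bipartite_arcs_cases) (auto simp: bipartite_arcs)
    show ?thesis unfolding symmetric_def with_proj_simps by (rule symI, rule sy)
  qed
qed simp_all

interpretation simple_graph \<Gamma> by (rule bipartite_simple_graph)

lemma caterpillar_forest_qual_power:
  assumes "caterpillar_forest \<Gamma>"
  shows "qual_power k A \<subseteq> P0_matrices \<inter> PS_matrices"
proof -
  have cyc: "\<nexists>L y. vertex_cycle (arcs \<Gamma>) L y"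
    using assms unfolding caterpillar_forest_def graph_forest_iff by (elim conjE)
  have spines: "\<forall>S\<in>sccs_verts. \<exists>vs. spine S vs"
    by (rule iffD1[OF caterpillar_forest_iff_spines[OF cyc] assms])
  obtain key :: "nat + nat \<Rightarrow> nat" where key: "\<forall>u w u' w'. (u, w) \<in> arcs \<Gamma> \<longrightarrow> (u', w') \<in> arcs \<Gamma> \<longrightarrow>
      {u, w} \<inter> {u', w'} = {} \<longrightarrow> key u < key u' \<and> key w < key w' \<or> key u' < key u \<and> key w' < key w"
    using forest_keys[OF spines] by (elim exE)
  have "monotone_keys {(i, j). i < n \<and> j < m \<and> A $$ (i, j) \<noteq> 0} (\<lambda>i. key (Inl i)) (\<lambda>j. key (Inr j))"
    unfolding monotone_keys_def
  proof (intro allI impI)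
    fix x y x' y'
    assume "(x, y) \<in> {(i, j). i < n \<and> j < m \<and> A $$ (i, j) \<noteq> 0}" "(x', y') \<in> {(i, j). i < n \<and> j < m \<and> A $$ (i, j) \<noteq> 0}"
      and ne: "x \<noteq> x'" "y \<noteq> y'"
    then have "(Inl x, Inr y) \<in> arcs \<Gamma>" "(Inl x', Inr y') \<in> arcs \<Gamma>" by (auto simp: bipartite_arcs)
    then show "key (Inl x) < key (Inl x') \<and> key (Inr y) < key (Inr y') \<or>
        key (Inl x') < key (Inl x) \<and> key (Inr y') < key (Inr y)"
      by (rule key[rule_format]) (use ne in auto)
  qed
  then show ?thesis by (rule monotone_keys_qual_power[OF A])
qed

text \<open>The two sides of the graph alternate along a cycle, so its length is even, at least
  four, and it splits into equally many rows and columns.\<close>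

lemma vertex_cycle_closure_eigenvalue:
  assumes y: "vertex_cycle (arcs \<Gamma>) L y" and k: "k \<ge> 2"
  shows "closure_eigenvalue A k (-1)"
proof -
  have L: "3 \<le> L" and inj: "inj_on y {..<L}" and yL: "y L = y 0" and adj: "\<And>j. j < L \<Longrightarrow> (y j, y (Suc j)) \<in> arcs \<Gamma>"
    using y unfolding vertex_cycle_def by auto
  define z where "z j = y (j mod L)" for j
  have zadj: "(z j, z (Suc j)) \<in> arcs \<Gamma>" for j
  proof -
    have "y (Suc (j mod L)) = y (Suc j mod L)" using yL by (simp add: mod_Suc)
    then show ?thesis using adj[of "j mod L"] L unfolding z_def by simp
  qed
  have zper: "z (j + L) = z j" for j unfolding z_def by simp
  \<comment> \<open>The offset makes the cycle start at a column, so that row \<open>r t\<close>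
    lies between the columns \<open>q t\<close> and \<open>q (Suc t)\<close>.\<close>
  obtain d where d: "d \<le> 1" "\<not> isl (z d)"
  proof (cases "isl (z 0)")
    case True
    then have "\<not> isl (z 1)" using zadj[of 0] by (auto elim: bipartite_arcs_cases)
    then show thesis using that[of 1] by simp
  next
    case False
    then show thesis using that[of 0] by simp
  qed
  have flip: "isl (z (Suc j)) \<longleftrightarrow> \<not> isl (z j)" for j using zadj[of j] by (auto elim: bipartite_arcs_cases)
  have alt: "isl (z (d + j)) \<longleftrightarrow> odd j" for j by (induction j) (auto simp: d flip)
  have "even L" using alt[of L] zper[of d] d by simp
  then obtain l where l: "L = 2 * l" by blast
  have l2: "l \<ge> 2" using L l by simp
  have zinj: "i = j" if "z (d + i) = z (d + j)" "i < L" "j < L" for i j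
  proof -
    have "(d + i) mod L = (d + j) mod L"
      by (rule inj_onD[OF inj that(1)[unfolded z_def]]) (use L in auto)
    note eq = this
    show ?thesis
    proof (cases "d = 0")
      case True
      then show ?thesis using eq that(2,3) by simp
    next
      case False
      then have "Suc i mod L = Suc j mod L" using eq d(1) by (simp add: le_Suc_eq)
      then show ?thesis using that(2,3) by (cases "Suc i = L"; cases "Suc j = L") auto
    qed
  qed
  define q where "q t = projr (z (d + 2 * t))" for t
  define r where "r t = projl (z (d + (2 * t + 1)))" for t
  have zq: "z (d + 2 * t) = Inr (q t)" for t unfolding q_def using alt[of "2 * t"] by (cases "z (d + 2 * t)") auto
  have zr: "z (d + (2 * t + 1)) = Inl (r t)" for t unfolding r_def using alt[of "2 * t + 1"] by (auto simp: isl_def)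
  have e1: "r t < n \<and> q t < m \<and> A $$ (r t, q t) \<noteq> 0" for t
    using zadj[of "d + 2 * t"] zq[of t] zr[of t] by (simp add: bipartite_arcs)
  have e2: "A $$ (r t, q (Suc t)) \<noteq> 0" for t
    using zadj[of "d + (2 * t + 1)"] zq[of "Suc t"] zr[of t] by (simp add: bipartite_arcs)
  have "Inr (q l) = Inr (q 0)" using zper[of d] zq[of 0] zq[of l] l by simp
  then have ql: "q l = q 0" by simp
  show ?thesis
  proof (rule cycle_closure_eigenvalue[OF A l2 _ _ _ k])
    show "inj_on r {..<l}"
    proof (rule inj_onI)
      fix s t assume st: "s \<in> {..<l}" "t \<in> {..<l}" "r s = r t"
      then have "z (d + (2 * s + 1)) = z (d + (2 * t + 1))" unfolding zr by simp
      then have "2 * s + 1 = 2 * t + 1" by (rule zinj) (use st l in auto)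
      then show "s = t" by simp
    qed
    show "inj_on q {..<l}"
    proof (rule inj_onI)
      fix s t assume st: "s \<in> {..<l}" "t \<in> {..<l}" "q s = q t"
      then have "z (d + 2 * s) = z (d + 2 * t)" unfolding zq by simp
      then have "2 * s = 2 * t" by (rule zinj) (use st l in auto)
      then show "s = t" by simp
    qed
    fix t assume t: "t < l"
    have "A $$ (r t, q (Suc t mod l)) \<noteq> 0"
      using e2[of t] ql t by (cases "Suc t = l") auto
    then show "r t < n \<and> q t < m \<and> A $$ (r t, q t) \<noteq> 0 \<and> A $$ (r t, q (Suc t mod l)) \<noteq> 0" using e1[of t] by simp
  qed
qed

text \<open>A spider centred at a column gives the eigenvalues directly. One centred at a row gives
  them for the transpose, from which they carry over because they are nonzero.\<close>

lemma spider_matrix_closure_eigenvalue: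
  assumes cyc: "\<nexists>L y. vertex_cycle (arcs \<Gamma>) L y" and sp: "spider (arcs \<Gamma>) v a b"
  shows "closure_eigenvalue A 3 (-1)" "closure_eigenvalue A 2 (Complex 6 2)"
proof -
  note binj = spider_inj[OF cyc sp]
  have ainj: "inj_on a {..<3}" and e: "\<And>t. t < 3 \<Longrightarrow> (v, a t) \<in> arcs \<Gamma> \<and> (a t, b t) \<in> arcs \<Gamma> \<and> b t \<noteq> v"
    using sp unfolding spider_def by auto
  have factor: "inj_on f {..<3}" if "inj_on g {..<3}" "\<And>t. t < 3 \<Longrightarrow> g t = h (f t)"
    for f :: "nat \<Rightarrow> nat" and g :: "nat \<Rightarrow> nat + nat" and h
  proof (rule inj_onI)
    fix s t assume st: "s \<in> {..<3::nat}" "t \<in> {..<3}" "f s = f t"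
    then have "g s = g t" using that(2)[of s] that(2)[of t] by simp
    then show "s = t" by (rule inj_onD[OF that(1)]) (use st in auto)
  qed
  have "closure_eigenvalue A 3 (-1) \<and> closure_eigenvalue A 2 (Complex 6 2)"
  proof (cases v)
    case (Inr c)
    define r q where "r t = projl (a t)" and "q t = projr (b t)" for t
    have ab: "a t = Inl (r t)" "b t = Inr (q t)" if "t < 3" for t
      using e[OF that] Inr unfolding r_def q_def by (auto elim!: bipartite_arcs_cases)
    have nz: "r t < n \<and> q t < m \<and> A $$ (r t, c) \<noteq> 0 \<and> A $$ (r t, q t) \<noteq> 0 \<and> q t \<noteq> c" "c < m" if "t < 3" for t
      using e[OF that] ab[OF that] Inr by (auto simp: bipartite_arcs)
    have r: "inj_on r {..<3}" by (rule factor[OF ainj]) (simp add: ab)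
    have q: "inj_on q {..<3}" by (rule factor[OF binj]) (simp add: ab)
    have c: "c < m" "c \<notin> q ` {..<3}" using nz(2)[of 0] nz(1) by auto
    have nz': "r t < n \<and> q t < m \<and> A $$ (r t, c) \<noteq> 0 \<and> A $$ (r t, q t) \<noteq> 0" if "t < 3" for t
      using nz(1)[OF that] by simp
    show ?thesis
      by (rule conjI[OF spider_closure_eigenvalue[OF A r q c nz']])
  next
    case (Inl c)
    define r q where "r t = projr (a t)" and "q t = projl (b t)" for t
    have ab: "a t = Inr (r t)" "b t = Inl (q t)" if "t < 3" for t
      using e[OF that] Inl unfolding r_def q_def by (auto elim!: bipartite_arcs_cases)
    have nz: "r t < m \<and> q t < n \<and> A\<^sup>T $$ (r t, c) \<noteq> 0 \<and> A\<^sup>T $$ (r t, q t) \<noteq> 0 \<and> q t \<noteq> c" "c < n" if "t < 3" for t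
      using e[OF that] ab[OF that] Inl A by (auto simp: bipartite_arcs)
    have r: "inj_on r {..<3}" by (rule factor[OF ainj]) (simp add: ab)
    have q: "inj_on q {..<3}" by (rule factor[OF binj]) (simp add: ab)
    have c: "c < n" "c \<notin> q ` {..<3}" using nz(2)[of 0] nz(1) by auto
    have AT: "A\<^sup>T \<in> carrier_mat m n" using A by simp
    have nz': "r t < m \<and> q t < n \<and> A\<^sup>T $$ (r t, c) \<noteq> 0 \<and> A\<^sup>T $$ (r t, q t) \<noteq> 0" if "t < 3" for t
      using nz(1)[OF that] by simp
    note ev = spider_closure_eigenvalue[OF AT r q c nz']
    show ?thesis
      by (rule conjI[OF closure_eigenvalue_transpose[OF ev(1)] closure_eigenvalue_transpose[OF ev(2)]])
        (simp_all add: complex_eq_iff)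
  qed
  then show "closure_eigenvalue A 3 (-1)" "closure_eigenvalue A 2 (Complex 6 2)" by auto
qed

lemma caterpillar_forestI:
  assumes "\<And>L y. \<not> vertex_cycle (arcs \<Gamma>) L y" "\<And>v a b. \<not> spider (arcs \<Gamma>) v a b"
  shows "caterpillar_forest \<Gamma>"
proof -
  have c: "\<nexists>L y. vertex_cycle (arcs \<Gamma>) L y" and s: "\<nexists>v a b. spider (arcs \<Gamma>) v a b" using assms by simp_all
  show ?thesis unfolding caterpillar_forest_iff_spines[OF c] using spine_exists[OF _ c s] by (intro ballI)
qed

lemma P0_caterpillar_forest:
  assumes "qual_power 3 A \<subseteq> P0_matrices"
  shows "caterpillar_forest \<Gamma>"
proof -
  have no: "\<not> closure_eigenvalue A 3 (-1)" by (rule closure_eigenvalue_P0[OF A assms])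
  have c: "\<not> vertex_cycle (arcs \<Gamma>) L y" for L y
    using no vertex_cycle_closure_eigenvalue[of L y 3] by auto
  then have c': "\<nexists>L y. vertex_cycle (arcs \<Gamma>) L y" by simp
  show ?thesis
    by (rule caterpillar_forestI[OF c]) (rule notI, rule notE[OF no spider_matrix_closure_eigenvalue(1)[OF c']])
qed

lemma PS_caterpillar_forest:
  assumes "qual_power 2 A \<subseteq> PS_matrices"
  shows "caterpillar_forest \<Gamma>"
proof -
  have no: "\<not> closure_eigenvalue A 2 (-1)" "\<not> closure_eigenvalue A 2 (Complex 6 2)"
    using closure_eigenvalue_PS[OF A assms, of "-1"] closure_eigenvalue_PS[OF A assms, of "Complex 6 2"]
    by (auto simp: complex_is_Real_iff)
  have c: "\<not> vertex_cycle (arcs \<Gamma>) L y" for L y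
    using no(1) vertex_cycle_closure_eigenvalue[of L y 2] by auto
  then have c': "\<nexists>L y. vertex_cycle (arcs \<Gamma>) L y" by simp
  show ?thesis
    by (rule caterpillar_forestI[OF c]) (rule notI, rule notE[OF no(2) spider_matrix_closure_eigenvalue(2)[OF c']])
qed

end

theorem theorem3:
  fixes A :: "real mat" and n m :: nat
  assumes "A \<in> carrier_mat n m"
  shows "(caterpillar_forest (with_proj (bipartite_graph A)) \<longleftrightarrow> qual_power 3 A \<subseteq> P0_matrices)
    \<and> (qual_power 3 A \<subseteq> P0_matrices \<longleftrightarrow> qual_power 2 A \<subseteq> PS_matrices)
    \<and> (qual_power 2 A \<subseteq> PS_matrices \<longleftrightarrow> (\<forall>k\<ge>1. qual_power k A \<subseteq> P0_matrices))
    \<and> ((\<forall>k\<ge>1. qual_power k A \<subseteq> P0_matrices) \<longleftrightarrow> (\<forall>k\<ge>1. qual_power k A \<subseteq> PS_matrices))"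
proof -
  let ?cat = "caterpillar_forest (with_proj (bipartite_graph A))"
  have all: "qual_power k A \<subseteq> P0_matrices \<and> qual_power k A \<subseteq> PS_matrices" if ?cat for k
    using caterpillar_forest_qual_power[OF assms that, of k] by simp
  have P0: "?cat" if "qual_power 3 A \<subseteq> P0_matrices" using P0_caterpillar_forest[OF assms that] .
  have PS: "?cat" if "qual_power 2 A \<subseteq> PS_matrices" using PS_caterpillar_forest[OF assms that] .
  have "?cat" if "\<forall>k\<ge>1. qual_power k A \<subseteq> P0_matrices" using P0 that by simp
  moreover have "?cat" if "\<forall>k\<ge>1. qual_power k A \<subseteq> PS_matrices" using PS that by simp
  ultimately show ?thesis using all P0 PS by blast
qed

end
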